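(* Let $Q$ be a quasi-order with finite ground set, let $(H,f_H)$ be a legal $Q$-labelled graph, let $\mathcal G$ be a hereditary nowhere dense class of legal $Q$-labelled graphs, and let $\mathcal H$ be a consistent set of homomorphisms from $(H,f_H)$ to $\mathcal G$. Then $$\limsup_{n\to\infty}\frac{\log \mathrm{ex}(H,f_H,\mathcal H,\mathcal G,n)}{\log n}=\mathrm{dup}_{\mathcal H}(H,f_H,\mathcal G).$$
   Context: All graphs are finite and simple. A separation of a graph $G$ is an ordered pair $(A,B)$ of subsets of $V(G)$ with $A\cup B=V(G)$ such that no edge of $G$ joins $A\setminus B$ and $B\setminus A$; its order is $|A\cap B|$. A collection $\mathcal C$ of separations of $G$ is independent if $A\setminus B\neq\emptyset$ for every $(A,B)\in\mathcal C$ and, for any distinct $(A,B),(C,D)\in\mathcal C$, $A\subseteq D$ and $C\subseteq B$. For $S\subseteq V(G)$, $N_G[S]$ is the set of vertices that are in $S$ or adjacent to a vertex of $S$. Labelled graphs. A march in $G$ is a finite sequence of pairwise distinct vertices of $G$. A labelling of $G$ is a function whose domain is a set of marches in $G$; it is legal if for every march in its domain, the entries form a clique of $G$. A quasi-order is a pair $Q=(X,\preceq)$ with $\preceq$ a reflexive and transitive relation on $X$. A $Q$-labelled graph is a pair $(G,f_G)$ where $f_G$ is a labelling of $G$ with image contained in $X$; it is legal if $f_G$ is legal. For a function $\phi$ and a march $m=(m_1,\dots,m_n)$, $\phi(m)=(\phi(m_1),\dots,\phi(m_n))$. An isomorphism from $(H,f_H)$ to $(G,f_G)$ is a graph isomorphism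 $\phi:V(H)\to V(G)$ such that for each march $m$ in the domain of $f_H$, $\phi(m)$ is in the domain of $f_G$ and $f_H(m)=f_G(\phi(m))$, and for each march $m'$ in the domain of $f_G$, $\phi^{-1}(m')$ is in the domain of $f_H$. $(H,f_H)$ is an induced subgraph of $(G,f_G)$ if $H$ is an induced subgraph of $G$, the domain of $f_H$ is contained in that of $f_G$, and every march in the domain of $f_G$ with all entries in $V(H)$ is in the domain of $f_H$ and has the same value under $f_H$ and $f_G$. A class of $Q$-labelled graphs is hereditary if it contains every induced subgraph of each of its members. $(H',f_{H'})$ is a subgraph of $(G,f_G)$ if $H'$ is a subgraph of $G$, the domain of $f_{H'}$ is contained in that of $f_G$, and $f_{H'}(m)=f_G(m)$ for every $m$ in the domain of $f_{H'}$; it is spanning if moreover $V(H')=V(G)$. A homomorphism from a legal $Q$-labelled graph $(H,f_H)$ to a $Q$-labelled graph $(G,f_G)$ is a graph homomorphism $\phi:V(H)\to V(G)$ such that for every march $m$ in the domain of $f_H$, $\phi(m)$ is in the domain of $f_G$ and $f_H(m)\preceq f_G(\phi(m))$. A set of homomorphisms from $(H,f_H)$ to a class $\mathcal G$ is a set each of whose members is a homomorphism from $(H,f_H)$ to some member of $\mathcal G$ (each homomorphism being regarded as a function with specified codomain). Consistency. Let $\mathcal G$ be a hereditary class of legal $Q$-labelled graphs and $\mathcal H$ a set of homomorphisms from a legal $Q$-labelled graph $(H,f_H)$ to $\mathcal G$. $\mathcal H$ is consistent if: (CON1) for every $\phi\in\mathcal H$ from $(H,f_H)$ to $(G,f)\in\mathcal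 G$: if $(G',f')$ is an induced subgraph of $(G,f)$ with $\phi(V(H))\subseteq V(G')$, then $\phi$ with codomain restricted to $V(G')$ is a homomorphism to $(G',f')$ belonging to $\mathcal H$; and if $(G,f)$ is an induced subgraph of some $(G',f')\in\mathcal G$, then $\phi$ with codomain changed to $V(G')$ is a homomorphism to $(G',f')$ belonging to $\mathcal H$; (CON2) if $\iota$ is an isomorphism from $(G_1,f_1)\in\mathcal G$ to $(G_2,f_2)\in\mathcal G$ and $\phi\in\mathcal H$ is a homomorphism to $(G_1,f_1)$, then $\iota\circ\phi\in\mathcal H$; (CON3) if $(G_1,f_1),(G_2,f_2)\in\mathcal G$, $\iota$ is an isomorphism from $(G_2,f_2)$ to a spanning subgraph $(G_1',f_1')$ of $(G_1,f_1)$, and $\phi\in\mathcal H$ is a homomorphism to $(G_1,f_1)$ that is also a homomorphism to $(G_1',f_1')$, then $\iota^{-1}\circ\phi$ is a homomorphism from $(H,f_H)$ to $(G_2,f_2)$ and belongs to $\mathcal H$. Counting. $\mathrm{ex}(H,f_H,\mathcal H,\mathcal G,n)$ is the maximum, over all $(G,f_G)\in\mathcal G$ with $|V(G)|=n$, of the number of members of $\mathcal H$ that are homomorphisms from $(H,f_H)$ to $(G,f_G)$. Duplication. For a labelled graph $(H,f_H)$, an independent collection $\mathcal L$ of separations of $H$ and a positive integer $w$, $(H,f_H)\wedge_w\mathcal L$ is the labelled graph $(G,f_G)$ obtained from $w$ disjoint isomorphic copies $(G_1,f_{G_1}),\dots,(G_w,f_{G_w})$ of $(H,f_H)$ by identifying,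 for each $v\in\bigcap_{(A,B)\in\mathcal L}B$, the $w$ copies of $v$ into a single vertex $v^G$; the domain of $f_G$ consists exactly of the marches $m^G$, where $m$ is a march in the domain of some $f_{G_i}$ and $m^G$ is obtained from $m$ by replacing each entry that is a copy of such a $v$ by $v^G$, and $f_G(m^G)=f_{G_i}(m)$. $\mathcal L$ is $\mathcal G$-duplicable if $(H,f_H)\wedge_k\mathcal L\in\mathcal G$ for infinitely many positive integers $k$. $\mathcal L$ is $(\mathcal G,\mathcal H)$-duplicable if there exist a $Q$-labelled graph $(G,f_G)$ and an onto homomorphism $\phi\in\mathcal H$ from $(H,f_H)$ to $(G,f_G)$ such that $\phi(A\setminus B)\cap\phi(B)=\emptyset$ for every $(A,B)\in\mathcal L$, and $\{(N_G[\phi(A\setminus B)],V(G)\setminus\phi(A\setminus B)):(A,B)\in\mathcal L\}$ is a $\mathcal G$-duplicable independent collection of separations of $(G,f_G)$ of size $|\mathcal L|$. $\mathrm{dup}_{\mathcal H}(H,f_H,\mathcal G)$ is the maximum size of a $(\mathcal G,\mathcal H)$-duplicable independent collection of separations of $H$. Sparsity. The radius of a connected graph is the least $k$ such that some vertex has distance at most $k$ from every vertex. For $\ell\ge0$, a graph $L$ is an $\ell$-shallow minor of $G$ if $L$ is isomorphic to a graph obtained from a subgraph of $G$ by contracting pairwise disjoint connected subgraphs each of radius at most $\ell$. A class of graphs is somewhere dense if there is an integer $t$ such that every complete graph is a $t$-shallow minor of some member; it is nowhere dense otherwise. A class of labelled graphs is nowhere dense if the class of its underlying graphs is. *)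

theory Defs
  imports Complex_Main "HOL-Library.Extended_Real" "HOL-Library.Liminf_Limsup" "HOL-Library.FuncSet"
begin

type_synonym 'x qorder = "'x set \<times> ('x \<Rightarrow> 'x \<Rightarrow> bool)"

definition quasi_order :: "'x qorder \<Rightarrow> bool" where
  "quasi_order Q \<longleftrightarrow> (\<forall>x\<in>fst Q. snd Q x x) \<and>
     (\<forall>x\<in>fst Q. \<forall>y\<in>fst Q. \<forall>z\<in>fst Q. snd Q x y \<longrightarrow> snd Q y z \<longrightarrow> snd Q x z)"

record ('a, 'x) lgraph =
  verts :: "'a set"
  edges :: "('a \<times> 'a) set"
  lab :: "'a list \<Rightarrow> 'x option"

definition wf_graph :: "('a, 'x) lgraph \<Rightarrow> bool" where
  "wf_graph G \<longleftrightarrow> finite (verts G) \<and> edges G \<subseteq> verts G \<times> verts G \<and>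
     (\<forall>u v. (u, v) \<in> edges G \<longrightarrow> (v, u) \<in> edges G) \<and> (\<forall>v. (v, v) \<notin> edges G)"

definition march :: "('a, 'x) lgraph \<Rightarrow> 'a list \<Rightarrow> bool" where
  "march G m \<longleftrightarrow> distinct m \<and> set m \<subseteq> verts G"

definition labelled_graph :: "('a, 'x) lgraph \<Rightarrow> bool" where
  "labelled_graph G \<longleftrightarrow> wf_graph G \<and> (\<forall>m\<in>dom (lab G). march G m)"

definition q_labelled :: "'x qorder \<Rightarrow> ('a, 'x) lgraph \<Rightarrow> bool" where
  "q_labelled Q G \<longleftrightarrow> labelled_graph G \<and> ran (lab G) \<subseteq> fst Q"

definition legal :: "('a, 'x) lgraph \<Rightarrow> bool" where
  "legal G \<longleftrightarrow> (\<forall>m\<in>dom (lab G). \<forall>u\<in>set m. \<forall>v\<in>set m. u \<noteq> v \<longrightarrow> (u, v) \<in> edges G)"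

definition legal_q_labelled :: "'x qorder \<Rightarrow> ('a, 'x) lgraph \<Rightarrow> bool" where
  "legal_q_labelled Q G \<longleftrightarrow> q_labelled Q G \<and> legal G"

definition lisomorphism :: "('a \<Rightarrow> 'b) \<Rightarrow> ('a, 'x) lgraph \<Rightarrow> ('b, 'x) lgraph \<Rightarrow> bool" where
  "lisomorphism \<iota> H G \<longleftrightarrow> bij_betw \<iota> (verts H) (verts G) \<and>
     (\<forall>u\<in>verts H. \<forall>v\<in>verts H. (u, v) \<in> edges H \<longleftrightarrow> (\<iota> u, \<iota> v) \<in> edges G) \<and>
     (\<forall>m\<in>dom (lab H). map \<iota> m \<in> dom (lab G) \<and> lab H m = lab G (map \<iota> m)) \<and>
     (\<forall>m'\<in>dom (lab G). map (inv_into (verts H) \<iota>) m' \<in> dom (lab H))"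

definition isomorphic :: "('a, 'x) lgraph \<Rightarrow> ('b, 'x) lgraph \<Rightarrow> bool" where
  "isomorphic H G \<longleftrightarrow> (\<exists>\<iota>. lisomorphism \<iota> H G)"

definition induced_subgraph :: "('a, 'x) lgraph \<Rightarrow> ('a, 'x) lgraph \<Rightarrow> bool" where
  "induced_subgraph H G \<longleftrightarrow> labelled_graph H \<and> verts H \<subseteq> verts G \<and>
     edges H = edges G \<inter> (verts H \<times> verts H) \<and>
     dom (lab H) \<subseteq> dom (lab G) \<and>
     (\<forall>m\<in>dom (lab G). set m \<subseteq> verts H \<longrightarrow> m \<in> dom (lab H) \<and> lab H m = lab G m)"

definition hereditary :: "('a, 'x) lgraph set \<Rightarrow> bool" where
  "hereditary \<G> \<longleftrightarrow> (\<forall>G\<in>\<G>. \<forall>H. induced_subgraph H G \<longrightarrow> H \<in> \<G>)"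

definition lsubgraph :: "('a, 'x) lgraph \<Rightarrow> ('a, 'x) lgraph \<Rightarrow> bool" where
  "lsubgraph H G \<longleftrightarrow> labelled_graph H \<and> verts H \<subseteq> verts G \<and> edges H \<subseteq> edges G \<and>
     dom (lab H) \<subseteq> dom (lab G) \<and> (\<forall>m\<in>dom (lab H). lab H m = lab G m)"

definition spanning_subgraph :: "('a, 'x) lgraph \<Rightarrow> ('a, 'x) lgraph \<Rightarrow> bool" where
  "spanning_subgraph H G \<longleftrightarrow> lsubgraph H G \<and> verts H = verts G"

definition lhom :: "'x qorder \<Rightarrow> ('a, 'x) lgraph \<Rightarrow> ('b, 'x) lgraph \<Rightarrow> ('a \<Rightarrow> 'b) \<Rightarrow> bool" where
  "lhom Q H G \<phi> \<longleftrightarrow> (\<forall>v\<in>verts H. \<phi> v \<in> verts G) \<and>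
     (\<forall>u v. (u, v) \<in> edges H \<longrightarrow> (\<phi> u, \<phi> v) \<in> edges G) \<and>
     (\<forall>m\<in>dom (lab H). map \<phi> m \<in> dom (lab G) \<and>
        snd Q (the (lab H m)) (the (lab G (map \<phi> m))))"

text \<open>A homomorphism with specified codomain is represented as a pair (phi, G), where
  phi is extensional on V(H) (i.e. a genuine function V(H) -> V(G)).\<close>
definition hom_set :: "'x qorder \<Rightarrow> ('h, 'x) lgraph \<Rightarrow> ('v, 'x) lgraph set
    \<Rightarrow> (('h \<Rightarrow> 'v) \<times> ('v, 'x) lgraph) set \<Rightarrow> bool" where
  "hom_set Q H \<G> \<H> \<longleftrightarrow> (\<forall>(\<phi>, G)\<in>\<H>. G \<in> \<G> \<and> lhom Q H G \<phi> \<and> \<phi> \<in> extensional (verts H))"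

definition consistent :: "'x qorder \<Rightarrow> ('h, 'x) lgraph \<Rightarrow> ('v, 'x) lgraph set
    \<Rightarrow> (('h \<Rightarrow> 'v) \<times> ('v, 'x) lgraph) set \<Rightarrow> bool" where
  "consistent Q H \<G> \<H> \<longleftrightarrow>
     \<comment> \<open>CON1\<close>
     (\<forall>(\<phi>, G)\<in>\<H>.
        (\<forall>G'. induced_subgraph G' G \<and> \<phi> ` verts H \<subseteq> verts G' \<longrightarrow>
              lhom Q H G' \<phi> \<and> (\<phi>, G') \<in> \<H>) \<and>
        (\<forall>G'\<in>\<G>. induced_subgraph G G' \<longrightarrow> lhom Q H G' \<phi> \<and> (\<phi>, G') \<in> \<H>)) \<and>
     \<comment> \<open>CON2\<close>
     (\<forall>G1\<in>\<G>. \<forall>G2\<in>\<G>. \<forall>\<iota> \<phi>. lisomorphism \<iota> G1 G2 \<and> (\<phi>, G1) \<in> \<H> \<longrightarrow>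
        (restrict (\<iota> \<circ> \<phi>) (verts H), G2) \<in> \<H>) \<and>
     \<comment> \<open>CON3\<close>
     (\<forall>G1\<in>\<G>. \<forall>G2\<in>\<G>. \<forall>G1' \<iota> \<phi>.
        spanning_subgraph G1' G1 \<and> lisomorphism \<iota> G2 G1' \<and> (\<phi>, G1) \<in> \<H> \<and> lhom Q H G1' \<phi> \<longrightarrow>
        lhom Q H G2 (restrict (inv_into (verts G2) \<iota> \<circ> \<phi>) (verts H)) \<and>
        (restrict (inv_into (verts G2) \<iota> \<circ> \<phi>) (verts H), G2) \<in> \<H>)"

definition ex_count :: "('h, 'x) lgraph \<Rightarrow> (('h \<Rightarrow> 'v) \<times> ('v, 'x) lgraph) set
    \<Rightarrow> ('v, 'x) lgraph set \<Rightarrow> nat \<Rightarrow> nat" where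
  "ex_count H \<H> \<G> n = Sup {card {\<phi>. (\<phi>, G) \<in> \<H>} | G. G \<in> \<G> \<and> card (verts G) = n}"

definition separation :: "('a, 'x) lgraph \<Rightarrow> 'a set \<times> 'a set \<Rightarrow> bool" where
  "separation G S \<longleftrightarrow> (case S of (A, B) \<Rightarrow>
     A \<subseteq> verts G \<and> B \<subseteq> verts G \<and> A \<union> B = verts G \<and>
     (\<forall>u\<in>A - B. \<forall>v\<in>B - A. (u, v) \<notin> edges G))"

definition independent_coll :: "('a, 'x) lgraph \<Rightarrow> ('a set \<times> 'a set) set \<Rightarrow> bool" where
  "independent_coll G \<L> \<longleftrightarrow> (\<forall>S\<in>\<L>. separation G S) \<and>
     (\<forall>(A, B)\<in>\<L>. A - B \<noteq> {}) \<and>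
     (\<forall>(A, B)\<in>\<L>. \<forall>(C, D)\<in>\<L>. (A, B) \<noteq> (C, D) \<longrightarrow> A \<subseteq> D \<and> C \<subseteq> B)"

definition closed_nbhd :: "('a, 'x) lgraph \<Rightarrow> 'a set \<Rightarrow> 'a set" where
  "closed_nbhd G S = S \<union> {v \<in> verts G. \<exists>u\<in>S. (u, v) \<in> edges G}"

text \<open>The duplication (G, f_G) \<and>_w L, realised concretely on vertex type 'a \<times> nat:
  copy i of v is (v, i), except that vertices in the intersection of all B are identified
  into the single vertex (v, 0).\<close>
definition dup_core :: "('a set \<times> 'a set) set \<Rightarrow> ('a, 'x) lgraph \<Rightarrow> 'a set" where
  "dup_core \<L> G = verts G \<inter> (\<Inter>(A, B)\<in>\<L>. B)"

definition dup_copy :: "('a set \<times> 'a set) set \<Rightarrow> ('a, 'x) lgraph \<Rightarrow> nat \<Rightarrow> 'a \<Rightarrow> 'a \<times> nat" where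
  "dup_copy \<L> G i v = (if v \<in> dup_core \<L> G then (v, 0) else (v, i))"

definition duplicate :: "('a, 'x) lgraph \<Rightarrow> ('a set \<times> 'a set) set \<Rightarrow> nat \<Rightarrow> ('a \<times> nat, 'x) lgraph" where
  "duplicate G \<L> w =
     \<lparr> verts = {dup_copy \<L> G i v | i v. i < w \<and> v \<in> verts G},
       edges = {(dup_copy \<L> G i u, dup_copy \<L> G i v) | i u v. i < w \<and> (u, v) \<in> edges G},
       lab = (\<lambda>m'. if (\<exists>i<w. \<exists>m\<in>dom (lab G). m' = map (dup_copy \<L> G i) m)
                   then lab G (map fst m') else None) \<rparr>"

definition class_duplicable :: "('v, 'x) lgraph set \<Rightarrow> ('a, 'x) lgraph \<Rightarrow> ('a set \<times> 'a set) set \<Rightarrow> bool" where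
  "class_duplicable \<G> G \<L> \<longleftrightarrow>
     infinite {k::nat. 0 < k \<and> (\<exists>G'\<in>\<G>. isomorphic (duplicate G \<L> k) G')}"

definition GH_duplicable :: "('h, 'x) lgraph \<Rightarrow> ('v, 'x) lgraph set
    \<Rightarrow> (('h \<Rightarrow> 'v) \<times> ('v, 'x) lgraph) set \<Rightarrow> ('h set \<times> 'h set) set \<Rightarrow> bool" where
  "GH_duplicable H \<G> \<H> \<L> \<longleftrightarrow>
     (\<exists>\<phi> G. (\<phi>, G) \<in> \<H> \<and> \<phi> ` verts H = verts G \<and>
        (\<forall>(A, B)\<in>\<L>. \<phi> ` (A - B) \<inter> \<phi> ` B = {}) \<and>
        (let \<L>' = (\<lambda>(A, B). (closed_nbhd G (\<phi> ` (A - B)), verts G - \<phi> ` (A - B))) ` \<L>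
         in independent_coll G \<L>' \<and> class_duplicable \<G> G \<L>' \<and> card \<L>' = card \<L>))"

definition dupH :: "('h, 'x) lgraph \<Rightarrow> (('h \<Rightarrow> 'v) \<times> ('v, 'x) lgraph) set
    \<Rightarrow> ('v, 'x) lgraph set \<Rightarrow> nat" where
  "dupH H \<H> \<G> = Sup {card \<L> | \<L>. independent_coll H \<L> \<and> GH_duplicable H \<G> \<H> \<L>}"

definition dist_within :: "('a, 'x) lgraph \<Rightarrow> 'a set \<Rightarrow> 'a \<Rightarrow> 'a \<Rightarrow> nat \<Rightarrow> bool" where
  "dist_within G S c v l \<longleftrightarrow> (\<exists>p. p \<noteq> [] \<and> hd p = c \<and> last p = v \<and> set p \<subseteq> S \<and>
     length p \<le> l + 1 \<and> (\<forall>i. Suc i < length p \<longrightarrow> (p ! i, p ! Suc i) \<in> edges G))"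

definition shallow_minor :: "nat \<Rightarrow> 'b set \<Rightarrow> ('b \<times> 'b) set \<Rightarrow> ('a, 'x) lgraph \<Rightarrow> bool" where
  "shallow_minor l VL EL G \<longleftrightarrow> (\<exists>\<beta> :: 'b \<Rightarrow> 'a set.
     (\<forall>x\<in>VL. \<beta> x \<subseteq> verts G \<and> (\<exists>c\<in>\<beta> x. \<forall>v\<in>\<beta> x. dist_within G (\<beta> x) c v l)) \<and>
     (\<forall>x\<in>VL. \<forall>y\<in>VL. x \<noteq> y \<longrightarrow> \<beta> x \<inter> \<beta> y = {}) \<and>
     (\<forall>(x, y)\<in>EL. \<exists>u\<in>\<beta> x. \<exists>v\<in>\<beta> y. (u, v) \<in> edges G))"

definition complete_verts :: "nat \<Rightarrow> nat set" where
  "complete_verts k = {..<k}"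

definition complete_edges :: "nat \<Rightarrow> (nat \<times> nat) set" where
  "complete_edges k = {(i, j). i < k \<and> j < k \<and> i \<noteq> j}"

definition somewhere_dense :: "('a, 'x) lgraph set \<Rightarrow> bool" where
  "somewhere_dense \<G> \<longleftrightarrow>
     (\<exists>t::nat. \<forall>k. \<exists>G\<in>\<G>. shallow_minor t (complete_verts k) (complete_edges k) G)"

definition nowhere_dense :: "('a, 'x) lgraph set \<Rightarrow> bool" where
  "nowhere_dense \<G> \<longleftrightarrow> \<not> somewhere_dense \<G>"

end

theory Submission
  imports Defs "HOL-Library.Infinite_Set"
begin

text \<open>
  Lower bound: if \<open>G \<and>\<^sub>k \<L>\<close> lies in the class, choosing one of the \<open>k\<close> copies independently for every
  separation yields \<open>k\<^bsup>|\<L>|\<^esup>\<close> homomorphisms into a graph with at most \<open>k |V(G)|\<close> vertices.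

  Upper bound: a subgraph of extremal, polynomially large density expands polynomially, so every moderately
  large set of its vertices contains two that stay close after the deletion of any few vertices; hence dense
  shallow topological minors contain large complete shallow minors.  In a nowhere dense class this bounds the weak colouring numbers by
  \<open>n\<^bsup>o(1)\<^esup>\<close>, so up to such a factor all homomorphisms land in an induced subgraph carrying a
  forest order of bounded height in which edges (and hence marches) are chains.  There a homomorphism amounts
  to an embedding of one of finitely many patterns.  Call a pattern node rich for an embedding if, with its
  proper ancestors fixed, it can be sent to many places.  If no embedding had \<open>d + 1\<close> pairwise incomparable rich
  nodes, then all nodes would be determined, up to boundedly many choices, by the images of at most \<open>d\<close> nodes,
  so there would be only \<open>O(n\<^sup>d)\<close> embeddings.  Otherwise the branches above \<open>d + 1\<close> incomparable rich nodes
  can be duplicated simultaneously, and the resulting induced subgraph is exactly a duplication.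
\<close>

section \<open>Walks and linked vertices\<close>

text \<open>Two orders of quantifiers shape the argument. Somewhere density asks for one depth that
  serves cliques of every size, so the expansion must stop after a number of rounds that depends
  only on the excess exponent; hence the iteration count \<open>s\<close> and the depth are fixed
  before the clique size \<open>k\<close>. Duplicability asks for one homomorphism onto one graph
  whose duplications occur for infinitely many \<open>k\<close>, whereas counting yields, for each
  \<open>k\<close>, some graph of the class with embeddings of its own. Therefore everything about
  an embedding that a duplication can see, namely the forest order, the edges, the labels and the
  factorisation of the homomorphism, is stored in a code over bounded numbers. Codes are finite in
  number because the ground set of \<open>Q\<close> is, so one code with one set \<open>A\<close> of
  nodes recurs for infinitely many \<open>k\<close>. Rich means at least \<open>K\<close> places,
  with \<open>K\<close> depending on \<open>k\<close> but not on \<open>n\<close>, so powers of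
  \<open>K\<close> remain constants while \<open>n\<close> grows.\<close>

abbreviation walk :: "('a, 'x) lgraph \<Rightarrow> 'a list \<Rightarrow> bool" where
  "walk G \<equiv> successively (\<lambda>x y. (x, y) \<in> edges G)"

lemma dist_within_walk:
  "dist_within G S u v l \<longleftrightarrow>
     (\<exists>p. p \<noteq> [] \<and> hd p = u \<and> last p = v \<and> set p \<subseteq> S \<and> length p \<le> l + 1 \<and> walk G p)"
  unfolding dist_within_def successively_conv_nth by blast

lemma wf_graph_sym: "wf_graph G \<Longrightarrow> (u, v) \<in> edges G \<Longrightarrow> (v, u) \<in> edges G"
  and wf_graph_finite: "wf_graph G \<Longrightarrow> finite (verts G)"
  unfolding wf_graph_def by auto

lemma walk_rev:
  assumes "wf_graph G" "walk G p"
  shows "walk G (rev p)"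
  using assms by (auto intro: successively_mono dest: wf_graph_sym)

lemma walk_distinct:
  assumes "walk G p" "p \<noteq> []"
  shows "\<exists>p'. walk G p' \<and> p' \<noteq> [] \<and> distinct p' \<and> hd p' = hd p \<and> last p' = last p
            \<and> set p' \<subseteq> set p \<and> length p' \<le> length p"
  using assms
proof (induction "length p" arbitrary: p rule: less_induct)
  case less
  show ?case
  proof (cases "distinct p")
    case True
    then show ?thesis using less.prems by blast
  next
    case False
    then obtain xs ys zs y where p: "p = xs @ [y] @ ys @ [y] @ zs"
      using not_distinct_decomp by blast
    let ?p = "xs @ [y] @ zs"
    have "walk G ?p" using less.prems(1) unfolding p
      by (auto simp: successively_append_iff successively_Cons)
    moreover have "length ?p < length p" by (simp add: p)
    ultimately obtain p' where p': "walk G p'" "p' \<noteq> []" "distinct p'" "hd p' = hd ?p" "last p' = last ?p"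
        "set p' \<subseteq> set ?p" "length p' \<le> length ?p"
      using less.hyps by blast
    have "hd ?p = hd p" by (simp add: p hd_append)
    moreover have "last ?p = last p" by (simp add: p)
    moreover have "set ?p \<subseteq> set p" by (auto simp: p)
    ultimately show ?thesis using p' \<open>length ?p < length p\<close> by (intro exI[of _ p']) auto
  qed
qed

lemma dist_within_refl: "u \<in> S \<Longrightarrow> dist_within G S u u l"
  unfolding dist_within_walk by (rule exI[of _ "[u]"]) auto

lemma dist_within_trans:
  assumes "dist_within G S u v l" "dist_within G S v w l'"
  shows "dist_within G S u w (l + l')"
proof -
  obtain p where p: "p \<noteq> []" "hd p = u" "last p = v" "set p \<subseteq> S" "length p \<le> l + 1" "walk G p"
    using assms(1) unfolding dist_within_walk by blast
  obtain q where q: "q \<noteq> []" "hd q = v" "last q = w" "set q \<subseteq> S" "length q \<le> l' + 1" "walk G q"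
    using assms(2) unfolding dist_within_walk by blast
  obtain q' where q': "q = v # q'" using q by (cases q) auto
  have "walk G (p @ q')" using p q unfolding q' by (auto simp: successively_append_iff successively_Cons)
  then show ?thesis unfolding dist_within_walk
    using p q by (intro exI[of _ "p @ q'"]) (auto simp: q')
qed

lemma dist_within_mono:
  "dist_within G S u v l \<Longrightarrow> S \<subseteq> S' \<Longrightarrow> l \<le> l' \<Longrightarrow> dist_within G S' u v l'"
  unfolding dist_within_walk by (elim exE, rule exI, auto)

lemma dist_within_sym:
  assumes "wf_graph G" "dist_within G S u v l"
  shows "dist_within G S v u l"
proof -
  obtain p where p: "p \<noteq> []" "hd p = u" "last p = v" "set p \<subseteq> S" "length p \<le> l + 1" "walk G p"
    using assms(2) unfolding dist_within_walk by blast
  then show ?thesis unfolding dist_within_walk using walk_rev[OF assms(1)]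
    by (intro exI[of _ "rev p"]) (auto simp: hd_rev last_rev)
qed

lemma dist_within_mem:
  assumes "dist_within G S u v l" shows "u \<in> S" "v \<in> S"
  using assms unfolding dist_within_walk by (metis hd_in_set last_in_set subsetD)+

section \<open>Pairs of vertices joined by short paths that survive few deletions\<close>

definition linked :: "('a, 'x) lgraph \<Rightarrow> nat \<Rightarrow> nat \<Rightarrow> 'a \<Rightarrow> 'a \<Rightarrow> bool" where
  "linked G L z u w \<longleftrightarrow> (\<forall>Z. finite Z \<longrightarrow> card Z \<le> z \<longrightarrow> u \<notin> Z \<longrightarrow> w \<notin> Z \<longrightarrow>
     dist_within G (verts G - Z) u w L)"

lemma linked_sym: "wf_graph G \<Longrightarrow> linked G L z u w \<Longrightarrow> linked G L z w u"
  unfolding linked_def by (meson dist_within_sym)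

text \<open>A set of \<open>z\<close> vertices misses some common partner of \<open>u\<close> and
  \<open>w\<close>, and the two short paths to that partner are concatenated. This is how pairs that
  may not be linked themselves become linked at twice the length.\<close>

lemma linked_common:
  assumes G: "wf_graph G" and c: "finite C" "card C \<ge> z + 3"
    and l: "\<And>c. c \<in> C \<Longrightarrow> linked G L z u c \<and> linked G L z w c"
  shows "linked G (2 * L) z u w"
  unfolding linked_def
proof (intro allI impI)
  fix Z assume Z: "finite Z" "card Z \<le> z" "u \<notin> Z" "w \<notin> Z"
  have "\<not> C \<subseteq> Z"
  proof
    assume "C \<subseteq> Z"
    then have "card C \<le> card Z" using Z(1) by (rule card_mono[rotated])
    then show False using c(2) Z(2) by linarith
  qed
  then obtain x where x: "x \<in> C" "x \<notin> Z" by blast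
  have "dist_within G (verts G - Z) u x L" "dist_within G (verts G - Z) w x L"
    using l[OF x(1)] Z x unfolding linked_def by blast+
  then show "dist_within G (verts G - Z) u w (2 * L)"
    using dist_within_trans[OF _ dist_within_sym[OF G]] unfolding mult_2 by blast
qed

text \<open>A subdivision, with paths of length at most \<open>L\<close>, of the graph on
  \<open>{..<k}\<close> with edge set \<open>P\<close>. A pair stands for an undirected edge, so
  \<open>P\<close> will contain only one orientation of it.\<close>

definition path_system ::
  "('a, 'x) lgraph \<Rightarrow> (nat \<Rightarrow> 'a) \<Rightarrow> nat \<Rightarrow> nat \<Rightarrow> (nat \<times> nat) set \<Rightarrow> (nat \<times> nat \<Rightarrow> 'a list) \<Rightarrow> bool" where
  "path_system G b k L P q \<longleftrightarrow>
     (\<forall>i j. (i, j) \<in> P \<longrightarrow> q (i, j) \<noteq> [] \<and> hd (q (i, j)) = b i \<and> last (q (i, j)) = b j \<and> distinct (q (i, j))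
              \<and> walk G (q (i, j)) \<and> set (q (i, j)) \<subseteq> verts G \<and> length (q (i, j)) \<le> L + 1
              \<and> set (q (i, j)) \<inter> b ` {..<k} \<subseteq> {b i, b j}) \<and>
     (\<forall>d\<in>P. \<forall>d'\<in>P. d \<noteq> d' \<longrightarrow> set (q d) \<inter> set (q d') \<subseteq> b ` {..<k})"

lemma path_systemD:
  assumes "path_system G b k L P q" "(i, j) \<in> P"
  shows "q (i, j) \<noteq> []" "hd (q (i, j)) = b i" "last (q (i, j)) = b j" "distinct (q (i, j))"
    "walk G (q (i, j))" "set (q (i, j)) \<subseteq> verts G" "length (q (i, j)) \<le> L + 1"
    "set (q (i, j)) \<inter> b ` {..<k} \<subseteq> {b i, b j}"
  using assms unfolding path_system_def by simp_all

lemma path_system_disjoint: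
  assumes "path_system G b k L P q" "d \<in> P" "d' \<in> P" "d \<noteq> d'"
  shows "set (q d) \<inter> set (q d') \<subseteq> b ` {..<k}"
  using assms unfolding path_system_def by simp

text \<open>Paths are chosen greedily. The \<open>k\<close> branch vertices together with the paths
  chosen so far, each of at most \<open>L + 1\<close> vertices, fit into the deletion budget
  \<open>z\<close>, so the next pair still has a short path that avoids them.\<close>

lemma linked_disjoint_paths:
  assumes G: "wf_graph G" and P: "finite P" "P \<subseteq> {(i, j). i < j \<and> j < k}"
    and b: "inj_on b {..<k}" "b ` {..<k} \<subseteq> verts G"
    and l: "\<And>i j. i < j \<Longrightarrow> j < k \<Longrightarrow> linked G L z (b i) (b j)"
    and z: "k + card P * (L + 1) \<le> z"
  shows "\<exists>q. path_system G b k L P q"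
  using P z
proof (induction P rule: finite_induct)
  case empty
  then show ?case by (simp add: path_system_def)
next
  case (insert d P)
  obtain i j where d: "d = (i, j)" "i < j" "j < k" using insert.prems(1) by auto
  have "k + card P * (L + 1) \<le> z" using insert by (simp add: algebra_simps)
  then obtain q where q: "path_system G b k L P q" using insert.IH insert.prems(1) by blast
  note q1 = path_systemD[OF q] and q2 = path_system_disjoint[OF q]
  \<comment> \<open>The two ends are exempt, since they may lie on earlier paths as well.\<close>
  define Z where "Z = (b ` {..<k} \<union> (\<Union>d\<in>P. set (q d))) - {b i, b j}"
  have "card (\<Union>d\<in>P. set (q d)) \<le> (\<Sum>d\<in>P. card (set (q d)))" by (rule card_UN_le[OF insert.hyps(1)])
  also have "\<dots> \<le> (\<Sum>d\<in>P. L + 1)"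
  proof (rule sum_mono)
    fix d assume "d \<in> P"
    then have "length (q d) \<le> L + 1" using q1(7) by (metis surj_pair)
    then show "card (set (q d)) \<le> L + 1" using card_length order_trans by blast
  qed
  finally have "card (\<Union>d\<in>P. set (q d)) \<le> card P * (L + 1)" by simp
  moreover have "card (b ` {..<k}) \<le> k" using card_image_le[of "{..<k}" b] by simp
  moreover have fin: "finite (b ` {..<k} \<union> (\<Union>d\<in>P. set (q d)))" using insert.hyps(1) by auto
  ultimately have "card Z \<le> k + card P * (L + 1)"
    unfolding Z_def by (meson Diff_subset add_mono card_Un_le card_mono order_trans)
  then have cZ: "card Z \<le> z" using \<open>k + card P * (L + 1) \<le> z\<close> by linarith
  have "finite Z" unfolding Z_def using fin by blast
  moreover have "b i \<notin> Z" "b j \<notin> Z" unfolding Z_def by auto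
  ultimately have "dist_within G (verts G - Z) (b i) (b j) L"
    using l[OF d(2,3)] cZ unfolding linked_def by blast
  then obtain p0 where p0: "p0 \<noteq> []" "hd p0 = b i" "last p0 = b j" "set p0 \<subseteq> verts G - Z" "length p0 \<le> L + 1" "walk G p0"
    unfolding dist_within_walk by blast
  obtain p where p: "p \<noteq> []" "hd p = b i" "last p = b j" "set p \<subseteq> verts G - Z" "length p \<le> L + 1" "walk G p" "distinct p"
    using walk_distinct[OF p0(6,1)] p0(2-5) by (auto dest: order_trans)
  have pd: "set p \<inter> b ` {..<k} \<subseteq> {b i, b j}" "\<And>d'. d' \<in> P \<Longrightarrow> set p \<inter> set (q d') \<subseteq> {b i, b j}"
    using p(4) unfolding Z_def by blast+
  have bij: "{b i, b j} \<subseteq> b ` {..<k}" using d by auto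
  define q' where "q' = q(d := p)"
  have q'P: "q' d' = q d'" if "d' \<in> P" for d' using that insert.hyps(2) unfolding q'_def by auto
  have q'd: "q' d = p" by (simp add: q'_def)
  have "path_system G b k L (insert d P) q'"
    unfolding path_system_def
  proof (intro conjI allI impI)
    fix i' j' assume e: "(i', j') \<in> insert d P"
    have *: "q' (i', j') \<noteq> [] \<and> hd (q' (i', j')) = b i' \<and> last (q' (i', j')) = b j' \<and> distinct (q' (i', j'))
              \<and> walk G (q' (i', j')) \<and> set (q' (i', j')) \<subseteq> verts G \<and> length (q' (i', j')) \<le> L + 1
              \<and> set (q' (i', j')) \<inter> b ` {..<k} \<subseteq> {b i', b j'}"
    proof (cases "(i', j') = d")
      case True
      then have eq: "i' = i" "j' = j" "q' (i, j) = p" using d q'd by auto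
      have "set p \<subseteq> verts G" using p(4) by blast
      then show ?thesis unfolding eq using p pd(1) by blast
    next
      case False
      then have e': "(i', j') \<in> P" using e by blast
      show ?thesis unfolding q'P[OF e'] using q1[OF e'] by blast
    qed
    show "q' (i', j') \<noteq> []" "hd (q' (i', j')) = b i'" "last (q' (i', j')) = b j'" "distinct (q' (i', j'))"
      "walk G (q' (i', j'))" "set (q' (i', j')) \<subseteq> verts G" "length (q' (i', j')) \<le> L + 1"
      "set (q' (i', j')) \<inter> b ` {..<k} \<subseteq> {b i', b j'}" using * by blast+
  next
    show "\<forall>d1\<in>insert d P. \<forall>d2\<in>insert d P. d1 \<noteq> d2 \<longrightarrow> set (q' d1) \<inter> set (q' d2) \<subseteq> b ` {..<k}"
    proof (intro ballI impI)
      fix d1 d2 assume "d1 \<in> insert d P" "d2 \<in> insert d P" "d1 \<noteq> d2"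
      then consider "d1 = d" "d2 \<in> P" | "d2 = d" "d1 \<in> P" | "d1 \<in> P" "d2 \<in> P" by blast
      then show "set (q' d1) \<inter> set (q' d2) \<subseteq> b ` {..<k}"
      proof cases
        case 1
        then show ?thesis using pd(2)[OF 1(2)] bij q'P[OF 1(2)] q'd by auto
      next
        case 2
        then show ?thesis using pd(2)[OF 2(2)] bij q'P[OF 2(2)] q'd by auto
      next
        case 3
        then show ?thesis using q2[OF 3 \<open>d1 \<noteq> d2\<close>] q'P by simp
      qed
    qed
  qed
  then show ?case by blast
qed

text \<open>Contracting a subdivided clique: the branch set of \<open>i\<close> is
  \<open>b i\<close> with the paths to all larger \<open>j\<close>, cut just before
  \<open>b j\<close>. It has radius at most \<open>L\<close> around \<open>b i\<close>, and the last
  edge of the path to \<open>b j\<close> supplies the adjacency. The budget \<open>z\<close> pays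
  for at most \<open>k * k\<close> paths.\<close>

lemma complete_shallow_minor_if_linked:
  assumes G: "wf_graph G" and b: "inj_on b {..<k}" "b ` {..<k} \<subseteq> verts G"
    and l: "\<And>i j. i < j \<Longrightarrow> j < k \<Longrightarrow> linked G L z (b i) (b j)"
    and z: "k + k * k * (L + 1) \<le> z"
  shows "shallow_minor L (complete_verts k) (complete_edges k) G"
proof -
  define P where "P = {(i, j). i < j \<and> j < k}"
  have sub: "P \<subseteq> {..<k} \<times> {..<k}" unfolding P_def by auto
  then have finP: "finite P" by (rule finite_subset) simp
  have "card P \<le> k * k" using card_mono[OF _ sub] by (simp add: card_cartesian_product)
  then have "card P * (L + 1) \<le> k * k * (L + 1)" by (rule mult_le_mono1)
  then have "k + card P * (L + 1) \<le> z" using z by linarith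
  moreover have "P \<subseteq> {(i, j). i < j \<and> j < k}" unfolding P_def by simp
  ultimately obtain q where q: "path_system G b k L P q"
    using linked_disjoint_paths[OF G finP _ b l] by blast
  note q1 = path_systemD[OF q] and q2 = path_system_disjoint[OF q]
  define \<beta> where "\<beta> i = {b i} \<union> (\<Union>j\<in>{j. i < j \<and> j < k}. set (q (i, j)) - {b j})" for i
  have b_inj: "b i = b j \<longleftrightarrow> i = j" if "i < k" "j < k" for i j
    using b(1) that by (auto simp: inj_on_def)
  \<comment> \<open>A branch set contains no branch vertex but its own, so an overlap of two branch
    sets would lie off all branch vertices, where the paths are disjoint.\<close>
  have inb: "x = b i" if xi: "x \<in> \<beta> i" "x \<in> b ` {..<k}" for x i
  proof (cases "x = b i")
    case False
    then obtain j where j: "i < j" "j < k" "x \<in> set (q (i, j))" "x \<noteq> b j"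
      using xi(1) unfolding \<beta>_def by blast
    have "(i, j) \<in> P" using j(1,2) unfolding P_def by simp
    then have "x \<in> {b i, b j}" using q1(8) j(3) xi(2) by blast
    then show ?thesis using j(4) by blast
  qed simp
  have "\<beta> x \<inter> \<beta> y = {}" if xy: "x < k" "y < k" "x \<noteq> y" for x y
  proof (rule ccontr)
    assume "\<beta> x \<inter> \<beta> y \<noteq> {}"
    then obtain u where u: "u \<in> \<beta> x" "u \<in> \<beta> y" by blast
    have "u \<notin> b ` {..<k}" using inb[OF u(1)] inb[OF u(2)] b_inj[OF xy(1,2)] xy by metis
    moreover have "b x \<in> b ` {..<k}" "b y \<in> b ` {..<k}" using xy by auto
    ultimately obtain j j' where "x < j" "j < k" "u \<in> set (q (x, j))" "y < j'" "j' < k" "u \<in> set (q (y, j'))"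
      using u unfolding \<beta>_def by auto
    moreover have "set (q (x, j)) \<inter> set (q (y, j')) \<subseteq> b ` {..<k}"
      using calculation xy(3) by (intro q2) (auto simp: P_def)
    ultimately show False using \<open>u \<notin> b ` {..<k}\<close> by blast
  qed
  moreover have "\<beta> x \<subseteq> verts G \<and> (\<exists>c\<in>\<beta> x. \<forall>v\<in>\<beta> x. dist_within G (\<beta> x) c v L)" if x: "x < k" for x
  proof (intro conjI bexI[of _ "b x"] ballI)
    have "set (q (x, j)) \<subseteq> verts G" if "x < j" "j < k" for j using q1(6) that unfolding P_def by simp
    moreover have "b x \<in> verts G" using b(2) x by auto
    ultimately show "\<beta> x \<subseteq> verts G" unfolding \<beta>_def by auto
    show "b x \<in> \<beta> x" unfolding \<beta>_def by simp
    fix v assume v: "v \<in> \<beta> x"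
    show "dist_within G (\<beta> x) (b x) v L"
    proof (cases "v = b x")
      case True
      then show ?thesis using v by (auto intro: dist_within_refl)
    next
      case False
      then obtain j where j: "x < j" "j < k" "v \<in> set (q (x, j))" "v \<noteq> b j" using v unfolding \<beta>_def by auto
      have qj: "q (x, j) \<noteq> []" "hd (q (x, j)) = b x" "last (q (x, j)) = b j" "distinct (q (x, j))" "walk G (q (x, j))"
        "length (q (x, j)) \<le> L + 1" using q1[of x j] j unfolding P_def by auto
      obtain p1 p2 where p: "q (x, j) = p1 @ v # p2" using split_list[OF j(3)] by blast
      have "p2 \<noteq> []" using qj(3) j(4) p by auto
      then have "b j \<in> set p2" using qj(3) p last_in_set[of p2] by auto
      then have "b j \<notin> set (p1 @ [v])" using qj(4) p by auto
      then have "set (p1 @ [v]) \<subseteq> \<beta> x" unfolding \<beta>_def using j p by auto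
      moreover have "walk G (p1 @ [v])" using qj(5) p by (auto simp: successively_append_iff successively_Cons)
      moreover have "hd (p1 @ [v]) = b x" using qj(2) p by (cases p1) auto
      ultimately show ?thesis unfolding dist_within_walk using qj(6) p
        by (intro exI[of _ "p1 @ [v]"]) auto
    qed
  qed
  moreover have edge: "\<exists>u\<in>\<beta> x. \<exists>v\<in>\<beta> y. (u, v) \<in> edges G" if xy: "x < y" "y < k" for x y
  proof -
    have qj: "q (x, y) \<noteq> []" "hd (q (x, y)) = b x" "last (q (x, y)) = b y" "distinct (q (x, y))" "walk G (q (x, y))"
      using q1[of x y] xy unfolding P_def by auto
    have "b x \<noteq> b y" using b_inj xy by simp
    then obtain p where p: "q (x, y) = p @ [b y]" "p \<noteq> []"
      using qj by (metis append_butlast_last_id append_Nil list.sel(1))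
    have "(last p, b y) \<in> edges G" using qj(5) p by (auto simp: successively_append_iff)
    moreover have "last p \<in> \<beta> x" unfolding \<beta>_def using p qj(4) xy last_in_set[OF p(2)] by auto
    moreover have "b y \<in> \<beta> y" unfolding \<beta>_def by simp
    ultimately show ?thesis by blast
  qed
  have "\<exists>u\<in>\<beta> x. \<exists>v\<in>\<beta> y. (u, v) \<in> edges G" if "x < k" "y < k" "x \<noteq> y" for x y
  proof (cases "x < y")
    case True
    then show ?thesis using edge that by blast
  next
    case False
    then show ?thesis using edge[of y x] that wf_graph_sym[OF G] by (meson linorder_cases)
  qed
  ultimately have "(\<forall>x\<in>{..<k}. \<beta> x \<subseteq> verts G \<and> (\<exists>c\<in>\<beta> x. \<forall>v\<in>\<beta> x. dist_within G (\<beta> x) c v L)) \<and>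
     (\<forall>x\<in>{..<k}. \<forall>y\<in>{..<k}. x \<noteq> y \<longrightarrow> \<beta> x \<inter> \<beta> y = {}) \<and>
     (\<forall>(x, y)\<in>{(i, j). i < k \<and> j < k \<and> i \<noteq> j}. \<exists>u\<in>\<beta> x. \<exists>v\<in>\<beta> y. (u, v) \<in> edges G)"
    by blast
  then show ?thesis unfolding shallow_minor_def complete_verts_def complete_edges_def by (intro exI[of _ \<beta>])
qed

section \<open>Dense path packings contain shallow clique minors\<close>

text \<open>The closed neighbourhoods of a maximal independent set cover \<open>S\<close>, and each
  has at most \<open>x + 1\<close> elements.\<close>

lemma independent_subset_of_low_degree:
  fixes R :: "'a \<Rightarrow> 'a \<Rightarrow> bool"
  assumes S: "finite S" and deg: "\<And>v. v \<in> S \<Longrightarrow> card {w \<in> S. R v w} \<le> x"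
    and sym: "\<And>u v. R u v \<Longrightarrow> R v u"
  shows "\<exists>I\<subseteq>S. (\<forall>u\<in>I. \<forall>v\<in>I. u \<noteq> v \<longrightarrow> \<not> R u v) \<and> card S \<le> card I * (x + 1)"
proof -
  let ?F = "{I. I \<subseteq> S \<and> (\<forall>u\<in>I. \<forall>v\<in>I. u \<noteq> v \<longrightarrow> \<not> R u v)}"
  have "finite ?F" by (rule finite_subset[of _ "Pow S"]) (use S in auto)
  moreover have "{} \<in> ?F" by simp
  ultimately obtain I where I: "I \<in> ?F" "\<And>J. J \<in> ?F \<Longrightarrow> I \<subseteq> J \<Longrightarrow> I = J"
    using finite_has_maximal2[of ?F "{}"] by (metis (no_types, lifting))
  have finI: "finite I" using I(1) S finite_subset by blast
  have "S \<subseteq> (\<Union>v\<in>I. insert v {w \<in> S. R v w})"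
  proof
    fix w assume w: "w \<in> S"
    show "w \<in> (\<Union>v\<in>I. insert v {w \<in> S. R v w})"
    proof (rule ccontr)
      assume n: "w \<notin> (\<Union>v\<in>I. insert v {w \<in> S. R v w})"
      then have "\<forall>v\<in>I. \<not> R v w \<and> \<not> R w v" using w sym by blast
      then have "insert w I \<in> ?F" using I(1) w by auto
      then have "I = insert w I" using I(2) by blast
      then show False using n by blast
    qed
  qed
  then have "card S \<le> card (\<Union>v\<in>I. insert v {w \<in> S. R v w})" by (rule card_mono[rotated]) (use finI S in auto)
  also have "\<dots> \<le> (\<Sum>v\<in>I. card (insert v {w \<in> S. R v w}))" by (rule card_UN_le[OF finI])
  also have "\<dots> \<le> (\<Sum>v\<in>I. x + 1)"
  proof (rule sum_mono)
    fix v assume "v \<in> I"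
    then have "card {w \<in> S. R v w} \<le> x" using deg I(1) by blast
    then show "card (insert v {w \<in> S. R v w}) \<le> x + 1"
      using card_insert_le_m1[of "x + 1" "{w \<in> S. R v w}" v] by simp
  qed
  also have "\<dots> = card I * (x + 1)" by simp
  finally show ?thesis using I(1) by blast
qed

text \<open>Averaging over a common neighbour \<open>w\<close>: inside the neighbourhood of a typical vertex of high degree,
  only a small proportion of the pairs have few common neighbours.\<close>
lemma pairwise_common_neighbours:
  fixes R :: "'a \<Rightarrow> 'a \<Rightarrow> bool"
  assumes U: "finite U" and sym: "\<And>u v. R u v \<Longrightarrow> R v u"
    and ind: "\<And>I. I \<subseteq> U \<Longrightarrow> (\<forall>u\<in>I. \<forall>v\<in>I. u \<noteq> v \<longrightarrow> \<not> R u v) \<Longrightarrow> card I < t"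
    and large: "256 * k * b * t\<^sup>2 < card U" and pos: "0 < b"
  shows "\<exists>B\<subseteq>U. card B = k \<and> (\<forall>u\<in>B. \<forall>v\<in>B. u \<noteq> v \<longrightarrow> b \<le> card {w \<in> U. R u w \<and> R v w})"
proof (cases "k = 0")
  case True
  then show ?thesis by (intro exI[of _ "{}"]) auto
next
  case False
  define m where "m = card U"
  define N where "N w = {u \<in> U. R w u}" for w
  have finN: "finite (N w)" for w unfolding N_def using U by simp
  have t: "0 < t" using ind[of "{}"] by simp
  have tk: "t \<le> t\<^sup>2 * (k * b)" using False pos t by (simp add: power2_eq_square)
  have tm: "256 * t < m" using large tk unfolding m_def by (simp add: algebra_simps)
  \<comment> \<open>Vertices of degree below \<open>m / (4 * t)\<close> are few: an independent set
    among them has fewer than \<open>t\<close> elements, so by the degree bound they make up at most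
    about a quarter of \<open>U\<close>.\<close>
  define low where "low = {u \<in> U. 4 * t * card (N u) < m}"
  have "\<exists>I\<subseteq>low. (\<forall>u\<in>I. \<forall>v\<in>I. u \<noteq> v \<longrightarrow> \<not> R u v) \<and> card low \<le> card I * (m div (4 * t) + 1)"
  proof (rule independent_subset_of_low_degree)
    show "finite low" unfolding low_def using U by simp
    fix v assume "v \<in> low"
    then have "card (N v) * (4 * t) \<le> m" unfolding low_def by (simp add: algebra_simps)
    then have "card (N v) \<le> m div (4 * t)" using t by (simp add: less_eq_div_iff_mult_less_eq)
    moreover have "card {w \<in> low. R v w} \<le> card (N v)" using finN by (intro card_mono) (auto simp: low_def N_def)
    ultimately show "card {w \<in> low. R v w} \<le> m div (4 * t)" by linarith
  qed (rule sym)
  then obtain I where I: "I \<subseteq> low" "\<forall>u\<in>I. \<forall>v\<in>I. u \<noteq> v \<longrightarrow> \<not> R u v" "card low \<le> card I * (m div (4 * t) + 1)" by blast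
  have "card I < t" using ind[of I] I(1,2) unfolding low_def by blast
  then have "card low \<le> t * (m div (4 * t) + 1)" using I(3) by (meson less_imp_le mult_le_mono1 order_trans)
  moreover have "4 * t * (m div (4 * t)) \<le> m" by (simp add: mult.commute)
  ultimately have low: "4 * card low \<le> m + 4 * t" by (simp add: algebra_simps)
  define high where "high = U - low"
  have finh: "finite high" unfolding high_def using U by simp
  have "card low \<le> card U" using U by (intro card_mono) (auto simp: low_def)
  then have high: "m \<le> 2 * card high" unfolding high_def m_def
    using low tm U by (subst card_Diff_subset) (auto simp: low_def m_def)
  \<comment> \<open>Double counting: a pair in \<open>Bd\<close> lies in the neighbourhoods of fewer
    than \<open>b\<close> vertices, so the sum of \<open>bad w\<close> is at most
    \<open>m * m * b\<close>.\<close>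
  define Bd where "Bd = {(u, v) \<in> U \<times> U. u \<noteq> v \<and> card {w \<in> U. R u w \<and> R v w} < b}"
  have Bd: "finite Bd" "card Bd \<le> m * m"
  proof -
    have sub: "Bd \<subseteq> U \<times> U" unfolding Bd_def by auto
    then show "finite Bd" using U by (meson finite_SigmaI finite_subset)
    show "card Bd \<le> m * m" using card_mono[OF _ sub] U by (simp add: card_cartesian_product m_def)
  qed
  define bad where "bad w = card {p \<in> Bd. p \<in> N w \<times> N w}" for w
  have "(\<Sum>w\<in>high. bad w) = (\<Sum>p\<in>Bd. card {w \<in> high. p \<in> N w \<times> N w})"
    unfolding bad_def by (rule sum_multicount_gen) (use finh Bd in auto)
  also have "\<dots> \<le> (\<Sum>p\<in>Bd. b)"
  proof (rule sum_mono)
    fix p assume p: "p \<in> Bd"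
    obtain u v where uv: "p = (u, v)" by fastforce
    have "{w \<in> high. p \<in> N w \<times> N w} \<subseteq> {w \<in> U. R u w \<and> R v w}"
      using sym unfolding uv N_def high_def by auto
    then have "card {w \<in> high. p \<in> N w \<times> N w} \<le> card {w \<in> U. R u w \<and> R v w}"
      by (rule card_mono[rotated]) (use U in simp)
    also have "\<dots> < b" using p unfolding uv Bd_def by simp
    finally show "card {w \<in> high. p \<in> N w \<times> N w} \<le> b" by simp
  qed
  also have "\<dots> \<le> m * m * b" using Bd(2) by simp
  finally have sumbad: "(\<Sum>w\<in>high. bad w) \<le> m * m * b" .
  \<comment> \<open>Source of the 256: high vertices have degree at least
    \<open>m / (4 * t)\<close>, so failure everywhere gives
    \<open>m * m \<le> 128 * t\<^sup>2 * k * bad w\<close>; summing over at least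
    \<open>m / 2\<close> of them contradicts the bound on the sum of \<open>bad\<close>.\<close>
  have "\<exists>w\<in>high. 8 * k * bad w < (card (N w))\<^sup>2"
  proof (rule ccontr)
    assume "\<not> ?thesis"
    then have c: "(card (N w))\<^sup>2 \<le> 8 * k * bad w" if "w \<in> high" for w using that by force
    have "m * m \<le> 128 * t\<^sup>2 * k * bad w" if "w \<in> high" for w
    proof -
      have "m \<le> 4 * t * card (N w)" using that unfolding high_def low_def by force
      then have "m * m \<le> (4 * t * card (N w)) * (4 * t * card (N w))" by (rule mult_le_mono) fact
      also have "\<dots> = 16 * t\<^sup>2 * (card (N w))\<^sup>2" by (simp add: power2_eq_square)
      also have "\<dots> \<le> 16 * t\<^sup>2 * (8 * k * bad w)" using c[OF that] by simp
      finally show ?thesis by (simp add: algebra_simps)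
    qed
    then have "(\<Sum>w\<in>high. m * m) \<le> (\<Sum>w\<in>high. 128 * t\<^sup>2 * k * bad w)" by (rule sum_mono)
    also have "\<dots> = 128 * t\<^sup>2 * k * (\<Sum>w\<in>high. bad w)" by (simp add: sum_distrib_left)
    also have "\<dots> \<le> 128 * t\<^sup>2 * k * (m * m * b)" using sumbad by simp
    finally have "card high * (m * m) \<le> 128 * t\<^sup>2 * k * (m * m * b)" by simp
    then have "(2 * card high) * (m * m) \<le> (256 * k * b * t\<^sup>2) * (m * m)" by (simp add: algebra_simps)
    moreover have "0 < m * m" using tm by simp
    ultimately have "2 * card high \<le> 256 * k * b * t\<^sup>2" by simp
    then show False using high large unfolding m_def by linarith
  qed
  then obtain w where w: "w \<in> high" "8 * k * bad w < (card (N w))\<^sup>2" by blast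
  define A where "A = N w"
  define a where "a = card A"
  have finA: "finite A" unfolding A_def by (rule finN)
  have "m \<le> 4 * t * a" using w(1) unfolding high_def low_def a_def A_def by force
  moreover have "4 * t * (64 * k) \<le> 256 * k * b * t\<^sup>2"
    using pos t by (simp add: power2_eq_square)
  ultimately have "4 * t * (64 * k) < 4 * t * a" using large unfolding m_def by linarith
  then have a: "64 * k < a" by simp
  define bd where "bd v = card {u \<in> A. (v, u) \<in> Bd}" for v
  have sumbd: "(\<Sum>v\<in>A. bd v) = bad w"
  proof -
    have "(\<Sum>v\<in>A. bd v) = card (SIGMA v:A. {u \<in> A. (v, u) \<in> Bd})"
      unfolding bd_def using finA by (subst card_SigmaI) auto
    also have "(SIGMA v:A. {u \<in> A. (v, u) \<in> Bd}) = {p \<in> Bd. p \<in> N w \<times> N w}" unfolding A_def by auto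
    finally show ?thesis unfolding bad_def .
  qed
  \<comment> \<open>More than half of \<open>A\<close> has at most \<open>a / (4 * k)\<close> bad
    partners in \<open>A\<close>. On \<open>S\<close> the bad pairs thus form a graph of low degree,
    and \<open>k\<close> independent vertices of it make up the desired set
    \<open>B\<close>.\<close>
  define S where "S = {v \<in> A. 4 * k * bd v \<le> a}"
  have "a * card (A - S) = (\<Sum>v\<in>A-S. a)" by simp
  also have "\<dots> \<le> (\<Sum>v\<in>A-S. 4 * k * bd v)" by (intro sum_mono) (auto simp: S_def)
  also have "\<dots> \<le> (\<Sum>v\<in>A. 4 * k * bd v)" using finA by (intro sum_mono2) auto
  also have "\<dots> = 4 * k * bad w" unfolding sumbd[symmetric] by (simp add: sum_distrib_left)
  finally have "2 * (a * card (A - S)) < a * a" using w(2) unfolding a_def A_def power2_eq_square by linarith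
  then have "a * (2 * card (A - S)) < a * a" by (simp add: algebra_simps)
  then have "2 * card (A - S) < a" by simp
  moreover have "card (A - S) = a - card S" unfolding a_def using finA by (intro card_Diff_subset) (auto simp: S_def)
  ultimately have cS: "a < 2 * card S" by linarith
  have "\<exists>I\<subseteq>S. (\<forall>u\<in>I. \<forall>v\<in>I. u \<noteq> v \<longrightarrow> (u, v) \<notin> Bd) \<and> card S \<le> card I * (a div (4 * k) + 1)"
  proof (rule independent_subset_of_low_degree)
    show "finite S" unfolding S_def using finA by simp
    fix v assume "v \<in> S"
    then have "bd v * (4 * k) \<le> a" unfolding S_def by (simp add: algebra_simps)
    then have "bd v \<le> a div (4 * k)" using False by (simp add: less_eq_div_iff_mult_less_eq)
    moreover have "card {u \<in> S. (v, u) \<in> Bd} \<le> bd v" unfolding bd_def using finA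
      by (intro card_mono) (auto simp: S_def)
    ultimately show "card {u \<in> S. (v, u) \<in> Bd} \<le> a div (4 * k)" by linarith
  next
    fix u v assume "(u, v) \<in> Bd"
    moreover have "{w \<in> U. R u w \<and> R v w} = {w \<in> U. R v w \<and> R u w}" by auto
    ultimately show "(v, u) \<in> Bd" unfolding Bd_def by auto
  qed
  then obtain J where J: "J \<subseteq> S" "\<forall>u\<in>J. \<forall>v\<in>J. u \<noteq> v \<longrightarrow> (u, v) \<notin> Bd" "card S \<le> card J * (a div (4 * k) + 1)" by blast
  have "k \<le> card J"
  proof (rule ccontr)
    assume "\<not> ?thesis"
    then have "card S \<le> k * (a div (4 * k) + 1)" using J(3) by (meson mult_le_mono1 nle_le order_trans)
    moreover have "4 * k * (a div (4 * k)) \<le> a" by (simp add: mult.commute)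
    ultimately show False using cS a by (simp add: algebra_simps)
  qed
  then obtain B where B: "B \<subseteq> J" "card B = k" using obtain_subset_with_card_n by blast
  have "B \<subseteq> U" using B(1) J(1) unfolding S_def A_def N_def by auto
  moreover have "b \<le> card {w \<in> U. R u w \<and> R v w}" if "u \<in> B" "v \<in> B" "u \<noteq> v" for u v
  proof -
    have "(u, v) \<notin> Bd" "u \<in> U" "v \<in> U" using that J(2) B(1) \<open>B \<subseteq> U\<close> by blast+
    then show ?thesis using that(3) unfolding Bd_def by simp
  qed
  ultimately show ?thesis using B(2) by blast
qed

text \<open>\<open>q (u, v)\<close> holds only the interior of the walk, and only interiors are
  confined to \<open>R\<close> and kept disjoint. The walks need not be paths, so two of them can be
  spliced without clean-up.\<close>

definition packing ::
  "('a, 'x) lgraph \<Rightarrow> nat \<Rightarrow> 'a set \<Rightarrow> ('a \<times> 'a) set \<Rightarrow> ('a \<times> 'a \<Rightarrow> 'a list) \<Rightarrow> bool" where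
  "packing G l R D q \<longleftrightarrow>
     (\<forall>u v. (u, v) \<in> D \<longrightarrow> walk G (u # q (u, v) @ [v]) \<and> set (q (u, v)) \<subseteq> R \<and> length (q (u, v)) \<le> l) \<and>
     (\<forall>d\<in>D. \<forall>d'\<in>D. d \<noteq> d' \<longrightarrow> set (q d) \<inter> set (q d') = {})"

lemma packing_mono: "packing G l R D q \<Longrightarrow> l \<le> l' \<Longrightarrow> R \<subseteq> R' \<Longrightarrow> packing G l' R' D q"
  unfolding packing_def by (meson order_trans)

lemma packing_dist_within:
  assumes p: "packing G l (verts G) D q" and d: "(u, w) \<in> D" "set (q (u, w)) \<inter> Z = {}"
    and uw: "u \<in> verts G - Z" "w \<in> verts G - Z"
  shows "dist_within G (verts G - Z) u w (l + 1)"
proof -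
  have "walk G (u # q (u, w) @ [w])" "set (q (u, w)) \<subseteq> verts G" "length (q (u, w)) \<le> l"
    using p d(1) unfolding packing_def by blast+
  then show ?thesis unfolding dist_within_walk using d(2) uw
    by (intro exI[of _ "u # q (u, w) @ [w]"]) auto
qed

text \<open>A set \<open>U0\<close> that maximises \<open>e(U) / |U|\<^bsup>1 + \<eta>\<^esup>\<close> expands polynomially, even after the deletion of a
  small vertex set.\<close>
locale extremal_packing =
  fixes G :: "('a, 'x) lgraph" and l :: nat and D :: "('a \<times> 'a) set" and q :: "'a \<times> 'a \<Rightarrow> 'a list"
    and U0 :: "'a set" and \<eta> :: real
  assumes G: "wf_graph G" and packing: "packing G l (verts G) D q"
    and U0: "U0 \<subseteq> verts G" "U0 \<noteq> {}" and \<eta>: "0 < \<eta>"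
    and pos: "0 < card (D \<inter> U0 \<times> U0)"
    and extremal: "\<And>U. U \<subseteq> U0 \<Longrightarrow>
      real (card (D \<inter> U \<times> U)) \<le> real (card (D \<inter> U0 \<times> U0)) * (real (card U) / real (card U0)) powr (1 + \<eta>)"
begin

abbreviation "m \<equiv> real (card U0)"
abbreviation "e \<equiv> real (card (D \<inter> U0 \<times> U0))"

lemma fin: "finite U0" using G U0(1) wf_graph_finite finite_subset by blast

lemma m_pos: "0 < m" using fin U0(2) by (simp add: card_gt_0_iff)

definition nbh :: "'a set \<Rightarrow> 'a set \<Rightarrow> 'a set" where
  "nbh Z U = {w \<in> U0 - Z. \<exists>u\<in>U. w = u \<or> ((u, w) \<in> D \<and> set (q (u, w)) \<inter> Z = {})
     \<or> ((w, u) \<in> D \<and> set (q (w, u)) \<inter> Z = {})}"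

text \<open>By extremality, deleting \<open>U\<close> leaves at most
  \<open>e * (1 - |U| / m)\<close> pairs, so at least \<open>e * |U| / m\<close> pairs touch
  \<open>U\<close>. Of these \<open>Z\<close> destroys at most half of that bound: pairs with an end
  in \<open>Z\<close> number at most \<open>2 * |U| * |Z|\<close>, and by disjointness of interiors
  each vertex of \<open>Z\<close> lies inside at most one walk. The rest are pairs within
  \<open>nbh Z U\<close>, to which extremality applies again.\<close>

lemma expansion:
  assumes Z: "finite Z" "6 * real (card Z) * m \<le> e" and U: "U \<subseteq> U0 - Z" "U \<noteq> {}"
  shows "real (card U) / (2 * m) \<le> (real (card (nbh Z U)) / m) powr (1 + \<eta>)"
proof -
  have finU: "finite U" using U(1) fin by (meson finite_Diff finite_subset)
  have finD: "finite (D \<inter> U0 \<times> U0)" using fin by blast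
  define T where "T = {d \<in> D \<inter> U0 \<times> U0. fst d \<in> U \<or> snd d \<in> U}"
  define N where "N = nbh Z U"
  have finN: "finite N" unfolding N_def nbh_def using fin by simp
  have NU0: "N \<subseteq> U0" unfolding N_def nbh_def by auto
  have finT: "finite T" unfolding T_def by (rule finite_subset[OF _ finD]) blast
  have finQ: "finite {d \<in> D \<inter> U0 \<times> U0. set (q d) \<inter> Z \<noteq> {}}" by (rule finite_subset[OF _ finD]) blast
  have cU: "card U \<le> card U0" using U(1) fin by (intro card_mono) auto
  have cDU: "real (card (U0 - U)) = m - real (card U)"
    using U(1) finU cU by (subst card_Diff_subset) auto
  have "D \<inter> U0 \<times> U0 \<subseteq> T \<union> D \<inter> (U0 - U) \<times> (U0 - U)" unfolding T_def by auto
  then have "card (D \<inter> U0 \<times> U0) \<le> card (T \<union> D \<inter> (U0 - U) \<times> (U0 - U))"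
    by (rule card_mono[rotated]) (use finT fin in blast)
  also have "\<dots> \<le> card T + card (D \<inter> (U0 - U) \<times> (U0 - U))" by (rule card_Un_le)
  finally have "e \<le> card T + real (card (D \<inter> (U0 - U) \<times> (U0 - U)))" by linarith
  also have "real (card (D \<inter> (U0 - U) \<times> (U0 - U))) \<le> e * (real (card (U0 - U)) / m) powr (1 + \<eta>)"
    by (rule extremal) blast
  also have "(real (card (U0 - U)) / m) powr (1 + \<eta>) \<le> (real (card (U0 - U)) / m) powr 1"
    using \<eta> m_pos cDU by (intro powr_mono') (auto simp: divide_simps)
  also have "\<dots> = 1 - real (card U) / m" using m_pos cDU cU by (simp add: diff_divide_distrib)
  finally have "e \<le> card T + e * (1 - real (card U) / m)" by (simp add: mult_left_mono)
  then have cT: "e * real (card U) / m \<le> card T" by (simp add: algebra_simps)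
  have "T \<subseteq> (D \<inter> N \<times> N) \<union> U \<times> Z \<union> Z \<times> U \<union> {d \<in> D \<inter> U0 \<times> U0. set (q d) \<inter> Z \<noteq> {}}"
  proof
    fix d assume d: "d \<in> T"
    obtain x y where xy: "d = (x, y)" by fastforce
    have "d \<in> D \<inter> N \<times> N" if "d \<notin> U \<times> Z" "d \<notin> Z \<times> U" "set (q d) \<inter> Z = {}"
      using that d U(1) unfolding xy T_def N_def nbh_def by auto
    then show "d \<in> (D \<inter> N \<times> N) \<union> U \<times> Z \<union> Z \<times> U \<union> {d \<in> D \<inter> U0 \<times> U0. set (q d) \<inter> Z \<noteq> {}}"
      using d unfolding T_def by blast
  qed
  then have "card T \<le> card ((D \<inter> N \<times> N) \<union> U \<times> Z \<union> Z \<times> U \<union> {d \<in> D \<inter> U0 \<times> U0. set (q d) \<inter> Z \<noteq> {}})"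
    by (rule card_mono[rotated]) (use finN finU Z(1) finQ in blast)
  also have "\<dots> \<le> card (D \<inter> N \<times> N) + card (U \<times> Z) + card (Z \<times> U) + card {d \<in> D \<inter> U0 \<times> U0. set (q d) \<inter> Z \<noteq> {}}"
    by (meson card_Un_le add_mono order_refl order_trans)
  also have "card {d \<in> D \<inter> U0 \<times> U0. set (q d) \<inter> Z \<noteq> {}} \<le> card Z"
  proof -
    define z where "z d = (SOME z. z \<in> set (q d) \<inter> Z)" for d
    have z: "z d \<in> set (q d) \<inter> Z" if "set (q d) \<inter> Z \<noteq> {}" for d
      unfolding z_def by (rule someI_ex) (use that in blast)
    have "inj_on z {d \<in> D \<inter> U0 \<times> U0. set (q d) \<inter> Z \<noteq> {}}"
    proof (rule inj_onI)
      fix d d' assume *: "d \<in> {d \<in> D \<inter> U0 \<times> U0. set (q d) \<inter> Z \<noteq> {}}" "d' \<in> {d \<in> D \<inter> U0 \<times> U0. set (q d) \<inter> Z \<noteq> {}}" "z d = z d'"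
      then have "z d \<in> set (q d) \<inter> set (q d')" using z[of d] z[of d'] by auto
      then show "d = d'" using packing * unfolding packing_def by blast
    qed
    then show ?thesis using z Z(1) by (intro card_inj_on_le[where f = z]) auto
  qed
  finally have "card T \<le> card (D \<inter> N \<times> N) + 2 * (card U * card Z) + card Z"
    by (simp add: card_cartesian_product mult.commute)
  moreover have "card Z \<le> card U * card Z" using U(2) finU by (simp add: card_gt_0_iff Suc_leI)
  ultimately have "card T \<le> card (D \<inter> N \<times> N) + 3 * (card U * card Z)" by linarith
  then have "real (card T) \<le> real (card (D \<inter> N \<times> N)) + 3 * (real (card U) * real (card Z))"
    by (metis (mono_tags) of_nat_add of_nat_le_iff of_nat_mult of_nat_numeral)
  also have "3 * (real (card U) * real (card Z)) \<le> e * real (card U) / (2 * m)"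
  proof -
    have "real (card U) * (6 * real (card Z) * m) \<le> real (card U) * e" using Z(2) by (intro mult_left_mono) auto
    then show ?thesis using m_pos by (simp add: field_simps)
  qed
  finally have "e * real (card U) / (2 * m) \<le> real (card (D \<inter> N \<times> N))" using cT by (simp add: field_simps)
  also have "\<dots> \<le> e * (real (card N) / m) powr (1 + \<eta>)" by (rule extremal) (rule NU0)
  finally have "e * (real (card U) / (2 * m)) \<le> e * (real (card N) / m) powr (1 + \<eta>)" by simp
  then show ?thesis unfolding N_def using pos by (subst (asm) mult_le_cancel_left_pos) auto
qed

text \<open>Iterates \<open>expansion\<close>. If the ball has relative size \<open>y\<close> in
  \<open>U0\<close>, the next one has relative size at least
  \<open>(y / 2) powr (1 / (1 + \<eta>))\<close>. The factor \<open>2 powr (- 1 / \<eta>)\<close> is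
  the fixed point of this map, so only the exponent of \<open>m\<close> changes, by the factor
  \<open>1 / (1 + \<eta>)\<close> per round.\<close>

lemma large_ball:
  assumes Z: "finite Z" "6 * real (card Z) * m \<le> e" and u: "u \<in> U0 - Z"
  shows "\<exists>B\<subseteq>U0 - Z. (\<forall>w\<in>B. dist_within G (verts G - Z) u w (s * (l + 1))) \<and>
     m * (2 powr (- 1 / \<eta>) * m powr (- ((1 / (1 + \<eta>)) ^ s))) \<le> real (card B)"
proof (induction s)
  case 0
  have "2 powr (- 1 / \<eta>) \<le> (1 :: real)" using powr_mono[of "- 1 / \<eta>" 0 2] \<eta> by simp
  then have "m * (2 powr (- 1 / \<eta>) * m powr (- ((1 / (1 + \<eta>)) ^ 0))) \<le> 1" using m_pos by (simp add: powr_minus field_simps)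
  moreover have "dist_within G (verts G - Z) u u 0" using u U0(1) by (intro dist_within_refl) auto
  ultimately show ?case using u by (intro exI[of _ "{u}"]) auto
next
  case (Suc s)
  then obtain B where B: "B \<subseteq> U0 - Z" "\<And>w. w \<in> B \<Longrightarrow> dist_within G (verts G - Z) u w (s * (l + 1))"
     "m * (2 powr (- 1 / \<eta>) * m powr (- ((1 / (1 + \<eta>)) ^ s))) \<le> real (card B)" by blast
  let ?th = "(1 / (1 + \<eta>)) ^ s"
  have "0 < m * (2 powr (- 1 / \<eta>) * m powr (- ?th))" using m_pos by simp
  then have "B \<noteq> {}" using B(3) by auto
  have "2 powr (- 1 / \<eta>) * m powr (- ?th) / 2 \<le> real (card B) / (2 * m)"
    using B(3) m_pos by (simp add: field_simps)
  also have "\<dots> \<le> (real (card (nbh Z B)) / m) powr (1 + \<eta>)" by (rule expansion[OF Z B(1) \<open>B \<noteq> {}\<close>])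
  finally have 1: "2 powr (- 1 / \<eta>) * m powr (- ?th) / 2 \<le> (real (card (nbh Z B)) / m) powr (1 + \<eta>)" .
  have "2 powr (- 1 / \<eta>) / 2 = 2 powr (- 1 / \<eta> - 1)" by (simp add: powr_diff)
  also have "- 1 / \<eta> - 1 = (- 1 / \<eta>) * (1 + \<eta>)" using \<eta> by (simp add: field_simps)
  finally have 2: "2 powr (- 1 / \<eta>) / 2 = (2 powr (- 1 / \<eta>)) powr (1 + \<eta>)" by (simp only: powr_powr)
  have "- ?th = - ((1 / (1 + \<eta>)) ^ Suc s) * (1 + \<eta>)" using \<eta> by simp
  then have 3: "m powr (- ?th) = (m powr (- ((1 / (1 + \<eta>)) ^ Suc s))) powr (1 + \<eta>)" by (simp only: powr_powr)
  have "(2 powr (- 1 / \<eta>) * m powr (- ((1 / (1 + \<eta>)) ^ Suc s))) powr (1 + \<eta>)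
      = (2 powr (- 1 / \<eta>)) powr (1 + \<eta>) * (m powr (- ((1 / (1 + \<eta>)) ^ Suc s))) powr (1 + \<eta>)"
    by (rule powr_mult)
  also have "\<dots> = 2 powr (- 1 / \<eta>) * m powr (- ?th) / 2" unfolding 2[symmetric] 3[symmetric] by simp
  finally have "(2 powr (- 1 / \<eta>) * m powr (- ((1 / (1 + \<eta>)) ^ Suc s))) powr (1 + \<eta>) \<le> (real (card (nbh Z B)) / m) powr (1 + \<eta>)"
    using 1 by linarith
  then have "2 powr (- 1 / \<eta>) * m powr (- ((1 / (1 + \<eta>)) ^ Suc s)) \<le> real (card (nbh Z B)) / m"
    using powr_less_mono2[of "1 + \<eta>" "real (card (nbh Z B)) / m"] \<eta> m_pos by (smt (verit) divide_nonneg_nonneg of_nat_0_le_iff)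
  then have "m * (2 powr (- 1 / \<eta>) * m powr (- ((1 / (1 + \<eta>)) ^ Suc s))) \<le> real (card (nbh Z B))"
    using m_pos by (simp add: field_simps)
  moreover have "nbh Z B \<subseteq> U0 - Z" unfolding nbh_def by blast
  moreover have "dist_within G (verts G - Z) u w (Suc s * (l + 1))" if w: "w \<in> nbh Z B" for w
  proof -
    obtain v where v: "v \<in> B" and wv: "w = v \<or> ((v, w) \<in> D \<and> set (q (v, w)) \<inter> Z = {}) \<or> ((w, v) \<in> D \<and> set (q (w, v)) \<inter> Z = {})"
      using w unfolding nbh_def by blast
    have in': "v \<in> verts G - Z" "w \<in> verts G - Z" using v w B(1) U0(1) unfolding nbh_def by auto
    have "dist_within G (verts G - Z) v w (l + 1)"
      using wv packing_dist_within[OF packing, of v w Z] packing_dist_within[OF packing, of w v Z] in'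
        dist_within_sym[OF G] dist_within_refl by metis
    then have "dist_within G (verts G - Z) u w (s * (l + 1) + (l + 1))" using B(2)[OF v] dist_within_trans by metis
    then show ?thesis by (simp add: algebra_simps)
  qed
  ultimately show ?case by (intro exI[of _ "nbh Z B"] conjI ballI)
qed

text \<open>For \<open>t\<close> pairwise unlinked vertices, the union of their cuts is small enough
  to be deleted. The balls around them are then disjoint, since an overlap gives a path of length at
  most \<open>2 * s * (l + 1)\<close> that avoids the cut of that pair; but by \<open>t2\<close>
  each ball has more than \<open>m / t\<close> vertices.\<close>

lemma unlinked_small:
  assumes A: "A \<subseteq> U0" "\<And>u v. u \<in> A \<Longrightarrow> v \<in> A \<Longrightarrow> u \<noteq> v \<Longrightarrow> \<not> linked G (2 * s * (l + 1)) z u v"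
    and t1: "6 * real (t * t * z) * m \<le> e"
    and t2: "1 < real t * (2 powr (- 1 / \<eta>) * m powr (- ((1 / (1 + \<eta>)) ^ s)))"
  shows "card A < t"
proof (rule ccontr)
  assume "\<not> card A < t"
  then have "t \<le> card A" by simp
  then obtain C where C: "C \<subseteq> A" "card C = t" using obtain_subset_with_card_n by blast
  have finC: "finite C" using C(1) A(1) fin by (meson finite_subset)
  have "\<forall>u v. \<exists>Z. u \<in> C \<longrightarrow> v \<in> C \<longrightarrow> u \<noteq> v \<longrightarrow> finite Z \<and> card Z \<le> z \<and> u \<notin> Z \<and> v \<notin> Z \<and>
     \<not> dist_within G (verts G - Z) u v (2 * s * (l + 1))"
    using A(2) C(1) unfolding linked_def by blast
  then obtain Zf where Zf: "\<And>u v. u \<in> C \<Longrightarrow> v \<in> C \<Longrightarrow> u \<noteq> v \<Longrightarrow> finite (Zf u v) \<and> card (Zf u v) \<le> z \<and> u \<notin> Zf u v \<and> v \<notin> Zf u v \<and>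
     \<not> dist_within G (verts G - Zf u v) u v (2 * s * (l + 1))" by metis
  define P where "P = {(u, v). u \<in> C \<and> v \<in> C \<and> u \<noteq> v}"
  have P: "P \<subseteq> C \<times> C" unfolding P_def by auto
  have finP: "finite P" using P finC by (meson finite_SigmaI finite_subset)
  have cP: "card P \<le> t * t" using card_mono[OF _ P] finC C(2) by (simp add: card_cartesian_product)
  define Z where "Z = (\<Union>(u, v)\<in>P. Zf u v)"
  have finZ: "finite Z" unfolding Z_def P_def using finP Zf by (auto simp: P_def)
  have "card Z \<le> (\<Sum>p\<in>P. card (case p of (u, v) \<Rightarrow> Zf u v))" unfolding Z_def by (rule card_UN_le[OF finP])
  also have "\<dots> \<le> (\<Sum>p\<in>P. z)" by (rule sum_mono) (use Zf in \<open>auto simp: P_def\<close>)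
  also have "\<dots> \<le> t * t * z" using cP by simp
  finally have cZ: "card Z \<le> t * t * z" .
  \<comment> \<open>The centre \<open>u\<close> is kept because it may lie in the cut of another
    pair.\<close>
  have "\<exists>B\<subseteq>U0 - (Z - {u}). (\<forall>w\<in>B. dist_within G (verts G - (Z - {u})) u w (s * (l + 1))) \<and>
     m * (2 powr (- 1 / \<eta>) * m powr (- ((1 / (1 + \<eta>)) ^ s))) \<le> real (card B)" if u: "u \<in> C" for u
  proof (rule large_ball)
    show "finite (Z - {u})" using finZ by simp
    show "u \<in> U0 - (Z - {u})" using u C(1) A(1) by blast
    have "card (Z - {u}) \<le> t * t * z" using cZ finZ by (meson card_Diff1_le order_trans)
    then have "real (card (Z - {u})) \<le> real (t * t * z)" by (rule of_nat_mono)
    then have "6 * real (card (Z - {u})) * m \<le> 6 * real (t * t * z) * m" using m_pos by (intro mult_right_mono mult_left_mono) linarith+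
    then show "6 * real (card (Z - {u})) * m \<le> e" using t1 by linarith
  qed
  then obtain B where B: "\<And>u. u \<in> C \<Longrightarrow> B u \<subseteq> U0 - (Z - {u})"
     "\<And>u w. u \<in> C \<Longrightarrow> w \<in> B u \<Longrightarrow> dist_within G (verts G - (Z - {u})) u w (s * (l + 1))"
     "\<And>u. u \<in> C \<Longrightarrow> m * (2 powr (- 1 / \<eta>) * m powr (- ((1 / (1 + \<eta>)) ^ s))) \<le> real (card (B u))" by metis
  have disj: "B u \<inter> B v = {}" if uv: "u \<in> C" "v \<in> C" "u \<noteq> v" for u v
  proof (rule ccontr)
    assume "B u \<inter> B v \<noteq> {}"
    then obtain w where w: "w \<in> B u" "w \<in> B v" by blast
    have sub: "Zf u v \<subseteq> Z" unfolding Z_def P_def using uv by auto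
    have uvZ: "u \<notin> Zf u v" "v \<notin> Zf u v" using Zf uv by blast+
    have "dist_within G (verts G - Zf u v) u w (s * (l + 1))"
      by (rule dist_within_mono[OF B(2)[OF uv(1) w(1)]]) (use sub uvZ in auto)
    moreover have "dist_within G (verts G - Zf u v) v w (s * (l + 1))"
      by (rule dist_within_mono[OF B(2)[OF uv(2) w(2)]]) (use sub uvZ in auto)
    ultimately have "dist_within G (verts G - Zf u v) u v (s * (l + 1) + s * (l + 1))"
      using dist_within_trans dist_within_sym[OF G] by metis
    moreover have "s * (l + 1) + s * (l + 1) = 2 * s * (l + 1)" by simp
    ultimately show False using Zf uv by metis
  qed
  have BU: "B u \<subseteq> U0" if "u \<in> C" for u using B(1) that by blast
  have finB: "finite (B u)" if "u \<in> C" for u using BU[OF that] fin finite_subset by blast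
  have "(\<Sum>u\<in>C. card (B u)) = card (\<Union>u\<in>C. B u)"
    using finC disj finB by (intro card_UN_disjoint[symmetric]) auto
  also have "\<dots> \<le> card U0" using BU fin by (intro card_mono) auto
  finally have "real (\<Sum>u\<in>C. card (B u)) \<le> m" by (simp only: of_nat_le_iff)
  moreover have "real t * (m * (2 powr (- 1 / \<eta>) * m powr (- ((1 / (1 + \<eta>)) ^ s)))) \<le> real (\<Sum>u\<in>C. card (B u))"
    using sum_bounded_below[of C "m * (2 powr (- 1 / \<eta>) * m powr (- ((1 / (1 + \<eta>)) ^ s)))" "\<lambda>u. real (card (B u))"] B(3) C(2)
    by simp
  moreover have "m * 1 < m * (real t * (2 powr (- 1 / \<eta>) * m powr (- ((1 / (1 + \<eta>)) ^ s))))"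
    using t2 m_pos by (intro mult_strict_left_mono)
  ultimately show False by (simp add: mult.left_commute)
qed

end

text \<open>On an extremal set \<open>U0\<close>, \<open>unlinked_small\<close> says that the linked
  relation has no large independent set. So \<open>pairwise_common_neighbours\<close> finds
  \<open>k\<close> vertices whose pairs have many common partners, and \<open>linked_common\<close>
  makes them pairwise linked. The resulting depth \<open>2 * L\<close> depends on
  \<open>\<delta>\<close> and \<open>l\<close> only.\<close>

theorem complete_shallow_minor_if_dense_packing:
  fixes \<delta> :: real
  assumes "0 < \<delta>"
  shows "\<exists>L. \<forall>k. \<exists>n0. \<forall>(G :: ('a, 'x) lgraph) D q W. \<forall>n\<ge>n0. wf_graph G \<longrightarrow> card (verts G) \<le> n \<longrightarrow>
     W \<subseteq> verts G \<longrightarrow> W \<noteq> {} \<longrightarrow> D \<subseteq> W \<times> W \<longrightarrow> packing G l (verts G) D q \<longrightarrow>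
     real (card W) * real n powr \<delta> \<le> real (card D) \<longrightarrow>
     shallow_minor L (complete_verts k) (complete_edges k) G"
proof -
  \<comment> \<open>Half of the exponent is spent on passing from density per vertex to density
    relative to \<open>|W| powr (1 + \<eta>)\<close>, as
    \<open>|W| powr \<eta> \<le> n powr \<eta>\<close>.\<close>
  define \<eta> where "\<eta> = \<delta> / 2"
  have \<eta>: "0 < \<eta>" using assms by (simp add: \<eta>_def)
  have "1 / (1 + \<eta>) < 1" using \<eta> by simp
  \<comment> \<open>After \<open>s\<close> rounds a ball falls short of \<open>U0\<close> by a
    factor of at most about \<open>n powr (\<eta> / 8)\<close>.\<close>
  then obtain s where s: "(1 / (1 + \<eta>)) ^ s < \<eta> / 8"
    using real_arch_pow_inv[of "\<eta> / 8" "1 / (1 + \<eta>)"] \<eta> by auto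
  define L where "L = 2 * s * (l + 1)"
  show ?thesis
  proof (rule exI[of _ "2 * L"], rule allI)
    fix k
    \<comment> \<open>\<open>z\<close> pays for the greedy choice of paths of length
      \<open>2 * L\<close>, \<open>b\<close> is the number of partners that
      \<open>linked_common\<close> asks for, and \<open>C\<close> collects the constants that
      \<open>n powr (\<eta> / 8)\<close> must beat.\<close>
    define z where "z = k + k * k * (2 * L + 1)"
    define b where "b = z + 3"
    define C where "C = 24 * real z + 1024 * real k * real b + 2 powr (1 / \<eta>) + 2"
    define n0 where "n0 = nat \<lceil>C powr (8 / \<eta>)\<rceil>"
    have C: "2 \<le> C" "24 * real z \<le> C" "1024 * real k * real b < C" "2 powr (1 / \<eta>) < C" unfolding C_def
      by (auto intro!: add_nonneg_nonneg add_nonneg_pos)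
    show "\<exists>n0. \<forall>(G :: ('a, 'x) lgraph) D q W. \<forall>n\<ge>n0. wf_graph G \<longrightarrow> card (verts G) \<le> n \<longrightarrow>
     W \<subseteq> verts G \<longrightarrow> W \<noteq> {} \<longrightarrow> D \<subseteq> W \<times> W \<longrightarrow> packing G l (verts G) D q \<longrightarrow>
     real (card W) * real n powr \<delta> \<le> real (card D) \<longrightarrow>
     shallow_minor (2 * L) (complete_verts k) (complete_edges k) G"
    proof (intro exI[of _ n0] allI impI)
      fix G :: "('a, 'x) lgraph" and D q W n
      assume n: "n0 \<le> n" and G: "wf_graph G" and cV: "card (verts G) \<le> n"
        and W: "W \<subseteq> verts G" "W \<noteq> {}" and D: "D \<subseteq> W \<times> W" and pk: "packing G l (verts G) D q"
        and dense: "real (card W) * real n powr \<delta> \<le> real (card D)"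
      have finW: "finite W" using W(1) wf_graph_finite[OF G] finite_subset by blast
      have wpos: "0 < real (card W)" using finW W(2) by (simp add: card_gt_0_iff)
      have wn: "card W \<le> n" using card_mono[OF wf_graph_finite[OF G] W(1)] cV by linarith
      have npos: "0 < real n" using wpos wn by linarith
      have "C powr (8 / \<eta>) \<le> real n" using n unfolding n0_def by linarith
      then have "(C powr (8 / \<eta>)) powr (\<eta> / 8) \<le> real n powr (\<eta> / 8)" using \<eta> by (intro powr_mono2) auto
      then have nC: "C \<le> real n powr (\<eta> / 8)" using \<eta> C(1) by (simp add: powr_powr)
      have n1: "1 \<le> real n" using npos by simp
      have nC2: "C \<le> real n powr (\<eta> / 2)" using nC powr_mono[of "\<eta> / 8" "\<eta> / 2" "real n"] n1 \<eta> by simp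
      define f where "f U = real (card (D \<inter> U \<times> U)) / real (card U) powr (1 + \<eta>)" for U
      let ?F = "{U. U \<subseteq> W \<and> U \<noteq> {}}"
      have finF: "finite ?F" by (rule finite_subset[of _ "Pow W"]) (use finW in auto)
      have WF: "W \<in> ?F" using W by simp
      have "Max (f ` ?F) \<in> f ` ?F" using finF WF by (intro Max_in) auto
      then obtain U0 where U0': "Max (f ` ?F) = f U0" "U0 \<in> ?F" by (rule imageE)
      have U0: "U0 \<in> ?F" "f U0 = Max (f ` ?F)" using U0' by simp_all
      have fmax: "f U \<le> f U0" if "U \<in> ?F" for U unfolding U0(2) using finF that by (intro Max_ge) auto
      define m where "m = real (card U0)"
      define e where "e = real (card (D \<inter> U0 \<times> U0))"
      have finU0: "finite U0" using U0(1) finW finite_subset by blast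
      have mpos: "0 < m" unfolding m_def using finU0 U0(1) by (simp add: card_gt_0_iff)
      have DW: "D \<inter> W \<times> W = D" using D by blast
      have "real n powr \<eta> * real (card W) powr (1 + \<eta>) = real (card W) * (real n powr \<eta> * real (card W) powr \<eta>)"
        using wpos by (simp add: powr_add)
      also have "\<dots> \<le> real (card W) * (real n powr \<eta> * real n powr \<eta>)"
        using wn \<eta> by (intro mult_left_mono powr_mono2) auto
      also have "\<dots> = real (card W) * real n powr \<delta>" by (simp add: powr_add[symmetric] \<eta>_def)
      finally have "real n powr \<eta> \<le> f W" unfolding f_def DW using dense wpos by (simp add: le_divide_eq)
      then have "real n powr \<eta> \<le> f U0" using fmax[OF WF] by linarith
      then have e1: "real n powr \<eta> * m powr (1 + \<eta>) \<le> e" unfolding f_def e_def m_def using mpos by (simp add: m_def le_divide_eq)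
      have m1: "1 \<le> m" using mpos unfolding m_def by simp
      have "real n powr \<eta> * m \<le> real n powr \<eta> * m powr (1 + \<eta>)"
        using powr_mono[of 1 "1 + \<eta>" m] m1 \<eta> by (intro mult_left_mono) auto
      then have e2: "real n powr \<eta> * m \<le> e" using e1 by linarith
      have epos: "0 < e" using e2 npos mpos by (smt (verit) mult_pos_pos powr_gt_zero)
      have "card (D \<inter> U0 \<times> U0) \<le> card (U0 \<times> U0)" using finU0 by (intro card_mono) auto
      then have "card (D \<inter> U0 \<times> U0) \<le> card U0 * card U0" by (simp add: card_cartesian_product)
      then have "e \<le> m * m" unfolding e_def m_def by (metis of_nat_le_iff of_nat_mult)
      then have "real n powr \<eta> * m \<le> m * m" using e2 by linarith
      then have mn: "real n powr \<eta> \<le> m" using mpos by simp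
      interpret extremal_packing G l D q U0 \<eta>
      proof
        show "U0 \<subseteq> verts G" "U0 \<noteq> {}" using U0(1) W(1) by auto
        show "0 < card (D \<inter> U0 \<times> U0)" using epos unfolding e_def by simp
        fix U assume U: "U \<subseteq> U0"
        show "real (card (D \<inter> U \<times> U)) \<le> real (card (D \<inter> U0 \<times> U0)) * (real (card U) / real (card U0)) powr (1 + \<eta>)"
        proof (cases "U = {}")
          case False
          then have "f U \<le> f U0" using fmax U U0(1) by blast
          moreover have "0 < real (card U)" using False U finU0 by (simp add: card_gt_0_iff finite_subset)
          ultimately show ?thesis unfolding f_def using mpos
            by (simp add: powr_divide field_simps m_def)
        qed simp
      qed (use G pk \<eta> in auto)
      \<comment> \<open>For \<open>t\<close> about \<open>n powr (\<eta> / 4)\<close>, the product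
        \<open>t * t\<close> is of order \<open>n powr (\<eta> / 2)\<close>. This is small against
        both \<open>m\<close> and \<open>e / m\<close>, which are at least
        \<open>n powr \<eta>\<close>, yet \<open>t\<close> exceeds \<open>m\<close> divided by the
        size of a ball.\<close>
      define t where "t = nat \<lceil>real n powr (\<eta> / 4)\<rceil>"
      have "1 \<le> real n powr (\<eta> / 4)" using n1 \<eta> by (simp add: ge_one_powr_ge_zero)
      then have t: "real n powr (\<eta> / 4) \<le> real t" "real t \<le> 2 * real n powr (\<eta> / 4)" unfolding t_def by linarith+
      have "real t * real t \<le> (2 * real n powr (\<eta> / 4)) * (2 * real n powr (\<eta> / 4))"
        using t by (intro mult_mono) auto
      then have tt: "real t * real t \<le> 4 * real n powr (\<eta> / 2)" by (simp add: powr_add[symmetric])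
      have nn: "real n powr (\<eta> / 2) * real n powr (\<eta> / 2) = real n powr \<eta>" by (simp add: powr_add[symmetric])
      have small: "card I < t" if "I \<subseteq> U0" "\<forall>u\<in>I. \<forall>v\<in>I. u \<noteq> v \<longrightarrow> \<not> linked G L z u v" for I
      proof (rule unlinked_small[where s = s and z = z])
        show "I \<subseteq> U0" by fact
        show "\<And>u v. u \<in> I \<Longrightarrow> v \<in> I \<Longrightarrow> u \<noteq> v \<Longrightarrow> \<not> linked G (2 * s * (l + 1)) z u v"
          using that(2) unfolding L_def by blast
        have "6 * (real t * real t * real z) \<le> 6 * (4 * real n powr (\<eta> / 2) * real z)"
          using tt by (intro mult_left_mono mult_right_mono) auto
        also have "\<dots> \<le> real n powr (\<eta> / 2) * C" using C(2) mult_left_mono[OF C(2), of "real n powr (\<eta> / 2)"] by simp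
        also have "\<dots> \<le> real n powr (\<eta> / 2) * real n powr (\<eta> / 2)" using nC2 by (intro mult_left_mono) auto
        finally have "6 * real (t * t * z) \<le> real n powr \<eta>" unfolding nn by simp
        then have "6 * real (t * t * z) * m \<le> real n powr \<eta> * m" using mpos by (intro mult_right_mono) auto
        then show "6 * real (t * t * z) * real (card U0) \<le> real (card (D \<inter> U0 \<times> U0))"
          using e2 unfolding e_def m_def by linarith
        let ?th = "(1 / (1 + \<eta>)) ^ s"
        have th: "0 < ?th" using \<eta> by simp
        have "m \<le> real n" unfolding m_def using U0'(2) finW wn card_mono[of W U0] by force
        then have "m powr ?th \<le> real n powr ?th" using th mpos by (intro powr_mono2) auto
        also have "\<dots> \<le> real n powr (\<eta> / 8)" using s n1 by (intro powr_mono) auto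
        finally have "2 powr (1 / \<eta>) * m powr ?th < real n powr (\<eta> / 8) * real n powr (\<eta> / 8)"
          using nC C(4) mpos by (intro mult_less_le_imp_less) auto
        also have "\<dots> = real n powr (\<eta> / 4)" by (simp add: powr_add[symmetric])
        finally have "2 powr (1 / \<eta>) * m powr ?th < real t" using t(1) by linarith
        then show "1 < real t * (2 powr (- 1 / \<eta>) * real (card U0) powr (- ?th))"
          unfolding m_def[symmetric] using mpos by (simp add: powr_minus field_simps)
      qed
      have "\<exists>B\<subseteq>U0. card B = k \<and> (\<forall>u\<in>B. \<forall>v\<in>B. u \<noteq> v \<longrightarrow> b \<le> card {w \<in> U0. linked G L z u w \<and> linked G L z v w})"
      proof (rule pairwise_common_neighbours)
        show "finite U0" by fact
        show "linked G L z u v \<Longrightarrow> linked G L z v u" for u v by (rule linked_sym[OF G])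
        show "0 < b" unfolding b_def by simp
        show "I \<subseteq> U0 \<Longrightarrow> \<forall>u\<in>I. \<forall>v\<in>I. u \<noteq> v \<longrightarrow> \<not> linked G L z u v \<Longrightarrow> card I < t" for I by (rule small)
        have "256 * real k * real b * (real t * real t) \<le> 256 * real k * real b * (4 * real n powr (\<eta> / 2))"
          using tt by (intro mult_left_mono) auto
        also have "\<dots> = (1024 * real k * real b) * real n powr (\<eta> / 2)" by simp
        also have "\<dots> < C * real n powr (\<eta> / 2)" using C(3) npos by (intro mult_strict_right_mono) auto
        also have "\<dots> \<le> real n powr (\<eta> / 2) * real n powr (\<eta> / 2)" using nC2 by (intro mult_right_mono) auto
        finally have "256 * real k * real b * (real t * real t) < m" unfolding nn using mn by linarith
        then have "real (256 * k * b * t\<^sup>2) < real (card U0)" unfolding m_def by (simp add: power2_eq_square)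
        then show "256 * k * b * t\<^sup>2 < card U0" by (simp only: of_nat_less_iff)
      qed
      then obtain B where B: "B \<subseteq> U0" "card B = k" "\<And>u v. u \<in> B \<Longrightarrow> v \<in> B \<Longrightarrow> u \<noteq> v \<Longrightarrow>
         b \<le> card {w \<in> U0. linked G L z u w \<and> linked G L z v w}" by blast
      have "finite B" using B(1) finU0 finite_subset by blast
      then obtain \<beta> where \<beta>: "bij_betw \<beta> {..<k} B" using B(2) ex_bij_betw_nat_finite[of B] by (auto simp: atLeast0LessThan)
      have inj\<beta>: "inj_on \<beta> {..<k}" and im\<beta>: "\<beta> ` {..<k} = B" using \<beta> unfolding bij_betw_def by auto
      show "shallow_minor (2 * L) (complete_verts k) (complete_edges k) G"
      proof (rule complete_shallow_minor_if_linked[where z = z, OF G inj\<beta>])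
        show "\<beta> ` {..<k} \<subseteq> verts G" using im\<beta> B(1) U0'(2) W(1) by auto
        show "k + k * k * (2 * L + 1) \<le> z" unfolding z_def by simp
        fix i j assume ij: "i < j" "j < k"
        then have "\<beta> i \<in> B" "\<beta> j \<in> B" "\<beta> i \<noteq> \<beta> j" using im\<beta> inj\<beta> by (auto simp: inj_on_def)
        then have "z + 3 \<le> card {w \<in> U0. linked G L z (\<beta> i) w \<and> linked G L z (\<beta> j) w}" using B(3) unfolding b_def by blast
        moreover have "finite {w \<in> U0. linked G L z (\<beta> i) w \<and> linked G L z (\<beta> j) w}" using finU0 by simp
        ultimately show "linked G (2 * L) z (\<beta> i) (\<beta> j)" by (intro linked_common[OF G]) auto
      qed
    qed
  qed
qed

section \<open>Orderings and colourings of nowhere dense graphs\<close>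

lemma card_heavy_le:
  assumes "finite D" "finite S"
  shows "c * card {v \<in> S. c \<le> card (D `` {v})} \<le> card D"
proof -
  have fin: "finite (D `` {v})" for v using assms(1) by (rule finite_Image)
  have "c * card {v \<in> S. c \<le> card (D `` {v})} = (\<Sum>v\<in>{v \<in> S. c \<le> card (D `` {v})}. c)" by simp
  also have "\<dots> \<le> (\<Sum>v\<in>{v \<in> S. c \<le> card (D `` {v})}. card (D `` {v}))" by (rule sum_mono) simp
  also have "\<dots> = card (SIGMA v:{v \<in> S. c \<le> card (D `` {v})}. D `` {v})"
    using assms(2) fin by (subst card_SigmaI) auto
  also have "\<dots> \<le> card D" using assms(1) by (intro card_mono) auto
  finally show ?thesis .
qed

lemma maximal_family_member:
  assumes "finite U" and "\<And>D. P D \<Longrightarrow> D \<subseteq> U" and "P {}"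
  shows "\<exists>D. P D \<and> (\<forall>d. d \<notin> D \<longrightarrow> \<not> P (insert d D))"
proof -
  have "finite {D. P D}" by (rule finite_subset[of _ "Pow U"]) (use assms in auto)
  moreover have "{} \<in> {D. P D}" using assms(3) by simp
  ultimately obtain D where D: "D \<in> {D. P D}" "\<And>E. E \<in> {D. P D} \<Longrightarrow> D \<subseteq> E \<Longrightarrow> D = E"
    using finite_has_maximal2[of "{D. P D}" "{}"] by (metis (no_types, lifting))
  have "\<not> P (insert d D)" if "d \<notin> D" for d
    using D(2)[of "insert d D"] that by blast
  then show ?thesis using D(1) by blast
qed

lemma packing_insert:
  assumes "packing G l R D q" "(u, v) \<notin> D" "walk G (u # p @ [v])" "set p \<subseteq> R" "length p \<le> l"
    and disj: "\<And>d. d \<in> D \<Longrightarrow> set p \<inter> set (q d) = {}"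
  shows "packing G l R (insert (u, v) D) (q((u, v) := p))"
proof -
  have "(q((u, v) := p)) d = q d" if "d \<in> D" for d using that assms(2) by auto
  moreover have "(q((u, v) := p)) (u, v) = p" by simp
  ultimately show ?thesis using assms(1,3-5) disj unfolding packing_def
    by (auto simp del: fun_upd_apply) (blast+)
qed

text \<open>\<open>D1\<close> is a maximal packing of walks between vertices of \<open>S\<close>,
  and \<open>X\<close> is the set of its interior vertices; \<open>D2\<close> is a maximal packing
  of shorter walks from \<open>S\<close> to \<open>S \<union> X\<close> with at most
  \<open>c\<close> walks per start. Sparsity bounds both, so some \<open>y\<close> has few partners
  in \<open>D1\<close> and is not full in \<open>D2\<close>. The set \<open>F\<close> collects the
  walks of \<open>D2\<close> that start at \<open>y\<close> or at a \<open>D1\<close>-partner of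
  \<open>y\<close>. A walk from \<open>y\<close> that misses \<open>F\<close> would, by maximality
  of \<open>D2\<close>, meet a walk of \<open>D2\<close> from another start \<open>v'\<close>;
  splicing the two gives a walk from \<open>y\<close> to \<open>v'\<close> that contradicts
  maximality of \<open>D1\<close>.\<close>

lemma small_hitting_set:
  assumes G: "wf_graph G" and S: "S \<subseteq> verts G" "S \<noteq> {}" and x: "0 < x"
    and sparse: "\<And>W D q. W \<subseteq> verts G \<Longrightarrow> W \<noteq> {} \<Longrightarrow> D \<subseteq> W \<times> W \<Longrightarrow> packing G (2 * r) (verts G) D q \<Longrightarrow>
       card D \<le> x * card W"
  shows "\<exists>y\<in>S. \<exists>F. finite F \<and> card F \<le> (4 * x + 1) * (4 * x * (1 + 2 * r * x)) * (r + 1) \<and>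
     (\<forall>p v. walk G (y # p @ [v]) \<longrightarrow> set p \<subseteq> verts G - S \<longrightarrow> v \<in> S \<longrightarrow> v \<noteq> y \<longrightarrow> length p \<le> r \<longrightarrow>
        insert v (set p) \<inter> F \<noteq> {})"
proof -
  have finV: "finite (verts G)" by (rule wf_graph_finite[OF G])
  have finS: "finite S" using finV S(1) finite_subset by blast
  have Spos: "0 < card S" using finS S(2) by (simp add: card_gt_0_iff)
  have "\<exists>D. (D \<subseteq> S \<times> S \<and> (\<exists>q. packing G (2 * r) (verts G - S) D q)) \<and>
     (\<forall>d. d \<notin> D \<longrightarrow> \<not> (insert d D \<subseteq> S \<times> S \<and> (\<exists>q. packing G (2 * r) (verts G - S) (insert d D) q)))"
    by (rule maximal_family_member[of "S \<times> S"]) (use finS in \<open>auto simp: packing_def\<close>)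
  then obtain D1 q1 where D1: "D1 \<subseteq> S \<times> S" "packing G (2 * r) (verts G - S) D1 q1"
    and max1: "\<And>d q. d \<notin> D1 \<Longrightarrow> d \<in> S \<times> S \<Longrightarrow> \<not> packing G (2 * r) (verts G - S) (insert d D1) q"
    by (metis insert_subset)
  have finD1: "finite D1" using D1(1) finS by (meson finite_SigmaI finite_subset)
  have cD1: "card D1 \<le> x * card S"
    by (rule sparse[OF S D1(1) packing_mono[OF D1(2)]]) auto
  define X where "X = (\<Union>d\<in>D1. set (q1 d))"
  have XV: "X \<subseteq> verts G - S" using D1(2) unfolding X_def packing_def by fastforce
  have "card X \<le> (\<Sum>d\<in>D1. card (set (q1 d)))" unfolding X_def by (rule card_UN_le[OF finD1])
  also have "\<dots> \<le> (\<Sum>d\<in>D1. 2 * r)"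
  proof (rule sum_mono)
    fix d assume "d \<in> D1"
    then have "length (q1 d) \<le> 2 * r" using D1(2) unfolding packing_def by (metis surj_pair)
    then show "card (set (q1 d)) \<le> 2 * r" using card_length order_trans by blast
  qed
  also have "\<dots> \<le> 2 * r * x * card S" using cD1 by (simp add: algebra_simps)
  finally have cX: "card X \<le> 2 * r * x * card S" .
  \<comment> \<open>Since \<open>D2\<close> has at most \<open>x * (1 + 2 * r * x) * |S|\<close>
    pairs, at most a quarter of \<open>S\<close> is full; likewise at most a quarter has
    \<open>4 * x\<close> or more partners in \<open>D1\<close>.\<close>
  define c where "c = 4 * x * (1 + 2 * r * x)"
  have finSX: "finite (S \<union> X)" using finS XV finV by (meson Diff_subset finite_UnI finite_subset)
  define P2 where "P2 D \<longleftrightarrow> D \<subseteq> S \<times> (S \<union> X) \<and> (\<forall>v. card (D `` {v}) \<le> c) \<and>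
     (\<exists>q. packing G r (verts G - S - X) D q)" for D
  have "\<exists>D. P2 D \<and> (\<forall>d. d \<notin> D \<longrightarrow> \<not> P2 (insert d D))"
    by (rule maximal_family_member[of "S \<times> (S \<union> X)"]) (use finS finSX in \<open>auto simp: P2_def packing_def\<close>)
  then obtain D2 where P2: "P2 D2" and max2: "\<And>d. d \<notin> D2 \<Longrightarrow> \<not> P2 (insert d D2)" by blast
  obtain q2 where D2: "D2 \<subseteq> S \<times> (S \<union> X)" "\<And>v. card (D2 `` {v}) \<le> c" "packing G r (verts G - S - X) D2 q2"
    using P2 unfolding P2_def by blast
  have finD2: "finite D2" using D2(1) finS finSX by (meson finite_SigmaI finite_subset)
  have "card D2 \<le> x * card (S \<union> X)"
  proof (rule sparse)
    show "packing G (2 * r) (verts G) D2 q2" by (rule packing_mono[OF D2(3)]) auto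
  qed (use S XV D2(1) in auto)
  also have "\<dots> \<le> x * (card S + card X)" using card_Un_le by (intro mult_le_mono2)
  also have "\<dots> \<le> x * (card S + 2 * r * x * card S)" using cX by (intro mult_le_mono2) simp
  finally have cD2: "card D2 \<le> x * (1 + 2 * r * x) * card S" by (simp add: algebra_simps)
  define full where "full = {v \<in> S. c \<le> card (D2 `` {v})}"
  define heavy where "heavy = {v \<in> S. 4 * x \<le> card (D1 `` {v})}"
  have "c * card full \<le> x * (1 + 2 * r * x) * card S"
    using card_heavy_le[OF finD2 finS, of c] cD2 unfolding full_def by linarith
  then have "x * (1 + 2 * r * x) * (4 * card full) \<le> x * (1 + 2 * r * x) * card S" unfolding c_def by (simp only: mult.assoc mult.left_commute)
  then have full: "4 * card full \<le> card S" using x by simp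
  have "4 * x * card heavy \<le> x * card S"
    using card_heavy_le[OF finD1 finS, of "4 * x"] cD1 unfolding heavy_def by linarith
  then have "x * (4 * card heavy) \<le> x * card S" by (simp only: mult.assoc mult.left_commute)
  then have heavy: "4 * card heavy \<le> card S" using x by simp
  have "\<not> S \<subseteq> full \<union> heavy"
  proof
    assume "S \<subseteq> full \<union> heavy"
    then have "card S \<le> card (full \<union> heavy)" by (rule card_mono[rotated]) (simp add: full_def heavy_def finS)
    also have "\<dots> \<le> card full + card heavy" by (rule card_Un_le)
    finally show False using full heavy Spos by linarith
  qed
  then obtain y where "y \<in> S" "y \<notin> full" "y \<notin> heavy" by blast
  then have y: "y \<in> S" "card (D2 `` {y}) < c" "card (D1 `` {y}) < 4 * x"
    unfolding full_def heavy_def by (simp_all add: not_le)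
  define A where "A = insert y (D1 `` {y})"
  define F where "F = (\<Union>v\<in>A. \<Union>w\<in>D2 `` {v}. insert w (set (q2 (v, w))))"
  have finA: "finite A" unfolding A_def using finD1 by (simp add: finite_Image)
  have finI: "finite (D2 `` {v})" for v using finD2 by (rule finite_Image)
  have cA: "card A \<le> 4 * x + 1" unfolding A_def using y(3) card_insert_le_m1[of "4 * x + 1" "D1 `` {y}" y] by simp
  have "card F \<le> (\<Sum>v\<in>A. card (\<Union>w\<in>D2 `` {v}. insert w (set (q2 (v, w)))))"
    unfolding F_def by (rule card_UN_le[OF finA])
  also have "\<dots> \<le> (\<Sum>v\<in>A. c * (r + 1))"
  proof (rule sum_mono)
    fix v
    have "card (\<Union>w\<in>D2 `` {v}. insert w (set (q2 (v, w)))) \<le> (\<Sum>w\<in>D2 `` {v}. card (insert w (set (q2 (v, w)))))"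
      by (rule card_UN_le[OF finI])
    also have "\<dots> \<le> (\<Sum>w\<in>D2 `` {v}. r + 1)"
    proof (rule sum_mono)
      fix w assume "w \<in> D2 `` {v}"
      then have "length (q2 (v, w)) \<le> r" using D2(3) unfolding packing_def by blast
      then have "card (set (q2 (v, w))) \<le> r" using card_length order_trans by blast
      then show "card (insert w (set (q2 (v, w)))) \<le> r + 1"
        using card_insert_le_m1[of "r + 1" "set (q2 (v, w))" w] by simp
    qed
    also have "\<dots> \<le> c * (r + 1)" using mult_le_mono1[OF D2(2)[of v], of "r + 1"] by simp
    finally show "card (\<Union>w\<in>D2 `` {v}. insert w (set (q2 (v, w)))) \<le> c * (r + 1)" .
  qed
  also have "\<dots> \<le> (4 * x + 1) * (c * (r + 1))" using cA by (simp only: sum_constant of_nat_id mult_le_mono1)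
  finally have cF: "card F \<le> (4 * x + 1) * (4 * x * (1 + 2 * r * x)) * (r + 1)" unfolding c_def by (simp only: mult.assoc)
  have finF: "finite F" unfolding F_def using finA finI by blast
  have hit: "insert v (set p) \<inter> F \<noteq> {}"
    if p: "walk G (y # p @ [v])" "set p \<subseteq> verts G - S" "v \<in> S" "v \<noteq> y" "length p \<le> r" for p v
  proof
    assume noF: "insert v (set p) \<inter> F = {}"
    \<comment> \<open>The walk is cut at its first vertex in \<open>X \<union> S\<close>, so that
      the prefix \<open>p'\<close> is an admissible interior for \<open>D2\<close>.\<close>
    have "\<exists>z\<in>set (p @ [v]). z \<in> X \<union> S" using p(3) by simp
    then obtain p' w p'' where sp: "p @ [v] = p' @ w # p''" "w \<in> X \<union> S" "\<And>z. z \<in> set p' \<Longrightarrow> z \<notin> X \<union> S"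
      using split_list_first_prop[of "p @ [v]" "\<lambda>z. z \<in> X \<union> S"] by blast
    have p'p: "set p' \<subseteq> set p" "length p' \<le> length p"
    proof -
      show "set p' \<subseteq> set p" "length p' \<le> length p"
        using sp(1) by (cases p'' rule: rev_cases; auto)+
    qed
    have w_in: "w \<in> insert v (set p)"
    proof -
      have "w \<in> set (p @ [v])" using sp(1) by simp
      then show ?thesis by simp
    qed
    have "walk G ((y # p' @ [w]) @ p'')" using p(1) sp(1) by simp
    then have walk': "walk G (y # p' @ [w])" unfolding successively_append_iff by blast
    have p'V: "set p' \<subseteq> verts G - S - X" using p(2) p'p(1) sp(3) by blast
    have wD2: "(y, w) \<notin> D2"
    proof
      assume "(y, w) \<in> D2"
      then have "w \<in> F" unfolding F_def A_def by blast
      then show False using noF w_in by blast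
    qed
    have "\<exists>d\<in>D2. set p' \<inter> set (q2 d) \<noteq> {}"
    proof (rule ccontr)
      assume "\<not> ?thesis"
      then have "packing G r (verts G - S - X) (insert (y, w) D2) (q2((y, w) := p'))"
        using p'V p'p(2) p(5) by (intro packing_insert[OF D2(3) wD2 walk']) auto
      moreover have "card (insert (y, w) D2 `` {v}) \<le> c" for v
      proof (cases "v = y")
        case True
        have "insert (y, w) D2 `` {y} = insert w (D2 `` {y})" by auto
        then show ?thesis using y(2) finI[of y] True by (simp add: card_insert_if)
      next
        case False
        then have "insert (y, w) D2 `` {v} = D2 `` {v}" by auto
        then show ?thesis using D2(2) by simp
      qed
      moreover have "insert (y, w) D2 \<subseteq> S \<times> (S \<union> X)" using D2(1) y(1) sp(2) by blast
      ultimately have "P2 (insert (y, w) D2)" unfolding P2_def by blast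
      then show False using max2[OF wD2] by blast
    qed
    then obtain v' w' z where d: "(v', w') \<in> D2" "z \<in> set p'" "z \<in> set (q2 (v', w'))" by (metis disjoint_iff surj_pair)
    have v'S: "v' \<in> S" using d(1) D2(1) by blast
    have "v' \<notin> A"
    proof
      assume "v' \<in> A"
      then have "z \<in> F" unfolding F_def using d by blast
      then show False using noF d(2) p'p(1) by blast
    qed
    then have yv': "(y, v') \<notin> D1" "y \<noteq> v'" unfolding A_def by auto
    obtain p1 p2 where p1: "p' = p1 @ z # p2" using split_list[OF d(2)] by blast
    obtain r1 r2 where r1: "q2 (v', w') = r1 @ z # r2" using split_list[OF d(3)] by blast
    have q2': "walk G (v' # q2 (v', w') @ [w'])" "set (q2 (v', w')) \<subseteq> verts G - S - X" "length (q2 (v', w')) \<le> r"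
      using D2(3) d(1) unfolding packing_def by blast+
    have "walk G ((y # p1 @ [z]) @ p2 @ [w])" using walk' p1 by simp
    then have wk1: "walk G (y # p1 @ [z])" unfolding successively_append_iff by blast
    have "walk G ((v' # r1 @ [z]) @ r2 @ [w'])" using q2'(1) r1 by simp
    then have "walk G (v' # r1 @ [z])" unfolding successively_append_iff by blast
    then have wk2: "walk G (rev (v' # r1 @ [z]))" by (rule walk_rev[OF G])
    \<comment> \<open>The splice follows \<open>p'\<close> to the common vertex \<open>z\<close> and
      then the walk of \<open>D2\<close> back to its start. Both pieces have at most
      \<open>r\<close> interior vertices and avoid \<open>X\<close>, hence the interiors of all
      walks of \<open>D1\<close>.\<close>
    define s where "s = p1 @ z # rev r1"
    have "walk G ((y # p1) @ [z])" using wk1 by simp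
    moreover have wk2': "walk G (z # rev r1 @ [v'])" using wk2 by simp
    ultimately have "walk G ((y # p1) @ (z # rev r1 @ [v']))" unfolding successively_append_iff[of _ "y # p1"] by simp
    then have ws: "walk G (y # s @ [v'])" unfolding s_def by simp
    have sV: "set s \<subseteq> verts G - S - X" using p'V q2'(2) p1 r1 unfolding s_def by auto
    have ls: "length s \<le> 2 * r" using p'p(2) p(5) q2'(3) p1 r1 unfolding s_def by simp
    have "packing G (2 * r) (verts G - S) (insert (y, v') D1) (q1((y, v') := s))"
    proof (rule packing_insert[OF D1(2) yv'(1) ws _ ls])
      show "set s \<subseteq> verts G - S" using sV by blast
      show "set s \<inter> set (q1 d) = {}" if "d \<in> D1" for d using sV that unfolding X_def by blast
    qed
    then show False using max1[OF yv'(1)] y(1) v'S by blast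
  qed
  show ?thesis using y(1) finF cF hit by blast
qed

text \<open>The highest rank goes to a vertex \<open>y\<close> that is good for the whole set, and
  the rest is ranked recursively. So each vertex is good for the set of vertices ranked up to
  it.\<close>

lemma ranking_exists:
  assumes "finite S" and "S \<subseteq> V" and step: "\<And>T. T \<subseteq> V \<Longrightarrow> T \<noteq> {} \<Longrightarrow> \<exists>y\<in>T. Q T y"
  shows "\<exists>\<rho> :: 'a \<Rightarrow> nat. inj_on \<rho> S \<and> (\<forall>x\<in>S. \<rho> x < card S) \<and> (\<forall>y\<in>S. Q {x \<in> S. \<rho> x \<le> \<rho> y} y)"
  using assms(1,2)
proof (induction "card S" arbitrary: S)
  case 0
  then have "S = {}" by simp
  then show ?case by simp
next
  case (Suc m)
  then obtain y where y: "y \<in> S" "Q S y" using step[of S] by fastforce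
  have cS: "card (S - {y}) = m" using Suc y(1) by simp
  obtain \<rho> :: "'a \<Rightarrow> nat" where \<rho>: "inj_on \<rho> (S - {y})" "\<And>x. x \<in> S - {y} \<Longrightarrow> \<rho> x < m"
     "\<And>z. z \<in> S - {y} \<Longrightarrow> Q {x \<in> S - {y}. \<rho> x \<le> \<rho> z} z"
  proof -
    have "\<exists>\<rho> :: 'a \<Rightarrow> nat. inj_on \<rho> (S - {y}) \<and> (\<forall>x\<in>S - {y}. \<rho> x < card (S - {y})) \<and>
       (\<forall>z\<in>S - {y}. Q {x \<in> S - {y}. \<rho> x \<le> \<rho> z} z)"
      by (rule Suc.hyps(1)) (use cS Suc.prems in auto)
    then show ?thesis using cS that by blast
  qed
  define \<rho>' where "\<rho>' = \<rho>(y := m)"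
  have \<rho>': "\<rho>' x = \<rho> x" if "x \<noteq> y" for x using that unfolding \<rho>'_def by simp
  have \<rho>'y: "\<rho>' y = m" unfolding \<rho>'_def by simp
  have lt: "\<rho>' x < m" if "x \<in> S" "x \<noteq> y" for x using \<rho>(2) that \<rho>' by simp
  have le: "\<rho>' x \<le> m" if "x \<in> S" for x using lt[OF that] \<rho>'y by (cases "x = y") auto
  have "inj_on \<rho>' S"
  proof (rule inj_onI)
    fix a b assume ab: "a \<in> S" "b \<in> S" "\<rho>' a = \<rho>' b"
    show "a = b"
    proof (cases "a = y \<or> b = y")
      case True
      then show ?thesis using ab lt \<rho>'y by (metis less_irrefl)
    next
      case False
      then show ?thesis using ab \<rho>(1) \<rho>' unfolding inj_on_def by simp
    qed
  qed
  moreover have "\<forall>x\<in>S. \<rho>' x < card S" using le Suc.hyps(2) by (simp add: less_Suc_eq_le Suc.hyps(2)[symmetric])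
  moreover have "Q {x \<in> S. \<rho>' x \<le> \<rho>' z} z" if z: "z \<in> S" for z
  proof (cases "z = y")
    case True
    then have "{x \<in> S. \<rho>' x \<le> \<rho>' z} = S" using le \<rho>'y by auto
    then show ?thesis using y(2) True by simp
  next
    case False
    then have "{x \<in> S. \<rho>' x \<le> \<rho>' z} = {x \<in> S - {y}. \<rho> x \<le> \<rho> z}"
    proof (intro set_eqI)
      fix a
      show "a \<in> {x \<in> S. \<rho>' x \<le> \<rho>' z} \<longleftrightarrow> a \<in> {x \<in> S - {y}. \<rho> x \<le> \<rho> z}"
        using lt[OF z False] \<rho>'y \<rho>'[of a] \<rho>'[OF False] by (cases "a = y") auto
    qed
    then show ?thesis using \<rho>(3)[of z] False z by simp
  qed
  ultimately show ?case by blast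
qed

text \<open>The vertices \<open>u\<close> of the conclusion are those weakly reachable from
  \<open>v\<close> within \<open>l\<close> steps. A path from \<open>v\<close> to such a
  \<open>u\<close> different from \<open>v\<close> drops below the rank of \<open>v\<close> for a
  first time, and \<open>F v\<close> meets it no later than there. From the meeting point
  \<open>y\<close> the rest of the path is shorter by at least one edge, so induction on
  \<open>l\<close> branches over at most \<open>c\<close> choices of \<open>y\<close>, with one more
  element for \<open>v\<close> itself.\<close>

lemma card_weakly_reachable_le:
  fixes \<rho> :: "'a \<Rightarrow> nat"
  assumes G: "wf_graph G" and inj: "inj_on \<rho> (verts G)"
    and F: "\<And>y. y \<in> verts G \<Longrightarrow> finite (F y) \<and> card (F y) \<le> c"
    and hit: "\<And>y p v. y \<in> verts G \<Longrightarrow> walk G (y # p @ [v]) \<Longrightarrow> set p \<subseteq> {w \<in> verts G. \<rho> y < \<rho> w} \<Longrightarrow>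
       v \<in> verts G \<Longrightarrow> \<rho> v < \<rho> y \<Longrightarrow> length p \<le> r \<Longrightarrow> insert v (set p) \<inter> F y \<noteq> {}"
    and l: "l \<le> r + 1"
  shows "\<exists>R. finite R \<and> card R \<le> (c + 1) ^ l \<and>
    (\<forall>u. dist_within G {w \<in> verts G. \<rho> u \<le> \<rho> w} v u l \<longrightarrow> u \<in> R)"
  using l
proof (induction l arbitrary: v)
  case 0
  have "u = v" if "dist_within G {w \<in> verts G. \<rho> u \<le> \<rho> w} v u 0" for u
  proof -
    obtain p where "p \<noteq> []" "hd p = v" "last p = u" "length p \<le> 1" using \<open>dist_within _ _ _ _ _\<close> unfolding dist_within_walk by auto
    then show ?thesis by (cases p) auto
  qed
  then show ?case by (intro exI[of _ "{v}"]) auto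
next
  case (Suc l)
  show ?case
  proof (cases "v \<in> verts G")
    case False
    then have "\<not> dist_within G {w \<in> verts G. \<rho> u \<le> \<rho> w} v u (Suc l)" for u
      using dist_within_mem(1)[of G "{w \<in> verts G. \<rho> u \<le> \<rho> w}" v u] by blast
    then show ?thesis by (intro exI[of _ "{}"]) auto
  next
    case v: True
    have "\<forall>y. \<exists>R. finite R \<and> card R \<le> (c + 1) ^ l \<and> (\<forall>u. dist_within G {w \<in> verts G. \<rho> u \<le> \<rho> w} y u l \<longrightarrow> u \<in> R)"
      using Suc by simp
    then obtain R where R: "\<And>y. finite (R y)" "\<And>y. card (R y) \<le> (c + 1) ^ l"
      "\<And>y u. dist_within G {w \<in> verts G. \<rho> u \<le> \<rho> w} y u l \<Longrightarrow> u \<in> R y"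
      unfolding choice_iff by blast
    define R' where "R' = insert v (\<Union>y\<in>F v. R y)"
    have finF: "finite (F v)" and cF: "card (F v) \<le> c" using F[OF v] by auto
    have "card (\<Union>y\<in>F v. R y) \<le> (\<Sum>y\<in>F v. card (R y))" by (rule card_UN_le[OF finF])
    also have "\<dots> \<le> (\<Sum>y\<in>F v. (c + 1) ^ l)" by (rule sum_mono) (rule R(2))
    also have "\<dots> \<le> c * (c + 1) ^ l" using cF by simp
    finally have "card (\<Union>y\<in>F v. R y) \<le> c * (c + 1) ^ l" .
    then have "card R' \<le> c * (c + 1) ^ l + 1" unfolding R'_def
      using card_insert_le_m1[of "c * (c + 1) ^ l + 1" "\<Union>y\<in>F v. R y" v] by simp
    also have "\<dots> \<le> (c + 1) ^ Suc l" by simp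
    finally have "card R' \<le> (c + 1) ^ Suc l" .
    moreover have "finite R'" unfolding R'_def using finF R(1) by simp
    moreover have "u \<in> R'" if d: "dist_within G {w \<in> verts G. \<rho> u \<le> \<rho> w} v u (Suc l)" for u
    proof (cases "u = v")
      case True
      then show ?thesis unfolding R'_def by simp
    next
      case uv: False
      obtain p0 where p0: "p0 \<noteq> []" "hd p0 = v" "last p0 = u" "set p0 \<subseteq> {w \<in> verts G. \<rho> u \<le> \<rho> w}" "length p0 \<le> Suc l + 1" "walk G p0"
        using d unfolding dist_within_walk by blast
      obtain p where p: "p \<noteq> []" "hd p = v" "last p = u" "set p \<subseteq> {w \<in> verts G. \<rho> u \<le> \<rho> w}" "length p \<le> Suc l + 1" "walk G p" "distinct p"
        using walk_distinct[OF p0(6,1)] p0(2-5) by (auto dest: order_trans)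
      obtain p' where p': "p = v # p'" using p(1,2) by (cases p) auto
      have "p' \<noteq> []" using p' p(3) uv by auto
      then have up': "u \<in> set p'" using p(3) p' last_in_set[of p'] by auto
      have "u \<in> verts G" "\<rho> u \<le> \<rho> v" using dist_within_mem[OF d] by auto
      moreover have "\<rho> u \<noteq> \<rho> v" using inj uv v \<open>u \<in> verts G\<close> by (auto simp: inj_on_def)
      ultimately have "\<exists>z\<in>set p'. \<rho> z \<le> \<rho> v" using up' by auto
      then obtain a z b where sp: "p' = a @ z # b" "\<rho> z \<le> \<rho> v" "\<And>x. x \<in> set a \<Longrightarrow> \<not> \<rho> x \<le> \<rho> v"
        using split_list_first_prop[of p' "\<lambda>z. \<rho> z \<le> \<rho> v"] by blast
      have zV: "z \<in> verts G" "z \<noteq> v" using p(4,7) p' sp(1) by auto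
      then have "\<rho> z \<noteq> \<rho> v" using inj_onD[OF inj _ zV(1) v] by blast
      then have "\<rho> z < \<rho> v" using sp(2) by simp
      moreover have "walk G ((v # a @ [z]) @ b)" using p(6) p' sp(1) by simp
      then have "walk G (v # a @ [z])" unfolding successively_append_iff by blast
      moreover have "set a \<subseteq> {w \<in> verts G. \<rho> v < \<rho> w}" using sp(3) p(4) p' sp(1) by (fastforce simp: not_le)
      moreover have "length a \<le> r" using p(5) p' sp(1) Suc.prems by simp
      ultimately obtain y where y: "y \<in> F v" "y \<in> insert z (set a)" using hit[OF v] zV(1) by blast
      then have "y \<in> set p'" using sp(1) by auto
      then obtain a' b' where sp': "p' = a' @ y # b'" using split_list by fastforce
      have "walk G ((v # a') @ (y # b'))" using p(6) p' sp' by simp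
      then have "walk G (y # b')" unfolding successively_append_iff by blast
      moreover have "last (y # b') = u" using p(3) p' sp' by (simp split: if_splits)
      moreover have "set (y # b') \<subseteq> {w \<in> verts G. \<rho> u \<le> \<rho> w}" using p(4) p' sp' by auto
      moreover have "length (y # b') \<le> l + 1" using p(5) p' sp' by simp
      ultimately have "dist_within G {w \<in> verts G. \<rho> u \<le> \<rho> w} y u l"
        unfolding dist_within_walk by (intro exI[of _ "y # b'"]) simp
      then show ?thesis using R(3) y(1) unfolding R'_def by blast
    qed
    ultimately show ?thesis by blast
  qed
qed

section \<open>Colourings that separate weakly reachable vertices\<close>

lemma greedy_colouring:
  fixes \<rho> :: "'a \<Rightarrow> nat"
  assumes "finite V" and N: "\<And>v. finite (N v) \<and> card (N v) \<le> c"
  shows "\<exists>col :: 'a \<Rightarrow> nat. \<forall>v\<in>V. col v \<le> c \<and> (\<forall>u\<in>V. u \<in> N v \<longrightarrow> \<rho> u < \<rho> v \<longrightarrow> col u \<noteq> col v)"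
  using assms(1)
proof (induction V rule: finite_ranking_induct[where f = \<rho>])
  case empty
  then show ?case by simp
next
  case (insert x S)
  then obtain col :: "'a \<Rightarrow> nat" where col: "\<And>v. v \<in> S \<Longrightarrow> col v \<le> c"
    "\<And>u v. v \<in> S \<Longrightarrow> u \<in> S \<Longrightarrow> u \<in> N v \<Longrightarrow> \<rho> u < \<rho> v \<Longrightarrow> col u \<noteq> col v" by blast
  show ?case
  proof (cases "x \<in> S")
    case True
    then show ?thesis using col by (metis insert_absorb)
  next
    case False
    have "card (col ` N x) \<le> c" using N[of x] card_image_le[of "N x" col] by linarith
    then have "\<not> {..c} \<subseteq> col ` N x" using card_mono[of "col ` N x" "{..c}"] N[of x] by auto
    then obtain a where a: "a \<le> c" "a \<notin> col ` N x" by blast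
    have "\<forall>v\<in>insert x S. (col(x := a)) v \<le> c \<and>
       (\<forall>u\<in>insert x S. u \<in> N v \<longrightarrow> \<rho> u < \<rho> v \<longrightarrow> (col(x := a)) u \<noteq> (col(x := a)) v)"
      using a col False insert.hyps(2) by (auto simp: image_iff not_less[symmetric])
    then show ?thesis by blast
  qed
qed

definition weak_colouring :: "('a, 'x) lgraph \<Rightarrow> ('a \<Rightarrow> nat) \<Rightarrow> nat \<Rightarrow> ('a \<Rightarrow> nat) \<Rightarrow> bool" where
  "weak_colouring G \<rho> r col \<longleftrightarrow> (\<forall>u v. u \<noteq> v \<longrightarrow> dist_within G {w \<in> verts G. \<rho> u \<le> \<rho> w} v u r \<longrightarrow> col u \<noteq> col v)"

text \<open>The vertex \<open>u\<close> of least rank on the path is weakly reachable from every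
  other vertex of it, so its colour occurs only once. One of the two parts left by \<open>u\<close>
  is long enough for the induction hypothesis and does not use this colour.\<close>

lemma long_paths_have_many_colours:
  assumes G: "wf_graph G" and col: "weak_colouring G \<rho> r col"
    and p: "walk G p" "distinct p" "set p \<subseteq> verts G" "2 ^ k \<le> length p" and r: "2 ^ k \<le> r + 1"
  shows "k < card (col ` set p)"
  using p r
proof (induction k arbitrary: p)
  case 0
  then have "p \<noteq> []" by auto
  then show ?case by (simp add: card_gt_0_iff)
next
  case (Suc k)
  \<comment> \<open>Truncation to \<open>2 ^ Suc k\<close> vertices keeps all distances to
    \<open>u\<close> within the radius \<open>r\<close>, however long the given path is.\<close>
  define p0 where "p0 = take (2 ^ Suc k) p"
  have p0: "walk G p0" "distinct p0" "set p0 \<subseteq> set p" "length p0 = 2 ^ Suc k"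
  proof -
    show "walk G p0" using Suc.prems(1) successively_append_iff[of _ p0 "drop (2 ^ Suc k) p"] unfolding p0_def by auto
  qed (use Suc.prems in \<open>auto simp: p0_def set_take_subset min_def\<close>)
  have "p0 \<noteq> []" using p0(4) by auto
  then obtain u where u: "u \<in> set p0" "\<And>w. w \<in> set p0 \<Longrightarrow> \<rho> u \<le> \<rho> w"
    using ex_min_if_finite[of "\<rho> ` set p0"] by (metis (no_types, lifting) List.finite_set arg_min_if_finite(1) arg_min_least set_empty)
  obtain p1 p2 where sp: "p0 = p1 @ u # p2" using split_list[OF u(1)] by blast
  have V: "set p0 \<subseteq> {w \<in> verts G. \<rho> u \<le> \<rho> w}" using p0(3) Suc.prems(3) u(2) by blast
  have differ: "col u \<noteq> col w" if w: "w \<in> set p1 \<union> set p2" for w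
  proof -
    have uw: "u \<noteq> w" using w p0(2) sp by auto
    have "dist_within G {w \<in> verts G. \<rho> u \<le> \<rho> w} w u r"
    proof (cases "w \<in> set p1")
      case True
      then obtain a b where ab: "p1 = a @ w # b" using split_list by fastforce
      have "walk G (a @ (w # b @ [u]) @ p2)" using p0(1) sp ab by simp
      then have "walk G (w # b @ [u])" unfolding successively_append_iff by blast
      moreover have "set (w # b @ [u]) \<subseteq> {w \<in> verts G. \<rho> u \<le> \<rho> w}" using V sp ab by auto
      moreover have "length (w # b @ [u]) \<le> r + 1" using p0(4) sp ab Suc.prems(5) by simp
      ultimately show ?thesis unfolding dist_within_walk by (intro exI[of _ "w # b @ [u]"]) simp
    next
      case False
      then have "w \<in> set p2" using w by simp
      then obtain a b where ab: "p2 = a @ w # b" using split_list by fastforce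
      have "walk G (p1 @ (u # a @ [w]) @ b)" using p0(1) sp ab by simp
      then have "walk G (u # a @ [w])" unfolding successively_append_iff by blast
      moreover have "set (u # a @ [w]) \<subseteq> {w \<in> verts G. \<rho> u \<le> \<rho> w}" using V sp ab by auto
      moreover have "length (u # a @ [w]) \<le> r + 1" using p0(4) sp ab Suc.prems(5) by simp
      ultimately have "dist_within G {w \<in> verts G. \<rho> u \<le> \<rho> w} u w r"
        unfolding dist_within_walk by (intro exI[of _ "u # a @ [w]"]) simp
      then show ?thesis by (rule dist_within_sym[OF G])
    qed
    then show ?thesis using col uw unfolding weak_colouring_def by blast
  qed
  have len: "length p1 + length p2 + 1 = 2 * 2 ^ k" using p0(4) sp by simp
  have w12: "walk G p1" "walk G p2" using p0(1) unfolding sp by (auto simp: successively_append_iff successively_Cons)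
  have "\<exists>p'. walk G p' \<and> distinct p' \<and> set p' \<subseteq> set p1 \<union> set p2 \<and> 2 ^ k \<le> length p'"
  proof (cases "2 ^ k \<le> length p1")
    case True
    then show ?thesis using w12 p0(2) sp by (intro exI[of _ p1]) auto
  next
    case False
    then have "2 ^ k \<le> length p2" using len by linarith
    then show ?thesis using w12 p0(2) sp by (intro exI[of _ p2]) auto
  qed
  then obtain p' where p': "walk G p'" "distinct p'" "set p' \<subseteq> set p1 \<union> set p2" "2 ^ k \<le> length p'" by blast
  have "set p' \<subseteq> verts G" using p'(3) V sp by auto
  moreover have "2 ^ k \<le> r + 1" using Suc.prems(5) by simp
  ultimately have "k < card (col ` set p')" using Suc.IH[OF p'(1,2) _ p'(4)] by blast
  moreover have "col u \<notin> col ` set p'" using differ p'(3) by auto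
  ultimately have "Suc k < card (insert (col u) (col ` set p'))" by simp
  also have "\<dots> \<le> card (col ` set p)" using p'(3) p0(3) sp by (intro card_mono) auto
  finally show ?case .
qed

section \<open>The elimination forest of a vertex set with respect to a ranking\<close>

definition ancestor :: "('a, 'x) lgraph \<Rightarrow> ('a \<Rightarrow> nat) \<Rightarrow> 'a set \<Rightarrow> 'a \<Rightarrow> 'a \<Rightarrow> bool" where
  "ancestor G \<rho> X u v \<longleftrightarrow> (\<exists>l. dist_within G {w \<in> X. \<rho> u \<le> \<rho> w} v u l)"

lemma ancestor_mem: "ancestor G \<rho> X u v \<Longrightarrow> u \<in> X \<and> v \<in> X \<and> \<rho> u \<le> \<rho> v"
  unfolding ancestor_def using dist_within_mem by fastforce

lemma ancestor_refl: "u \<in> X \<Longrightarrow> ancestor G \<rho> X u u"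
  unfolding ancestor_def by (rule exI[of _ 0], rule dist_within_refl) simp

lemma ancestor_trans:
  assumes "ancestor G \<rho> X u v" "ancestor G \<rho> X v w"
  shows "ancestor G \<rho> X u w"
proof -
  obtain l l' where l: "dist_within G {z \<in> X. \<rho> u \<le> \<rho> z} v u l" "dist_within G {z \<in> X. \<rho> v \<le> \<rho> z} w v l'"
    using assms unfolding ancestor_def by blast
  have "\<rho> u \<le> \<rho> v" using ancestor_mem[OF assms(1)] by blast
  then have "{z \<in> X. \<rho> v \<le> \<rho> z} \<subseteq> {z \<in> X. \<rho> u \<le> \<rho> z}" by auto
  then have "dist_within G {z \<in> X. \<rho> u \<le> \<rho> z} w v l'" by (rule dist_within_mono[OF l(2)]) simp
  from dist_within_trans[OF this l(1)] show ?thesis unfolding ancestor_def by blast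
qed

lemma ancestor_join:
  assumes G: "wf_graph G" and a: "ancestor G \<rho> X u w" "ancestor G \<rho> X v w" and le: "\<rho> u \<le> \<rho> v"
  shows "ancestor G \<rho> X u v"
proof -
  obtain l l' where l: "dist_within G {z \<in> X. \<rho> u \<le> \<rho> z} w u l" "dist_within G {z \<in> X. \<rho> v \<le> \<rho> z} w v l'"
    using a unfolding ancestor_def by blast
  have "{z \<in> X. \<rho> v \<le> \<rho> z} \<subseteq> {z \<in> X. \<rho> u \<le> \<rho> z}" using le by auto
  then have "dist_within G {z \<in> X. \<rho> u \<le> \<rho> z} v w l'"
    by (rule dist_within_mono[OF dist_within_sym[OF G l(2)]]) simp
  from dist_within_trans[OF this l(1)] show ?thesis unfolding ancestor_def by blast
qed

lemma ancestor_chain: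
  assumes "wf_graph G" "ancestor G \<rho> X u w" "ancestor G \<rho> X v w"
  shows "ancestor G \<rho> X u v \<or> ancestor G \<rho> X v u"
  using ancestor_join[OF assms] ancestor_join[OF assms(1,3,2)] by linarith

lemma edge_ancestor:
  assumes G: "wf_graph G" and e: "(u, v) \<in> edges G" "u \<in> X" "v \<in> X"
  shows "ancestor G \<rho> X u v \<or> ancestor G \<rho> X v u"
proof -
  have *: "ancestor G \<rho> X a b" if "(b, a) \<in> edges G" "a \<in> X" "b \<in> X" "\<rho> a \<le> \<rho> b" for a b
  proof -
    have "dist_within G {w \<in> X. \<rho> a \<le> \<rho> w} b a 1"
      unfolding dist_within_walk by (rule exI[of _ "[b, a]"]) (use that in simp)
    then show ?thesis unfolding ancestor_def by blast
  qed
  show ?thesis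
  proof (cases "\<rho> u \<le> \<rho> v")
    case True
    then show ?thesis using *[OF wf_graph_sym[OF G e(1)]] e by blast
  next
    case False
    then show ?thesis using *[OF e(1)] e by simp
  qed
qed

text \<open>Two ancestors \<open>a\<close> and \<open>b\<close> of \<open>v\<close> are comparable,
  say by a path in \<open>X\<close> on which \<open>a\<close> has least rank. The path sees at most
  \<open>h\<close> colours, so by \<open>long_paths_have_many_colours\<close> it has fewer than
  \<open>2 ^ h\<close> vertices, and the weak colouring separates \<open>a\<close> from
  \<open>b\<close>. Ancestors of \<open>v\<close> thus have distinct colours, all among the at most
  \<open>h\<close> colours on \<open>X\<close>.\<close>

lemma card_ancestors_le:
  assumes G: "wf_graph G" and inj: "inj_on \<rho> (verts G)" and col: "weak_colouring G \<rho> r col"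
    and X: "X \<subseteq> verts G" "card (col ` X) \<le> h" and r: "2 ^ h \<le> r + 1"
  shows "card {u. ancestor G \<rho> X u v} \<le> h"
proof -
  have finX: "finite X" using X(1) wf_graph_finite[OF G] finite_subset by blast
  have "col a \<noteq> col b" if ab: "ancestor G \<rho> X a v" "ancestor G \<rho> X b v" "\<rho> a < \<rho> b" for a b
  proof -
    have "ancestor G \<rho> X a b" using ancestor_join[OF G ab(1,2)] ab(3) by simp
    then obtain l where "dist_within G {w \<in> X. \<rho> a \<le> \<rho> w} b a l" unfolding ancestor_def by blast
    then obtain p0 where p0: "p0 \<noteq> []" "hd p0 = b" "last p0 = a" "set p0 \<subseteq> {w \<in> X. \<rho> a \<le> \<rho> w}" "walk G p0"
      unfolding dist_within_walk by blast
    obtain p where p: "p \<noteq> []" "hd p = b" "last p = a" "set p \<subseteq> {w \<in> X. \<rho> a \<le> \<rho> w}" "walk G p" "distinct p"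
      using walk_distinct[OF p0(5,1)] p0(2-4) by (auto dest: order_trans)
    have "col ` set p \<subseteq> col ` X" using p(4) by blast
    then have "card (col ` set p) \<le> h" using X(2) finX by (meson card_mono finite_imageI order_trans)
    then have "\<not> 2 ^ h \<le> length p"
      using long_paths_have_many_colours[OF G col p(5,6) _ _ r] p(4) X(1) by fastforce
    then have "length p \<le> r + 1" using r by linarith
    then have "dist_within G {w \<in> verts G. \<rho> a \<le> \<rho> w} b a r"
      unfolding dist_within_walk using p X(1) by (intro exI[of _ p]) auto
    moreover have "a \<noteq> b" using ab(3) by auto
    ultimately show ?thesis using col unfolding weak_colouring_def by blast
  qed
  then have "inj_on col {u. ancestor G \<rho> X u v}"
  proof (intro inj_onI, unfold mem_Collect_eq)
    fix a b assume *: "ancestor G \<rho> X a v" "ancestor G \<rho> X b v" "col a = col b"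
    then have "\<rho> a = \<rho> b"
      using \<open>\<And>a b. ancestor G \<rho> X a v \<Longrightarrow> ancestor G \<rho> X b v \<Longrightarrow> \<rho> a < \<rho> b \<Longrightarrow> col a \<noteq> col b\<close>
      by (metis linorder_neqE_nat)
    moreover have "a \<in> verts G" "b \<in> verts G" using ancestor_mem[OF *(1)] ancestor_mem[OF *(2)] X(1) by auto
    ultimately show "a = b" using inj by (simp add: inj_on_def)
  qed
  moreover have "col ` {u. ancestor G \<rho> X u v} \<subseteq> col ` X" using ancestor_mem by fastforce
  ultimately have "card {u. ancestor G \<rho> X u v} \<le> card (col ` X)"
    using finX by (intro card_inj_on_le) auto
  then show ?thesis using X(2) by linarith
qed

text \<open>Packings with interiors of length at most \<open>2 * r\<close> are sparse in large
  graphs of the class, since for some \<open>k\<close> no member contains a clique of size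
  \<open>k\<close> as a minor of depth \<open>L\<close>. The hitting sets then have size polynomial
  in the density bound \<open>x\<close>, and this bounds weak reachability and with it the number of
  colours.\<close>

theorem nowhere_dense_colouring:
  fixes \<G> :: "('v, 'x) lgraph set" and \<delta> :: real
  assumes nd: "nowhere_dense \<G>" and wf: "\<And>G. G \<in> \<G> \<Longrightarrow> wf_graph G" and \<delta>: "0 < \<delta>"
  shows "\<exists>n0. \<forall>G\<in>\<G>. n0 \<le> card (verts G) \<longrightarrow> (\<exists>\<rho> col :: 'v \<Rightarrow> nat. inj_on \<rho> (verts G) \<and>
     (\<forall>v\<in>verts G. real (col v) < real (card (verts G)) powr \<delta>) \<and>
     (\<forall>X\<subseteq>verts G. card (col ` X) \<le> h \<longrightarrow> (\<forall>v. card {u. ancestor G \<rho> X u v} \<le> h)))"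
proof -
  define r :: nat where "r = 2 ^ h"
  have rpos: "0 < r" unfolding r_def by simp
  \<comment> \<open>\<open>c\<close> is cubic in \<open>x\<close>, which is about
    \<open>n powr \<delta>'\<close>, and enters with exponent \<open>r\<close>; this costs
    \<open>n powr (\<delta> / 2)\<close>. The other half of the exponent absorbs the constant
    \<open>(16 * M) ^ r\<close>.\<close>
  define \<delta>' where "\<delta>' = \<delta> / (6 * real r)"
  have \<delta>': "0 < \<delta>'" using \<delta> rpos unfolding \<delta>'_def by simp
  obtain L where L: "\<And>k. \<exists>n0. \<forall>(G :: ('v, 'x) lgraph) D q W. \<forall>n\<ge>n0. wf_graph G \<longrightarrow> card (verts G) \<le> n \<longrightarrow>
     W \<subseteq> verts G \<longrightarrow> W \<noteq> {} \<longrightarrow> D \<subseteq> W \<times> W \<longrightarrow> packing G (2 * r) (verts G) D q \<longrightarrow>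
     real (card W) * real n powr \<delta>' \<le> real (card D) \<longrightarrow>
     shallow_minor L (complete_verts k) (complete_edges k) G"
    using complete_shallow_minor_if_dense_packing[OF \<delta>', of "2 * r", where 'a = 'v and 'x = 'x] by blast
  obtain k where k: "\<And>G. G \<in> \<G> \<Longrightarrow> \<not> shallow_minor L (complete_verts k) (complete_edges k) G"
    using nd unfolding nowhere_dense_def somewhere_dense_def by blast
  obtain n1 where n1: "\<And>G :: ('v, 'x) lgraph. \<And>D q W n. n1 \<le> n \<Longrightarrow> wf_graph G \<Longrightarrow> card (verts G) \<le> n \<Longrightarrow>
     W \<subseteq> verts G \<Longrightarrow> W \<noteq> {} \<Longrightarrow> D \<subseteq> W \<times> W \<Longrightarrow> packing G (2 * r) (verts G) D q \<Longrightarrow>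
     real (card W) * real n powr \<delta>' \<le> real (card D) \<Longrightarrow>
     shallow_minor L (complete_verts k) (complete_edges k) G"
    using L[of k] by blast
  define M where "M = 20 * real (1 + 2 * r) * real (r + 1)"
  have M: "1 \<le> M" unfolding M_def by (simp add: algebra_simps)
  define n0 where "n0 = max (max n1 1) (nat \<lceil>((16 * M) ^ r + 1) powr (2 / \<delta>)\<rceil>)"
  show ?thesis
  proof (rule exI[of _ n0], intro ballI impI)
    fix G assume G\<G>: "G \<in> \<G>" and n0: "n0 \<le> card (verts G)"
    define n where "n = card (verts G)"
    have G: "wf_graph G" by (rule wf[OF G\<G>])
    have n: "n1 \<le> n" "1 \<le> n" "((16 * M) ^ r + 1) powr (2 / \<delta>) \<le> real n"
      using n0 unfolding n0_def n_def by linarith+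
    define x where "x = nat \<lceil>real n powr \<delta>'\<rceil>"
    have "1 \<le> real n powr \<delta>'" using n(2) \<delta>' by (simp add: ge_one_powr_ge_zero)
    then have x: "real n powr \<delta>' \<le> real x" "real x \<le> 2 * real n powr \<delta>'" "0 < x" unfolding x_def by linarith+
    define c where "c = (4 * x + 1) * (4 * x * (1 + 2 * r * x)) * (r + 1)"
    have sparse: "card D \<le> x * card W" if "W \<subseteq> verts G" "W \<noteq> {}" "D \<subseteq> W \<times> W" "packing G (2 * r) (verts G) D q" for W D q
    proof -
      have "\<not> real (card W) * real n powr \<delta>' \<le> real (card D)"
        using n1[OF n(1) G _ that] k[OF G\<G>] unfolding n_def by blast
      moreover have "real (card W) * real n powr \<delta>' \<le> real (card W) * real x" using x(1) by (rule mult_left_mono) simp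
      ultimately have "real (card D) \<le> real (x * card W)" by (simp add: mult.commute)
      then show ?thesis by (simp only: of_nat_le_iff)
    qed
    define hits where "hits S y F \<longleftrightarrow> finite F \<and> card F \<le> c \<and>
     (\<forall>p v. walk G (y # p @ [v]) \<longrightarrow> set p \<subseteq> verts G - S \<longrightarrow> v \<in> S \<longrightarrow> v \<noteq> y \<longrightarrow> length p \<le> r \<longrightarrow>
        insert v (set p) \<inter> F \<noteq> {})" for S y F
    define Q where "Q S y \<longleftrightarrow> (\<exists>F. hits S y F)" for S y
    have "\<exists>y\<in>T. Q T y" if "T \<subseteq> verts G" "T \<noteq> {}" for T
      unfolding Q_def hits_def c_def by (rule small_hitting_set[OF G that x(3) sparse])
    then obtain \<rho> :: "'v \<Rightarrow> nat" where \<rho>: "inj_on \<rho> (verts G)" "\<And>y. y \<in> verts G \<Longrightarrow> Q {x \<in> verts G. \<rho> x \<le> \<rho> y} y"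
      using ranking_exists[OF wf_graph_finite[OF G] order_refl, of Q] by blast
    define F where "F y = (SOME F. hits {x \<in> verts G. \<rho> x \<le> \<rho> y} y F)" for y
    have "hits {x \<in> verts G. \<rho> x \<le> \<rho> y} y (F y)" if "y \<in> verts G" for y
      using \<rho>(2)[OF that] unfolding Q_def F_def by (rule someI_ex)
    then have F: "\<And>y. y \<in> verts G \<Longrightarrow> finite (F y) \<and> card (F y) \<le> c"
      "\<And>y p v. y \<in> verts G \<Longrightarrow> walk G (y # p @ [v]) \<Longrightarrow> set p \<subseteq> verts G - {x \<in> verts G. \<rho> x \<le> \<rho> y} \<Longrightarrow>
         v \<in> {x \<in> verts G. \<rho> x \<le> \<rho> y} \<Longrightarrow> v \<noteq> y \<Longrightarrow> length p \<le> r \<Longrightarrow> insert v (set p) \<inter> F y \<noteq> {}"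
      unfolding hits_def by blast+
    have hit: "insert v (set p) \<inter> F y \<noteq> {}" if "y \<in> verts G" "walk G (y # p @ [v])" "set p \<subseteq> {w \<in> verts G. \<rho> y < \<rho> w}"
       "v \<in> verts G" "\<rho> v < \<rho> y" "length p \<le> r" for y p v
      using that by (intro F(2)) auto
    have "\<forall>v. \<exists>R. finite R \<and> card R \<le> (c + 1) ^ r \<and> (\<forall>u. dist_within G {w \<in> verts G. \<rho> u \<le> \<rho> w} v u r \<longrightarrow> u \<in> R)"
      using card_weakly_reachable_le[OF G \<rho>(1) F(1) hit] by simp
    then obtain R where R: "\<And>v. finite (R v) \<and> card (R v) \<le> (c + 1) ^ r"
      "\<And>u v. dist_within G {w \<in> verts G. \<rho> u \<le> \<rho> w} v u r \<Longrightarrow> u \<in> R v"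
      unfolding choice_iff by blast
    obtain col :: "'v \<Rightarrow> nat" where col: "\<And>v. v \<in> verts G \<Longrightarrow> col v \<le> (c + 1) ^ r"
      "\<And>u v. v \<in> verts G \<Longrightarrow> u \<in> verts G \<Longrightarrow> u \<in> R v \<Longrightarrow> \<rho> u < \<rho> v \<Longrightarrow> col u \<noteq> col v"
      using greedy_colouring[OF wf_graph_finite[OF G], of R "(c + 1) ^ r" \<rho>] R(1) by blast
    have wc: "weak_colouring G \<rho> r col" unfolding weak_colouring_def
    proof (intro allI impI)
      fix u v assume uv: "u \<noteq> v" "dist_within G {w \<in> verts G. \<rho> u \<le> \<rho> w} v u r"
      have "u \<in> verts G" "v \<in> verts G" "\<rho> u \<le> \<rho> v" using dist_within_mem[OF uv(2)] by auto
      moreover have "\<rho> u \<noteq> \<rho> v" using \<rho>(1) uv(1) calculation by (auto simp: inj_on_def)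
      ultimately show "col u \<noteq> col v" using col(2) R(2)[OF uv(2)] by simp
    qed
    have "real c + 1 \<le> 16 * M * (real n powr \<delta>') ^ 3"
    proof -
      have x1: "1 \<le> real x" using x(3) by simp
      have "real c = (4 * real x + 1) * (4 * real x * (1 + 2 * real r * real x)) * real (r + 1)"
        unfolding c_def by (simp only: of_nat_mult of_nat_add of_nat_numeral of_nat_1)
      also have "\<dots> \<le> (5 * real x) * (4 * real x * (real (1 + 2 * r) * real x)) * real (r + 1)"
        using x1 by (intro mult_mono) (auto simp: algebra_simps)
      also have "\<dots> = M * real x ^ 3" unfolding M_def by (simp add: power3_eq_cube)
      finally have c1: "real c \<le> M * real x ^ 3" .
      have "1 \<le> M * real x ^ 3" using M x1 one_le_power[OF x1, of 3] mult_mono[of 1 M 1 "real x ^ 3"] by simp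
      then have "real c + 1 \<le> 2 * M * real x ^ 3" using c1 by linarith
      also have "\<dots> \<le> 2 * M * (2 * real n powr \<delta>') ^ 3" using x(2) M by (intro mult_left_mono power_mono) auto
      finally show ?thesis by (simp add: power_mult_distrib)
    qed
    then have "(real c + 1) ^ r \<le> (16 * M * (real n powr \<delta>') ^ 3) ^ r" by (intro power_mono) auto
    also have "\<dots> = (16 * M) ^ r * (real n powr \<delta>') ^ (3 * r)" by (simp only: power_mult_distrib power_mult)
    also have "(real n powr \<delta>') ^ (3 * r) = real n powr (\<delta> / 2)"
    proof -
      have "(real n powr \<delta>') ^ (3 * r) = real n powr (\<delta>' * real (3 * r))"
        using n(2) by (subst powr_realpow[symmetric]) (auto simp: powr_powr)
      also have "\<delta>' * real (3 * r) = \<delta> / 2" unfolding \<delta>'_def using rpos by simp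
      finally show ?thesis .
    qed
    also have "(16 * M) ^ r * real n powr (\<delta> / 2) < real n powr (\<delta> / 2) * real n powr (\<delta> / 2)"
    proof (rule mult_strict_right_mono)
      have "(16 * M) ^ r + 1 = (((16 * M) ^ r + 1) powr (2 / \<delta>)) powr (\<delta> / 2)"
        using \<delta> M by (simp add: powr_powr add_nonneg_pos)
      also have "\<dots> \<le> real n powr (\<delta> / 2)" using n(3) \<delta> by (intro powr_mono2) auto
      finally show "(16 * M) ^ r < real n powr (\<delta> / 2)" by linarith
      show "0 < real n powr (\<delta> / 2)" using n(2) by simp
    qed
    also have "\<dots> = real n powr \<delta>" by (simp add: powr_add[symmetric])
    finally have small: "(real c + 1) ^ r < real n powr \<delta>" .
    have "real (col v) < real (card (verts G)) powr \<delta>" if "v \<in> verts G" for v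
    proof -
      have "real (col v) \<le> real ((c + 1) ^ r)" using col(1)[OF that] by (rule of_nat_mono)
      also have "\<dots> = (real c + 1) ^ r" by (simp add: add.commute)
      finally show ?thesis using small unfolding n_def by linarith
    qed
    moreover have "\<forall>X\<subseteq>verts G. card (col ` X) \<le> h \<longrightarrow> (\<forall>v. card {u. ancestor G \<rho> X u v} \<le> h)"
      using card_ancestors_le[OF G \<rho>(1) wc] unfolding r_def by simp
    ultimately show "\<exists>\<rho> col :: 'v \<Rightarrow> nat. inj_on \<rho> (verts G) \<and>
     (\<forall>v\<in>verts G. real (col v) < real (card (verts G)) powr \<delta>) \<and>
     (\<forall>X\<subseteq>verts G. card (col ` X) \<le> h \<longrightarrow> (\<forall>v. card {u. ancestor G \<rho> X u v} \<le> h))"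
      using \<rho>(1) by blast
  qed
qed

section \<open>Counting embeddings into forests of bounded height\<close>

text \<open>Forest orders, in which the elements below any given one form a chain. The rank is a
  linear extension, and through it every set of nodes has a canonical numbering.\<close>

locale tree_order =
  fixes X :: "'v set" and le :: "'v \<Rightarrow> 'v \<Rightarrow> bool" and \<rho> :: "'v \<Rightarrow> nat"
  assumes finX: "finite X" and inj_rank: "inj_on \<rho> X"
    and le_mem: "le u v \<Longrightarrow> u \<in> X \<and> v \<in> X \<and> \<rho> u \<le> \<rho> v"
    and le_refl: "u \<in> X \<Longrightarrow> le u u"
    and le_trans: "le u v \<Longrightarrow> le v w \<Longrightarrow> le u w"
    and le_chain: "le u w \<Longrightarrow> le v w \<Longrightarrow> le u v \<or> le v u"
begin

lemma le_antisym: "le u v \<Longrightarrow> le v u \<Longrightarrow> u = v"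
  by (meson le_mem inj_rank inj_on_def order_antisym)

lemma le_if_rank_le: "le u v \<or> le v u \<Longrightarrow> \<rho> u \<le> \<rho> v \<Longrightarrow> le u v"
  by (metis le_mem inj_rank inj_on_def order_antisym le_refl)

text \<open>The nodes of a pattern are numbered in order of rank, and its image is closed under
  ancestors. The numbering turns patterns into relations on numbers, which can be compared across
  graphs; closure under ancestors forces the chain below a node onto the whole chain below its
  image.\<close>

definition emb :: "nat \<Rightarrow> (nat \<times> nat) set \<Rightarrow> (nat \<Rightarrow> 'v) \<Rightarrow> bool" where
  "emb q Le \<psi> \<longleftrightarrow> (\<forall>i<q. \<psi> i \<in> X) \<and> (\<forall>i<q. \<forall>j<q. (i, j) \<in> Le \<longleftrightarrow> le (\<psi> i) (\<psi> j)) \<and>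
     (\<forall>i<q. \<forall>u. le u (\<psi> i) \<longrightarrow> (\<exists>j<q. u = \<psi> j)) \<and> (\<forall>i j. i < j \<longrightarrow> j < q \<longrightarrow> \<rho> (\<psi> i) < \<rho> (\<psi> j))"

lemma emb_mem: "emb q Le \<psi> \<Longrightarrow> i < q \<Longrightarrow> \<psi> i \<in> X"
  and emb_le: "emb q Le \<psi> \<Longrightarrow> i < q \<Longrightarrow> j < q \<Longrightarrow> (i, j) \<in> Le \<longleftrightarrow> le (\<psi> i) (\<psi> j)"
  and emb_down: "emb q Le \<psi> \<Longrightarrow> i < q \<Longrightarrow> le u (\<psi> i) \<Longrightarrow> \<exists>j<q. u = \<psi> j"
  and emb_mono: "emb q Le \<psi> \<Longrightarrow> i < j \<Longrightarrow> j < q \<Longrightarrow> \<rho> (\<psi> i) < \<rho> (\<psi> j)"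
  by (simp_all add: emb_def)

lemma emb_mono_le: "emb q Le \<psi> \<Longrightarrow> i \<le> j \<Longrightarrow> j < q \<Longrightarrow> \<rho> (\<psi> i) \<le> \<rho> (\<psi> j)"
  using emb_mono[of q Le \<psi> i j] by (cases "i = j") auto

lemma emb_inj: "emb q Le \<psi> \<Longrightarrow> i < q \<Longrightarrow> j < q \<Longrightarrow> \<psi> i = \<psi> j \<longleftrightarrow> i = j"
  using emb_mono[of q Le \<psi> i j] emb_mono[of q Le \<psi> j i] by (cases i j rule: linorder_cases) auto

lemma emb_Le_refl: "emb q Le \<psi> \<Longrightarrow> i < q \<Longrightarrow> (i, i) \<in> Le"
  using emb_le emb_mem le_refl by blast

lemma emb_Le_trans:
  "emb q Le \<psi> \<Longrightarrow> (i, j) \<in> Le \<Longrightarrow> (j, l) \<in> Le \<Longrightarrow> i < q \<Longrightarrow> j < q \<Longrightarrow> l < q \<Longrightarrow> (i, l) \<in> Le"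
  using emb_le le_trans by blast

lemma emb_Le_chain:
  "emb q Le \<psi> \<Longrightarrow> (i, l) \<in> Le \<Longrightarrow> (j, l) \<in> Le \<Longrightarrow> i < q \<Longrightarrow> j < q \<Longrightarrow> l < q \<Longrightarrow> (i, j) \<in> Le \<or> (j, i) \<in> Le"
  using emb_le le_chain by blast

lemma emb_Le_le:
  assumes "emb q Le \<psi>" "(i, j) \<in> Le" "i < q" "j < q"
  shows "i \<le> j"
proof (rule ccontr)
  assume "\<not> i \<le> j"
  then have "\<rho> (\<psi> j) < \<rho> (\<psi> i)" using emb_mono[OF assms(1)] assms(3) by simp
  moreover have "le (\<psi> i) (\<psi> j)" using emb_le[OF assms(1)] assms(2-4) by blast
  ultimately show False using le_mem by (metis not_less)
qed

text \<open>The image of a node determines the images of its ancestors: both restrictions are the increasing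
  enumeration of the same chain.\<close>
lemma emb_determined:
  assumes e: "emb q Le \<psi>" "emb q Le \<psi>'" and j: "j < q" "\<psi> j = \<psi>' j" and i: "i < q" "(i, j) \<in> Le"
  shows "\<psi> i = \<psi>' i"
  using i
proof (induction i rule: less_induct)
  case (less i)
  \<comment> \<open>The element \<open>\<chi> i\<close> lies below \<open>\<chi>' j\<close>, hence
    is \<open>\<chi>' l\<close> for some \<open>l\<close>; indices below \<open>i\<close> are
    already matched, so \<open>l\<close> is at least \<open>i\<close>. With the roles exchanged this
    gives equality of ranks.\<close>
  have *: "\<rho> (\<chi>' i) \<le> \<rho> (\<chi> i)" if c: "emb q Le \<chi>" "emb q Le \<chi>'" "\<chi> j = \<chi>' j"
    "\<And>i'. i' < i \<Longrightarrow> i' < q \<Longrightarrow> (i', j) \<in> Le \<Longrightarrow> \<chi> i' = \<chi>' i'" for \<chi> \<chi>'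
  proof -
    have "le (\<chi> i) (\<chi>' j)" using emb_le[OF c(1)] less.prems j(1) c(3) by metis
    then obtain l where l: "l < q" "\<chi> i = \<chi>' l" using emb_down[OF c(2) j(1)] by blast
    have lj: "(l, j) \<in> Le" using \<open>le (\<chi> i) (\<chi>' j)\<close> l emb_le[OF c(2)] j(1) by metis
    have "\<not> l < i"
    proof
      assume "l < i"
      then have "\<chi> l = \<chi> i" using c(4)[OF _ l(1) lj] l(2) by simp
      then show False using emb_inj[OF c(1) l(1) less.prems(1)] \<open>l < i\<close> by simp
    qed
    then show ?thesis using emb_mono_le[OF c(2) _ l(1), of i] l(2) by simp
  qed
  have "\<rho> (\<psi>' i) \<le> \<rho> (\<psi> i)" using less.IH by (intro *[OF e j(2)]) auto
  moreover have "\<rho> (\<psi> i) \<le> \<rho> (\<psi>' i)" using less.IH j(2) by (intro *[OF e(2,1)]) auto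
  ultimately show ?case using inj_rank emb_mem[OF e(1) less.prems(1)] emb_mem[OF e(2) less.prems(1)]
    by (auto simp: inj_on_def)
qed

text \<open>Places are counted within \<open>\<Psi>\<close> only. As \<open>\<Psi>\<close> will
  consist of embeddings with one common code, every re-embedding found this way also agrees in edges
  and labels.\<close>

definition rich :: "(nat \<Rightarrow> 'v) set \<Rightarrow> nat \<Rightarrow> (nat \<times> nat) set \<Rightarrow> nat \<Rightarrow> (nat \<Rightarrow> 'v) \<Rightarrow> nat \<Rightarrow> bool" where
  "rich \<Psi> q Le K \<psi> j \<longleftrightarrow> K \<le> card {\<psi>' j | \<psi>'. \<psi>' \<in> \<Psi> \<and> (\<forall>i<q. (i, j) \<in> Le \<longrightarrow> i \<noteq> j \<longrightarrow> \<psi>' i = \<psi> i)}"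

end

section \<open>Counting embeddings whose rich nodes have only small antichains\<close>

lemma card_restrict_insert_le:
  assumes fin: "finite \<Phi>" and K: "\<And>\<phi>. \<phi> \<in> \<Phi> \<Longrightarrow> card {\<phi>' i | \<phi>'. \<phi>' \<in> \<Phi> \<and> (\<forall>a\<in>A. \<phi>' a = \<phi> a)} \<le> K"
  shows "card ((\<lambda>\<phi>. restrict \<phi> (insert i A)) ` \<Phi>) \<le> K * card ((\<lambda>\<phi>. restrict \<phi> A) ` \<Phi>)"
proof -
  let ?T = "(\<lambda>\<phi>. restrict \<phi> (insert i A)) ` \<Phi>" and ?R = "(\<lambda>\<phi>. restrict \<phi> A) ` \<Phi>"
  have "?T \<subseteq> (\<Union>g\<in>?R. {f \<in> ?T. restrict f A = g})"
  proof
    fix f assume "f \<in> ?T"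
    then obtain \<phi> where \<phi>: "\<phi> \<in> \<Phi>" "f = restrict \<phi> (insert i A)" by blast
    then have "restrict f A = restrict \<phi> A" by (auto simp: restrict_def)
    then show "f \<in> (\<Union>g\<in>?R. {f \<in> ?T. restrict f A = g})" using \<phi> \<open>f \<in> ?T\<close> by blast
  qed
  then have "card ?T \<le> card (\<Union>g\<in>?R. {f \<in> ?T. restrict f A = g})" by (rule card_mono[rotated]) (use fin in auto)
  also have "\<dots> \<le> (\<Sum>g\<in>?R. card {f \<in> ?T. restrict f A = g})" using fin by (intro card_UN_le) auto
  also have "\<dots> \<le> (\<Sum>g\<in>?R. K)"
  proof (rule sum_mono)
    fix g assume "g \<in> ?R"
    then obtain \<phi> where \<phi>: "\<phi> \<in> \<Phi>" "g = restrict \<phi> A" by blast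
    have ev: "f i \<in> {\<phi>' i | \<phi>'. \<phi>' \<in> \<Phi> \<and> (\<forall>a\<in>A. \<phi>' a = \<phi> a)}" if f: "f \<in> ?T" "restrict f A = g" for f
    proof -
      obtain \<phi>' where \<phi>': "\<phi>' \<in> \<Phi>" "f = restrict \<phi>' (insert i A)" using f(1) by blast
      have "\<phi>' a = \<phi> a" if "a \<in> A" for a
      proof -
        have "restrict f A a = restrict \<phi> A a" using f(2) \<phi>(2) by simp
        then show ?thesis using that \<phi>'(2) by simp
      qed
      moreover have "f i = \<phi>' i" using \<phi>'(2) by simp
      ultimately show ?thesis using \<phi>'(1) by blast
    qed
    have "inj_on (\<lambda>f. f i) {f \<in> ?T. restrict f A = g}"
    proof (rule inj_onI)
      fix f f' assume *: "f \<in> {f \<in> ?T. restrict f A = g}" "f' \<in> {f \<in> ?T. restrict f A = g}" "f i = f' i"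
      have r: "f a = f' a" if "a \<in> A" for a
      proof -
        have "restrict f A a = restrict f' A a" using * by simp
        then show ?thesis using that by simp
      qed
      have "f \<in> extensional (insert i A)" "f' \<in> extensional (insert i A)" using * by auto
      then show "f = f'" by (rule extensionalityI) (use r *(3) in auto)
    qed
    moreover have "(\<lambda>f. f i) ` {f \<in> ?T. restrict f A = g} \<subseteq> {\<phi>' i | \<phi>'. \<phi>' \<in> \<Phi> \<and> (\<forall>a\<in>A. \<phi>' a = \<phi> a)}"
      using ev by auto
    moreover have "finite {\<phi>' i | \<phi>'. \<phi>' \<in> \<Phi> \<and> (\<forall>a\<in>A. \<phi>' a = \<phi> a)}" using fin by simp
    ultimately have "card {f \<in> ?T. restrict f A = g} \<le> card {\<phi>' i | \<phi>'. \<phi>' \<in> \<Phi> \<and> (\<forall>a\<in>A. \<phi>' a = \<phi> a)}"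
      by (rule card_inj_on_le)
    then show "card {f \<in> ?T. restrict f A = g} \<le> K" using K[OF \<phi>(1)] by linarith
  qed
  also have "\<dots> = K * card ?R" by simp
  finally show ?thesis .
qed

context tree_order begin

text \<open>The maximal rich nodes form an antichain, so there are at most \<open>d\<close> of them.
  Splitting \<open>\<Psi>\<close> by this set \<open>D\<close> gives the factor
  \<open>2 ^ q\<close>. Inside a part, the images of \<open>D\<close> contribute
  \<open>n ^ d\<close>, and then nodes are added in the order of their numbers. A node below a
  member of \<open>D\<close> is determined by \<open>emb_determined\<close>; any other node is not
  rich and has fewer than \<open>K\<close> places once its ancestors, which have smaller numbers,
  are fixed.\<close>

lemma card_embeddings_le:
  assumes \<Psi>: "\<Psi> \<subseteq> {..<q} \<rightarrow>\<^sub>E X" and emb: "\<And>\<psi>. \<psi> \<in> \<Psi> \<Longrightarrow> emb q Le \<psi>"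
    and n: "card X \<le> n" "1 \<le> n" and K: "1 \<le> K"
    and no: "\<And>\<psi> A. \<psi> \<in> \<Psi> \<Longrightarrow> A \<subseteq> {j. j < q \<and> rich \<Psi> q Le K \<psi> j} \<Longrightarrow>
       (\<forall>a\<in>A. \<forall>b\<in>A. a \<noteq> b \<longrightarrow> (a, b) \<notin> Le) \<Longrightarrow> card A \<noteq> Suc d"
  shows "card \<Psi> \<le> 2 ^ q * (n ^ d * K ^ q)"
proof -
  have fin\<Psi>: "finite \<Psi>" by (rule finite_subset[OF \<Psi>]) (use finX in \<open>simp add: finite_PiE\<close>)
  define tips where "tips \<psi> = {j. j < q \<and> rich \<Psi> q Le K \<psi> j \<and> (\<forall>l<q. rich \<Psi> q Le K \<psi> l \<longrightarrow> (j, l) \<in> Le \<longrightarrow> l = j)}" for \<psi>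
  have card_tips: "card (tips \<psi>) \<le> d" if \<psi>: "\<psi> \<in> \<Psi>" for \<psi>
  proof (rule ccontr)
    assume "\<not> ?thesis"
    then have "Suc d \<le> card (tips \<psi>)" by simp
    then obtain A where A: "A \<subseteq> tips \<psi>" "card A = Suc d" by (rule obtain_subset_with_card_n)
    have tipsD: "j < q" "rich \<Psi> q Le K \<psi> j" "\<And>l. l < q \<Longrightarrow> rich \<Psi> q Le K \<psi> l \<Longrightarrow> (j, l) \<in> Le \<Longrightarrow> l = j"
      if "j \<in> tips \<psi>" for j using that unfolding tips_def by simp_all
    have "A \<subseteq> {j. j < q \<and> rich \<Psi> q Le K \<psi> j}" using A(1) unfolding tips_def by auto
    moreover have "\<forall>a\<in>A. \<forall>b\<in>A. a \<noteq> b \<longrightarrow> (a, b) \<notin> Le"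
    proof (intro ballI impI notI)
      fix a b assume "a \<in> A" "b \<in> A" "a \<noteq> b" "(a, b) \<in> Le"
      then show False using tipsD(3)[of a b] tipsD(1,2)[of b] A(1) by auto
    qed
    ultimately show False using no[OF \<psi>] A(2) by blast
  qed
  have below_tip: "\<exists>l\<in>tips \<psi>. (j, l) \<in> Le" if \<psi>: "\<psi> \<in> \<Psi>" and j: "j < q" "rich \<Psi> q Le K \<psi> j" for \<psi> j
  proof -
    let ?B = "{l. l < q \<and> rich \<Psi> q Le K \<psi> l \<and> (j, l) \<in> Le}"
    have B: "finite ?B" "j \<in> ?B" using j emb_Le_refl[OF emb[OF \<psi>]] by auto
    define l where "l = Max ?B"
    have l: "l \<in> ?B" unfolding l_def by (rule Max_in) (use B in auto)
    have "l' = l" if l': "l' < q" "rich \<Psi> q Le K \<psi> l'" "(l, l') \<in> Le" for l'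
    proof -
      have "(j, l') \<in> Le" by (rule emb_Le_trans[OF emb[OF \<psi>], of j l l']) (use l l' j(1) in auto)
      then have "l' \<le> l" unfolding l_def using B l' by (intro Max_ge) auto
      moreover have "l \<le> l'" using emb_Le_le[OF emb[OF \<psi>] l'(3)] l l' by blast
      ultimately show ?thesis by simp
    qed
    then have "l \<in> tips \<psi>" unfolding tips_def using l by blast
    then show ?thesis using l by blast
  qed
  have part: "card {\<psi> \<in> \<Psi>. tips \<psi> = D} \<le> n ^ d * K ^ q" if D: "D \<subseteq> {..<q}" for D
  proof (cases "{\<psi> \<in> \<Psi>. tips \<psi> = D} = {}")
    case False
    define \<Phi> where "\<Phi> = {\<psi> \<in> \<Psi>. tips \<psi> = D}"
    have fin\<Phi>: "finite \<Phi>" unfolding \<Phi>_def using fin\<Psi> by simp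
    have finD: "finite D" using D finite_subset by blast
    have cD: "card D \<le> d" using False card_tips by blast
    have "i \<le> q \<Longrightarrow> card ((\<lambda>\<psi>. restrict \<psi> (D \<union> {..<i})) ` \<Phi>) \<le> n ^ d * K ^ i" for i
    proof (induction i)
      case 0
      have "(\<lambda>\<psi>. restrict \<psi> (D \<union> {..<0})) ` \<Phi> \<subseteq> D \<rightarrow>\<^sub>E X" using \<Psi> D unfolding \<Phi>_def by fastforce
      then have "card ((\<lambda>\<psi>. restrict \<psi> (D \<union> {..<0})) ` \<Phi>) \<le> card (D \<rightarrow>\<^sub>E X)"
        by (rule card_mono[rotated]) (use finD finX in \<open>simp add: finite_PiE\<close>)
      also have "\<dots> = card X ^ card D" using finD by (simp add: card_PiE)
      also have "\<dots> \<le> n ^ card D" using n(1) by (rule power_mono) simp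
      also have "\<dots> \<le> n ^ d" using n(2) cD by (intro power_increasing) auto
      finally show ?case by (simp only: power_0 mult_1_right)
    next
      case (Suc i)
      then have i: "i < q" by simp
      have "card ((\<lambda>\<psi>. restrict \<psi> (insert i (D \<union> {..<i}))) ` \<Phi>) \<le> K * card ((\<lambda>\<psi>. restrict \<psi> (D \<union> {..<i})) ` \<Phi>)"
      proof (rule card_restrict_insert_le[OF fin\<Phi>])
        fix \<phi> assume \<phi>: "\<phi> \<in> \<Phi>"
        then have \<phi>\<Psi>: "\<phi> \<in> \<Psi>" "tips \<phi> = D" unfolding \<Phi>_def by auto
        let ?S = "{\<phi>' i | \<phi>'. \<phi>' \<in> \<Phi> \<and> (\<forall>a\<in>D \<union> {..<i}. \<phi>' a = \<phi> a)}"
        show "card ?S \<le> K"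
        proof (cases "\<exists>j\<in>D. (i, j) \<in> Le")
          case True
          then obtain j where j: "j \<in> D" "(i, j) \<in> Le" by blast
          have "?S \<subseteq> {\<phi> i}"
          proof
            fix y assume "y \<in> ?S"
            then obtain \<phi>' where \<phi>': "\<phi>' \<in> \<Phi>" "\<forall>a\<in>D \<union> {..<i}. \<phi>' a = \<phi> a" "y = \<phi>' i" by blast
            have "\<phi>' i = \<phi> i"
              by (rule emb_determined[of q Le _ _ j]) (use \<phi>' \<phi>\<Psi> emb j i D in \<open>auto simp: \<Phi>_def\<close>)
            then show "y \<in> {\<phi> i}" using \<phi>'(3) by simp
          qed
          then have "card ?S \<le> card {\<phi> i}" by (intro card_mono) auto
          then show ?thesis using K by simp
        next
          case False
          then have "\<not> rich \<Psi> q Le K \<phi> i" using below_tip[OF \<phi>\<Psi>(1) i] \<phi>\<Psi>(2) by blast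
          then have lt: "card {\<psi>' i | \<psi>'. \<psi>' \<in> \<Psi> \<and> (\<forall>l<q. (l, i) \<in> Le \<longrightarrow> l \<noteq> i \<longrightarrow> \<psi>' l = \<phi> l)} < K"
            unfolding rich_def by simp
          have "?S \<subseteq> {\<psi>' i | \<psi>'. \<psi>' \<in> \<Psi> \<and> (\<forall>l<q. (l, i) \<in> Le \<longrightarrow> l \<noteq> i \<longrightarrow> \<psi>' l = \<phi> l)}"
          proof
            fix y assume "y \<in> ?S"
            then obtain \<phi>' where \<phi>': "\<phi>' \<in> \<Phi>" "\<forall>a\<in>D \<union> {..<i}. \<phi>' a = \<phi> a" "y = \<phi>' i" by blast
            have "\<phi>' l = \<phi> l" if "l < q" "(l, i) \<in> Le" "l \<noteq> i" for l
              using emb_Le_le[OF emb[OF \<phi>\<Psi>(1)] that(2,1) i] that(3) \<phi>'(2) by simp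
            then show "y \<in> {\<psi>' i | \<psi>'. \<psi>' \<in> \<Psi> \<and> (\<forall>l<q. (l, i) \<in> Le \<longrightarrow> l \<noteq> i \<longrightarrow> \<psi>' l = \<phi> l)}"
              using \<phi>'(1,3) unfolding \<Phi>_def by blast
          qed
          then have "card ?S \<le> card {\<psi>' i | \<psi>'. \<psi>' \<in> \<Psi> \<and> (\<forall>l<q. (l, i) \<in> Le \<longrightarrow> l \<noteq> i \<longrightarrow> \<psi>' l = \<phi> l)}"
            by (rule card_mono[rotated]) (use fin\<Psi> in simp)
          then show ?thesis using lt by linarith
        qed
      qed
      also have "\<dots> \<le> K * (n ^ d * K ^ i)" by (intro mult_le_mono2 Suc.IH) (use Suc.prems in simp)
      also have "insert i (D \<union> {..<i}) = D \<union> {..<Suc i}" by auto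
      finally show ?case by (simp only: power_Suc mult.left_commute)
    qed
    then have "card ((\<lambda>\<psi>. restrict \<psi> (D \<union> {..<q})) ` \<Phi>) \<le> n ^ d * K ^ q" by simp
    moreover have "restrict \<psi> (D \<union> {..<q}) = \<psi>" if "\<psi> \<in> \<Phi>" for \<psi>
    proof -
      have "D \<union> {..<q} = {..<q}" using D by blast
      moreover have "\<psi> \<in> {..<q} \<rightarrow>\<^sub>E X" using that \<Psi> unfolding \<Phi>_def by blast
      ultimately show ?thesis by (simp add: PiE_restrict)
    qed
    then have "(\<lambda>\<psi>. restrict \<psi> (D \<union> {..<q})) ` \<Phi> = \<Phi>" by simp
    ultimately show ?thesis unfolding \<Phi>_def by simp
  next
    case True
    then show ?thesis by (simp only: card.empty)
  qed
  have "\<Psi> \<subseteq> (\<Union>D\<in>Pow {..<q}. {\<psi> \<in> \<Psi>. tips \<psi> = D})"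
  proof
    fix \<psi> assume "\<psi> \<in> \<Psi>"
    moreover have "tips \<psi> \<in> Pow {..<q}" unfolding tips_def by auto
    ultimately show "\<psi> \<in> (\<Union>D\<in>Pow {..<q}. {\<psi> \<in> \<Psi>. tips \<psi> = D})" by blast
  qed
  then have "card \<Psi> \<le> card (\<Union>D\<in>Pow {..<q}. {\<psi> \<in> \<Psi>. tips \<psi> = D})" by (rule card_mono[rotated]) (use fin\<Psi> in auto)
  also have "\<dots> \<le> (\<Sum>D\<in>Pow {..<q}. card {\<psi> \<in> \<Psi>. tips \<psi> = D})" by (intro card_UN_le) simp
  also have "\<dots> \<le> (\<Sum>D\<in>Pow {..<q}. n ^ d * K ^ q)" by (rule sum_mono) (use part in auto)
  also have "\<dots> = 2 ^ q * (n ^ d * K ^ q)" by (simp add: card_Pow)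
  finally show ?thesis .
qed

lemma increasing_enumeration:
  assumes "C \<subseteq> X"
  shows "\<exists>\<psi>. \<psi> \<in> extensional {..<card C} \<and> \<psi> ` {..<card C} = C \<and> (\<forall>i j. i < j \<longrightarrow> j < card C \<longrightarrow> \<rho> (\<psi> i) < \<rho> (\<psi> j))"
proof -
  have finC: "finite C" using assms finX finite_subset by blast
  have inj: "inj_on \<rho> C" using inj_rank assms inj_on_subset by blast
  obtain h where h: "bij_betw h {..<card (\<rho> ` C)} (\<rho> ` C)" "strict_mono_on {..<card (\<rho> ` C)} h"
    using ex_bij_betw_strict_mono_card[of "\<rho> ` C"] finC by blast
  have c: "card (\<rho> ` C) = card C" using inj by (rule card_image)
  define \<psi> where "\<psi> = restrict (\<lambda>i. inv_into C \<rho> (h i)) {..<card C}"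
  have him: "h ` {..<card C} = \<rho> ` C" using h(1) unfolding bij_betw_def c by blast
  have \<psi>: "\<rho> (\<psi> i) = h i" if "i < card C" for i
  proof -
    have "h i \<in> \<rho> ` C" using him that by blast
    then show ?thesis unfolding \<psi>_def using that by (simp add: f_inv_into_f)
  qed
  have "\<psi> ` {..<card C} = inv_into C \<rho> ` (h ` {..<card C})" unfolding \<psi>_def by (auto simp: image_iff)
  also have "\<dots> = C" unfolding him using inj by (simp add: image_image)
  finally have "\<psi> ` {..<card C} = C" .
  moreover have "\<rho> (\<psi> i) < \<rho> (\<psi> j)" if "i < j" "j < card C" for i j
    using h(2) that \<psi> unfolding c by (simp add: strict_mono_on_def)
  moreover have "\<psi> \<in> extensional {..<card C}" unfolding \<psi>_def by simp
  ultimately show ?thesis by blast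
qed

text \<open>The ancestors of the images form a down-closed set of bounded size, enumerated by rank
  as \<open>\<psi>\<close>, so \<open>\<phi>\<close> factors through numbers as
  \<open>\<psi>\<close> after \<open>f\<close>. Every node of the pattern lies below an image of
  \<open>V\<close>; later this keeps the cut-off vertex sets of \<open>H\<close> non-empty.\<close>

lemma closure_embedding:
  assumes V: "finite V" and \<phi>: "\<phi> \<in> V \<rightarrow>\<^sub>E X" and depth: "\<And>v. card {u. le u v} \<le> p"
  shows "\<exists>q \<psi> f. q \<le> card V * p \<and> \<psi> \<in> {..<q} \<rightarrow>\<^sub>E X \<and>
     emb q {(i, j). i < q \<and> j < q \<and> le (\<psi> i) (\<psi> j)} \<psi> \<and>
     f \<in> V \<rightarrow>\<^sub>E {..<q} \<and> (\<forall>x\<in>V. \<phi> x = \<psi> (f x)) \<and> (\<forall>j<q. \<exists>x\<in>V. le (\<psi> j) (\<psi> (f x)))"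
proof -
  define C where "C = (\<Union>x\<in>V. {u. le u (\<phi> x)})"
  have CX: "C \<subseteq> X" unfolding C_def using le_mem by blast
  have "card C \<le> (\<Sum>x\<in>V. card {u. le u (\<phi> x)})" unfolding C_def by (rule card_UN_le[OF V])
  also have "\<dots> \<le> (\<Sum>x\<in>V. p)" by (rule sum_mono) (rule depth)
  finally have cC: "card C \<le> card V * p" by simp
  obtain \<psi> where \<psi>: "\<psi> \<in> extensional {..<card C}" "\<psi> ` {..<card C} = C"
     "\<And>i j. i < j \<Longrightarrow> j < card C \<Longrightarrow> \<rho> (\<psi> i) < \<rho> (\<psi> j)"
    using increasing_enumeration[OF CX] by blast
  define q where "q = card C"
  have mem: "\<psi> i \<in> C" if "i < q" for i using \<psi>(2) that unfolding q_def by blast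
  have ex: "\<exists>i<q. u = \<psi> i" if "u \<in> C" for u using \<psi>(2) that unfolding q_def by blast
  have down: "u \<in> C" if "le u v" "v \<in> C" for u v using that le_trans unfolding C_def by blast
  have "\<phi> x \<in> C" if "x \<in> V" for x using that \<phi> le_refl unfolding C_def by blast
  then have "\<forall>x\<in>V. \<exists>i. i < q \<and> \<phi> x = \<psi> i" using ex by blast
  then obtain f0 where f0: "\<And>x. x \<in> V \<Longrightarrow> f0 x < q \<and> \<phi> x = \<psi> (f0 x)" by metis
  define f where "f = restrict f0 V"
  have f: "f \<in> V \<rightarrow>\<^sub>E {..<q}" "\<And>x. x \<in> V \<Longrightarrow> \<phi> x = \<psi> (f x)" unfolding f_def using f0 by auto
  have "emb q {(i, j). i < q \<and> j < q \<and> le (\<psi> i) (\<psi> j)} \<psi>"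
    unfolding emb_def using mem CX ex down \<psi>(3) unfolding q_def by blast
  moreover have "\<exists>x\<in>V. le (\<psi> j) (\<psi> (f x))" if "j < q" for j
    using mem[OF that] f(2) unfolding C_def by auto
  moreover have "\<psi> \<in> {..<q} \<rightarrow>\<^sub>E X" using \<psi>(1) mem CX unfolding q_def by (auto simp: PiE_def)
  ultimately show ?thesis using f cC unfolding q_def by blast
qed

end

lemma distinct_representatives:
  assumes "finite I" and "\<And>i. i \<in> I \<Longrightarrow> card I \<le> card (Y i)"
  shows "\<exists>w. inj_on w I \<and> (\<forall>i\<in>I. w i \<in> Y i)"
proof -
  have "J \<subseteq> I \<Longrightarrow> \<exists>w. inj_on w J \<and> (\<forall>i\<in>J. w i \<in> Y i)" if "finite J" for J
    using that
  proof (induction J rule: finite_induct)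
    case (insert i J)
    then obtain w where w: "inj_on w J" "\<And>j. j \<in> J \<Longrightarrow> w j \<in> Y j" by blast
    have "card (w ` J) \<le> card J" using insert.hyps(1) by (rule card_image_le)
    also have "\<dots> < card (insert i J)" using insert.hyps by simp
    also have "\<dots> \<le> card I" using insert.prems assms(1) by (rule card_mono[rotated])
    also have "\<dots> \<le> card (Y i)" using assms(2) insert.prems by blast
    finally have "\<not> Y i \<subseteq> w ` J" using card_mono[of "w ` J" "Y i"] insert.hyps(1) by auto
    then obtain y where y: "y \<in> Y i" "y \<notin> w ` J" by blast
    have "inj_on (w(i := y)) (insert i J)" using w(1) y(2) insert.hyps(2) by (auto simp: inj_on_def)
    moreover have "\<forall>j\<in>insert i J. (w(i := y)) j \<in> Y j" using w(2) y(1) by auto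
    ultimately show ?case by blast
  qed simp
  then show ?thesis using assms(1) by blast
qed

section \<open>Gluing embeddings along rich nodes\<close>

definition ind_sub :: "('a, 'x) lgraph \<Rightarrow> 'a set \<Rightarrow> ('a, 'x) lgraph" where
  "ind_sub G W = \<lparr>verts = W, edges = edges G \<inter> W \<times> W, lab = (\<lambda>m. if set m \<subseteq> W then lab G m else None)\<rparr>"

lemma ind_sub_simps [simp]: "verts (ind_sub G W) = W" "edges (ind_sub G W) = edges G \<inter> W \<times> W"
  "lab (ind_sub G W) = (\<lambda>m. if set m \<subseteq> W then lab G m else None)"
  unfolding ind_sub_def by simp_all

lemma dom_lab_ind_sub: "dom (lab (ind_sub G W)) = {m \<in> dom (lab G). set m \<subseteq> W}"
  by (auto split: if_splits)

lemma labelled_graph_march: "labelled_graph G \<Longrightarrow> lab G m \<noteq> None \<Longrightarrow> distinct m \<and> set m \<subseteq> verts G"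
  unfolding labelled_graph_def march_def by blast

lemma labelled_graph_ind_sub:
  assumes "labelled_graph G" "W \<subseteq> verts G"
  shows "labelled_graph (ind_sub G W)"
proof -
  have wf: "wf_graph G" using assms(1) unfolding labelled_graph_def by blast
  have "wf_graph (ind_sub G W)"
    using wf assms(2) finite_subset[OF assms(2)] unfolding wf_graph_def by auto
  moreover have "march (ind_sub G W) m" if "m \<in> dom (lab (ind_sub G W))" for m
    using that labelled_graph_march[OF assms(1), of m] unfolding march_def dom_lab_ind_sub by auto
  ultimately show ?thesis unfolding labelled_graph_def by blast
qed

lemma induced_subgraph_ind_sub:
  "labelled_graph G \<Longrightarrow> W \<subseteq> verts G \<Longrightarrow> induced_subgraph (ind_sub G W) G"
  unfolding induced_subgraph_def using labelled_graph_ind_sub by (auto split: if_splits)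

text \<open>\<open>\<psi>\<close> is a base embedding, and \<open>\<Theta> a c\<close> re-embeds the
  same pattern with the proper ancestors of \<open>a\<close> kept fixed; only its part from
  \<open>a\<close> upwards is used, as copy \<open>c\<close> of that branch. The roots of the new
  branches lie off the image of \<open>\<psi>\<close> and are pairwise distinct, which in a forest
  is enough to keep whole branches apart.\<close>

locale glued = tree_order X le \<rho> for X :: "'v set" and le \<rho> +
  fixes G :: "('v, 'x) lgraph" and q :: nat and Le Ed :: "(nat \<times> nat) set" and Lb :: "nat list \<Rightarrow> 'x option"
    and A :: "nat set" and k :: nat and \<psi> :: "nat \<Rightarrow> 'v" and \<Theta> :: "nat \<Rightarrow> nat \<Rightarrow> nat \<Rightarrow> 'v"
  assumes lG: "labelled_graph G" and legG: "legal G" and XG: "X \<subseteq> verts G"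
    and edge_comparable: "(u, v) \<in> edges G \<Longrightarrow> u \<in> X \<Longrightarrow> v \<in> X \<Longrightarrow> le u v \<or> le v u"
    and emb_\<psi>: "emb q Le \<psi>"
    and Ed_\<psi>: "i < q \<Longrightarrow> j < q \<Longrightarrow> (i, j) \<in> Ed \<longleftrightarrow> (\<psi> i, \<psi> j) \<in> edges G"
    and Lb_\<psi>: "distinct ts \<Longrightarrow> set ts \<subseteq> {..<q} \<Longrightarrow> lab G (map \<psi> ts) = Lb ts"
    and emb_\<Theta>: "a \<in> A \<Longrightarrow> c < k \<Longrightarrow> emb q Le (\<Theta> a c)"
    and Ed_\<Theta>: "a \<in> A \<Longrightarrow> c < k \<Longrightarrow> i < q \<Longrightarrow> j < q \<Longrightarrow> (i, j) \<in> Ed \<longleftrightarrow> (\<Theta> a c i, \<Theta> a c j) \<in> edges G"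
    and Lb_\<Theta>: "a \<in> A \<Longrightarrow> c < k \<Longrightarrow> distinct ts \<Longrightarrow> set ts \<subseteq> {..<q} \<Longrightarrow> lab G (map (\<Theta> a c) ts) = Lb ts"
    and A: "A \<subseteq> {..<q}" and antichain: "a \<in> A \<Longrightarrow> b \<in> A \<Longrightarrow> (a, b) \<in> Le \<Longrightarrow> a = b"
    and agree: "a \<in> A \<Longrightarrow> c < k \<Longrightarrow> i < q \<Longrightarrow> (i, a) \<in> Le \<Longrightarrow> i \<noteq> a \<Longrightarrow> \<Theta> a c i = \<psi> i"
    and fresh: "a \<in> A \<Longrightarrow> c < k \<Longrightarrow> \<Theta> a c a \<notin> \<psi> ` {..<q}"
    and separate: "a \<in> A \<Longrightarrow> c < k \<Longrightarrow> b \<in> A \<Longrightarrow> d < k \<Longrightarrow> \<Theta> a c a = \<Theta> b d b \<Longrightarrow> a = b \<and> c = d"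
    and kpos: "0 < k"
begin

lemma wfG: "wf_graph G" using lG unfolding labelled_graph_def by blast

definition core :: "nat \<Rightarrow> bool" where "core t \<longleftrightarrow> (\<forall>a\<in>A. (a, t) \<notin> Le)"

definition top :: "nat \<Rightarrow> nat" where "top t = (SOME a. a \<in> A \<and> (a, t) \<in> Le)"

text \<open>\<open>thread t c\<close> is a single embedding that serves copy \<open>c\<close> of the
  node \<open>t\<close> together with all its ancestors, whereas \<open>glue\<close> changes the
  embedding from node to node. For nodes outside the branches, the copy number has no
  effect.\<close>

definition thread :: "nat \<Rightarrow> nat \<Rightarrow> nat \<Rightarrow> 'v" where
  "thread t c = (if core t then \<psi> else \<Theta> (top t) c)"

definition glue :: "nat \<Rightarrow> nat \<Rightarrow> 'v" where "glue t c = thread t c t"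

lemma top: "\<not> core t \<Longrightarrow> top t \<in> A" "\<not> core t \<Longrightarrow> (top t, t) \<in> Le"
  unfolding core_def top_def by (metis (mono_tags, lifting) someI_ex)+

lemma A_less: "a \<in> A \<Longrightarrow> a < q" using A by auto

lemma Le_trans: "(i, j) \<in> Le \<Longrightarrow> (j, l) \<in> Le \<Longrightarrow> i < q \<Longrightarrow> j < q \<Longrightarrow> l < q \<Longrightarrow> (i, l) \<in> Le"
  by (rule emb_Le_trans[OF emb_\<psi>])

lemma Le_chain: "(i, l) \<in> Le \<Longrightarrow> (j, l) \<in> Le \<Longrightarrow> i < q \<Longrightarrow> j < q \<Longrightarrow> l < q \<Longrightarrow> (i, j) \<in> Le \<or> (j, i) \<in> Le"
  by (rule emb_Le_chain[OF emb_\<psi>])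

lemma top_unique:
  assumes "a \<in> A" "(a, t) \<in> Le" "t < q"
  shows "\<not> core t" "top t = a"
proof -
  show nc: "\<not> core t" using assms unfolding core_def by blast
  have "(top t, a) \<in> Le \<or> (a, top t) \<in> Le"
    by (rule Le_chain[of _ t]) (use assms top[OF nc] A_less in auto)
  then show "top t = a" using antichain top(1)[OF nc] assms(1) by blast
qed

lemma core_down: "core t \<Longrightarrow> (s, t) \<in> Le \<Longrightarrow> s < q \<Longrightarrow> t < q \<Longrightarrow> core s"
  unfolding core_def using Le_trans A_less by blast

lemma thread_emb: "t < q \<Longrightarrow> c < k \<Longrightarrow> emb q Le (thread t c)"
  unfolding thread_def using emb_\<psi> emb_\<Theta> top(1) by simp

lemma thread_Ed: "t < q \<Longrightarrow> c < k \<Longrightarrow> i < q \<Longrightarrow> j < q \<Longrightarrow> (i, j) \<in> Ed \<longleftrightarrow> (thread t c i, thread t c j) \<in> edges G"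
  unfolding thread_def using Ed_\<psi> Ed_\<Theta> top(1) by simp

lemma thread_Lb:
  "t < q \<Longrightarrow> c < k \<Longrightarrow> distinct ts \<Longrightarrow> set ts \<subseteq> {..<q} \<Longrightarrow> lab G (map (thread t c) ts) = Lb ts"
  unfolding thread_def using Lb_\<psi> Lb_\<Theta> top(1) by simp

lemma glue_core: "core t \<Longrightarrow> glue t c = \<psi> t"
  unfolding glue_def thread_def by simp

lemma glue_mem: "t < q \<Longrightarrow> c < k \<Longrightarrow> glue t c \<in> X"
  unfolding glue_def using emb_mem[OF thread_emb] by blast

text \<open>On the chain below \<open>t\<close>, gluing agrees with one embedding: strictly below
  the branch root the embeddings coincide by \<open>agree\<close>, and from the root upwards all
  nodes have the same root. Facts about chains therefore pass from embeddings to the glued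
  structure.\<close>

lemma glue_eq_thread:
  assumes st: "s < q" "t < q" "c < k" "d < k" "(s, t) \<in> Le" and cd: "c = d \<or> core s"
  shows "glue s c = thread t d s"
proof (cases "core t")
  case True
  then show ?thesis using core_down[OF True st(5,1,2)] unfolding glue_def thread_def by simp
next
  case t: False
  note a = top(1)[OF t] top(2)[OF t] and aq = A_less[OF top(1)[OF t]]
  show ?thesis
  proof (cases "core s")
    case True
    have "(s, top t) \<in> Le"
    proof -
      have "(s, top t) \<in> Le \<or> (top t, s) \<in> Le" by (rule Le_chain[of _ t]) (use st a aq in auto)
      then show ?thesis using True a(1) unfolding core_def by blast
    qed
    moreover have "s \<noteq> top t" using True a(1) emb_Le_refl[OF emb_\<psi> st(1)] unfolding core_def by blast
    ultimately have "\<Theta> (top t) d s = \<psi> s" using agree a(1) st by blast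
    then show ?thesis using True t unfolding glue_def thread_def by simp
  next
    case False
    have "(top s, t) \<in> Le" by (rule Le_trans[OF top(2)[OF False] st(5)]) (use st A_less top(1)[OF False] in auto)
    then have "top t = top s" using top_unique[OF top(1)[OF False] _ st(2)] by blast
    then show ?thesis using False t cd unfolding glue_def thread_def by simp
  qed
qed

lemma fresh_above:
  assumes "a \<in> A" "c < k" "le (\<Theta> a c a) u"
  shows "u \<notin> \<psi> ` {..<q}"
proof
  assume "u \<in> \<psi> ` {..<q}"
  then obtain i where "i < q" "u = \<psi> i" by auto
  then show False using emb_down[OF emb_\<psi>] assms fresh by blast
qed

lemma le_top_glue: "\<not> core s \<Longrightarrow> s < q \<Longrightarrow> c < k \<Longrightarrow> le (\<Theta> (top s) c (top s)) (glue s c)"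
  using emb_le[OF emb_\<Theta>[OF top(1)], of s c "top s" s] top(2)[of s] A_less[OF top(1)[of s]]
  unfolding glue_def thread_def by simp

lemma glue_notin: "\<not> core s \<Longrightarrow> s < q \<Longrightarrow> c < k \<Longrightarrow> glue s c \<notin> \<psi> ` {..<q}"
  using fresh_above le_top_glue top(1) by blast

text \<open>Everything strictly below a new root lies in the image of \<open>\<psi>\<close>, which
  contains no new root.\<close>

lemma top_le_top:
  assumes "a \<in> A" "c < k" "b \<in> A" "d < k" "le (\<Theta> b d b) (\<Theta> a c a)"
  shows "b = a \<and> d = c"
proof -
  obtain s where s: "s < q" "\<Theta> b d b = \<Theta> a c s" using emb_down[OF emb_\<Theta>[OF assms(1,2)]] A_less assms by blast
  have sa: "(s, a) \<in> Le" using emb_le[OF emb_\<Theta>[OF assms(1,2)] s(1) A_less[OF assms(1)]] assms(5) s(2) by simp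
  have "s = a"
  proof (rule ccontr)
    assume "s \<noteq> a"
    then have "\<Theta> b d b = \<psi> s" using agree[OF assms(1,2) s(1) sa] s(2) by simp
    then show False using fresh[OF assms(3,4)] s(1) by auto
  qed
  then show ?thesis using separate[OF assms(3,4,1,2)] s(2) by blast
qed

text \<open>Different copies acquire no accidental comparabilities. Since the image of
  \<open>thread t d\<close> is closed under ancestors, \<open>glue s c\<close> equals
  \<open>thread t d s'\<close> for some \<open>s'\<close> below \<open>t\<close>. If
  \<open>s'\<close> lies in the branch of \<open>t\<close>, the roots of the branches of
  \<open>s\<close> and \<open>t\<close> are both below \<open>glue s c\<close>, hence comparable,
  and they coincide by \<open>top_le_top\<close>. Otherwise the value lies in the image of
  \<open>\<psi>\<close>, and \<open>s\<close> is a core node.\<close>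

lemma glue_le:
  assumes st: "s < q" "t < q" "c < k" "d < k" and le: "le (glue s c) (glue t d)"
  shows "(s, t) \<in> Le \<and> (c = d \<or> core s)"
proof -
  note th = thread_emb[OF st(2,4)]
  obtain s' where s': "s' < q" "glue s c = thread t d s'" using emb_down[OF th st(2)] le unfolding glue_def[of t d] by blast
  have s't: "(s', t) \<in> Le" using emb_le[OF th s'(1) st(2)] le s'(2) unfolding glue_def[of t d] by simp
  have in_core: "(s, t) \<in> Le \<and> (c = d \<or> core s)" if "glue s c = \<psi> s'"
  proof -
    have "core s" using glue_notin[OF _ st(1,3)] that s'(1) by auto
    then have "\<psi> s = \<psi> s'" using that glue_core by simp
    then have "s = s'" using emb_inj[OF emb_\<psi> st(1) s'(1)] by simp
    then show ?thesis using s't \<open>core s\<close> by simp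
  qed
  show ?thesis
  proof (cases "core t")
    case True
    then show ?thesis using in_core s'(2) unfolding thread_def by simp
  next
    case t: False
    note a = top(1)[OF t] top(2)[OF t] and aq = A_less[OF top(1)[OF t]]
    have g: "glue s c = \<Theta> (top t) d s'" using s'(2) t unfolding thread_def by simp
    show ?thesis
    proof (cases "(top t, s') \<in> Le")
      case True
      have le1: "le (\<Theta> (top t) d (top t)) (glue s c)"
        unfolding g using emb_le[OF emb_\<Theta>[OF a(1) st(4)] aq s'(1)] True by simp
      have ns: "\<not> core s" using fresh_above[OF a(1) st(4) le1] glue_core st(1) by (metis imageI lessThan_iff)
      note b = top(1)[OF ns]
      have "le (\<Theta> (top t) d (top t)) (\<Theta> (top s) c (top s)) \<or> le (\<Theta> (top s) c (top s)) (\<Theta> (top t) d (top t))"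
        using le_chain[OF le1 le_top_glue[OF ns st(1,3)]] .
      then have eq: "top s = top t" "c = d"
        using top_le_top[OF b st(3) a(1) st(4)] top_le_top[OF a(1) st(4) b st(3)] by metis+
      have "\<Theta> (top t) d s = \<Theta> (top t) d s'" using g ns eq unfolding glue_def thread_def by simp
      then have "s = s'" using emb_inj[OF emb_\<Theta>[OF a(1) st(4)] st(1) s'(1)] by simp
      then show ?thesis using s't eq by simp
    next
      case False
      have "(top t, s') \<in> Le \<or> (s', top t) \<in> Le" by (rule Le_chain[of _ t]) (use st a aq s' s't in auto)
      then have "(s', top t) \<in> Le" using False by blast
      moreover have "s' \<noteq> top t" using False emb_Le_refl[OF emb_\<psi> s'(1)] by auto
      ultimately show ?thesis using in_core g agree[OF a(1) st(4) s'(1)] by simp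
    qed
  qed
qed

lemma glue_inj:
  assumes "s < q" "t < q" "c < k" "d < k" "glue s c = glue t d"
  shows "s = t \<and> (c = d \<or> core s)"
proof -
  have "(s, t) \<in> Le \<and> (c = d \<or> core s)" "(t, s) \<in> Le \<and> (d = c \<or> core t)"
    by (rule glue_le; use assms le_refl glue_mem in simp)+
  then show ?thesis using emb_Le_le[OF emb_\<psi>] assms(1,2) by (meson le_antisym order_antisym)
qed

lemma glue_edge_aux:
  assumes "s < q" "t < q" "c < k" "d < k" "(s, t) \<in> Le" "c = d \<or> core s"
  shows "(glue s c, glue t d) \<in> edges G \<longleftrightarrow> (s, t) \<in> Ed" "(glue t d, glue s c) \<in> edges G \<longleftrightarrow> (t, s) \<in> Ed"
  using glue_eq_thread[OF assms] thread_Ed[OF assms(2,4,1,2)] thread_Ed[OF assms(2,4,2,1)]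
  unfolding glue_def[of t d] by simp_all

text \<open>Edges join comparable elements, so both directions reduce to a single thread, where
  \<open>Ed\<close> is known.\<close>

lemma glue_edge:
  assumes st: "s < q" "t < q" "c < k" "d < k"
  shows "(glue s c, glue t d) \<in> edges G \<longleftrightarrow> (s, t) \<in> Ed \<and> (c = d \<or> core s \<or> core t)"
proof
  assume e: "(glue s c, glue t d) \<in> edges G"
  then have "le (glue s c) (glue t d) \<or> le (glue t d) (glue s c)"
    using edge_comparable glue_mem st by blast
  then show "(s, t) \<in> Ed \<and> (c = d \<or> core s \<or> core t)"
  proof
    assume "le (glue s c) (glue t d)"
    then have "(s, t) \<in> Le" "c = d \<or> core s" using glue_le[OF st] by blast+
    then show ?thesis using e glue_edge_aux(1)[OF st] by blast
  next
    assume "le (glue t d) (glue s c)"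
    then have "(t, s) \<in> Le" "d = c \<or> core t" using glue_le[OF st(2,1,4,3)] by blast+
    then show ?thesis using e glue_edge_aux(2)[OF st(2,1,4,3)] by blast
  qed
next
  assume *: "(s, t) \<in> Ed \<and> (c = d \<or> core s \<or> core t)"
  then have "(\<psi> s, \<psi> t) \<in> edges G" using Ed_\<psi> st by blast
  then have "(s, t) \<in> Le \<or> (t, s) \<in> Le"
    using edge_comparable[of "\<psi> s" "\<psi> t"] emb_mem[OF emb_\<psi>] emb_le[OF emb_\<psi>] st by blast
  then show "(glue s c, glue t d) \<in> edges G"
  proof
    assume "(s, t) \<in> Le"
    moreover have "c = d \<or> core s" using * core_down[OF _ calculation st(1,2)] by blast
    ultimately show ?thesis using * glue_edge_aux(1)[OF st] by blast
  next
    assume "(t, s) \<in> Le"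
    moreover have "d = c \<or> core t" using * core_down[OF _ calculation st(2,1)] by blast
    ultimately show ?thesis using * glue_edge_aux(2)[OF st(2,1,4,3)] by blast
  qed
qed

text \<open>By legality the entries of a labelled march form a clique, hence a chain. The entry
  \<open>p\<close> of greatest rank lies above all others, so one thread carries the whole march,
  and its copy number \<open>d\<close> serves all entries outside the core.\<close>

lemma glue_march:
  assumes ms: "set ms \<subseteq> {..<q} \<times> {..<k}" and l: "lab G (map (\<lambda>(t, c). glue t c) ms) \<noteq> None"
  shows "\<exists>\<theta> d. d < k \<and> (\<forall>(s, c)\<in>set ms. glue s c = \<theta> s \<and> (c = d \<or> core s)) \<and>
     (\<forall>ts. distinct ts \<longrightarrow> set ts \<subseteq> {..<q} \<longrightarrow> lab G (map \<theta> ts) = Lb ts)"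
proof (cases "ms = []")
  case True
  \<comment> \<open>The empty march has no highest entry; any embedding and any copy number will
    do.\<close>
  then show ?thesis using kpos Lb_\<psi> by (intro exI[of _ \<psi>] exI[of _ 0]) simp
next
  case False
  let ?r = "\<lambda>(t, c). \<rho> (glue t c)"
  have "Max (?r ` set ms) \<in> ?r ` set ms" by (rule Max_in) (use False in auto)
  then obtain p where p: "p \<in> set ms" "?r p = Max (?r ` set ms)" by auto
  obtain t d where td: "p = (t, d)" by fastforce
  have tq: "t < q" "d < k" using ms p(1) td by auto
  have "glue s c = thread t d s \<and> (c = d \<or> core s)" if sc: "(s, c) \<in> set ms" for s c
  proof -
    have sq: "s < q" "c < k" using ms sc by auto
    have "?r (s, c) \<le> ?r p" unfolding p(2) by (rule Max_ge) (use sc in auto)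
    then have rk: "\<rho> (glue s c) \<le> \<rho> (glue t d)" using td by simp
    have in_m: "glue s c \<in> set (map (\<lambda>(t, c). glue t c) ms)" "glue t d \<in> set (map (\<lambda>(t, c). glue t c) ms)"
      using sc p(1) td by force+
    have "le (glue s c) (glue t d)"
    proof (cases "glue s c = glue t d")
      case True
      then show ?thesis using le_refl[OF glue_mem[OF tq]] by simp
    next
      case False
      then have "(glue s c, glue t d) \<in> edges G" using legG l in_m unfolding legal_def by blast
      then show ?thesis using edge_comparable glue_mem sq tq rk le_if_rank_le by blast
    qed
    then have "(s, t) \<in> Le" "c = d \<or> core s" using glue_le[OF sq(1) tq(1) sq(2) tq(2)] by blast+
    then show ?thesis using glue_eq_thread[OF sq(1) tq(1) sq(2) tq(2)] by blast
  qed
  then show ?thesis using tq thread_Lb[OF tq] by (intro exI[of _ "thread t d"] exI[of _ d]) auto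
qed

text \<open>A labelled list is a clique under \<open>\<psi>\<close>, hence a chain; this is what the
  premise \<open>Lb ts \<noteq> None\<close> provides. Its largest number is its top, whose thread
  carries the list.\<close>

lemma lab_glue:
  assumes ts: "distinct ts" "set ts \<subseteq> {..<q}" "Lb ts \<noteq> None" and c: "c < k"
  shows "lab G (map (\<lambda>t. glue t c) ts) = Lb ts"
proof (cases "ts = []")
  case True
  then show ?thesis using Lb_\<psi>[of "[]"] by simp
next
  case False
  define t where "t = Max (set ts)"
  have t: "t \<in> set ts" unfolding t_def by (rule Max_in) (use False in auto)
  have tq: "t < q" using t ts(2) by auto
  have "glue s c = thread t c s" if s: "s \<in> set ts" for s
  proof -
    have sq: "s < q" using s ts(2) by auto
    have "s \<le> t" unfolding t_def by (rule Max_ge) (use s in auto)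
    have "(s, t) \<in> Le"
    proof (cases "s = t")
      case True
      then show ?thesis using emb_Le_refl[OF emb_\<psi> tq] by simp
    next
      case False
      then have "\<psi> s \<noteq> \<psi> t" using emb_inj[OF emb_\<psi> sq tq] by simp
      moreover have "map \<psi> ts \<in> dom (lab G)" using Lb_\<psi>[OF ts(1,2)] ts(3) by (simp add: domIff)
      moreover have "\<psi> s \<in> set (map \<psi> ts)" "\<psi> t \<in> set (map \<psi> ts)" using s t by auto
      ultimately have "(\<psi> s, \<psi> t) \<in> edges G" using legG unfolding legal_def by blast
      then have "(s, t) \<in> Le \<or> (t, s) \<in> Le"
        using edge_comparable[of "\<psi> s" "\<psi> t"] emb_mem[OF emb_\<psi>] emb_le[OF emb_\<psi>] sq tq by blast
      then show ?thesis using emb_Le_le[OF emb_\<psi> _ tq sq] \<open>s \<le> t\<close> False by auto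
    qed
    then show ?thesis using glue_eq_thread[OF sq tq c c] by simp
  qed
  then have "map (\<lambda>t. glue t c) ts = map (thread t c) ts" by simp
  then show ?thesis using thread_Lb[OF tq c ts(1,2)] by (simp only:)
qed

text \<open>\<open>B\<close> may come from another graph of the class, as long as it realises the
  pattern \<open>Ed\<close>, \<open>Lb\<close> on the nodes \<open>J\<close>. So duplications of one
  fixed \<open>B\<close> are found in hosts with different \<open>k\<close>. The isomorphism sends
  copy \<open>c\<close> of \<open>\<beta> t\<close> to \<open>glue t c\<close>, and the vertices
  shared by all copies are those of core nodes.\<close>

theorem duplicate_isomorphic_induced:
  fixes B :: "('b, 'x) lgraph" and \<beta> :: "nat \<Rightarrow> 'b"
  assumes lB: "labelled_graph B" and J: "J \<subseteq> {..<q}" and \<beta>: "inj_on \<beta> J" "verts B = \<beta> ` J"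
    and Ed_\<beta>: "\<And>s t. s \<in> J \<Longrightarrow> t \<in> J \<Longrightarrow> (\<beta> s, \<beta> t) \<in> edges B \<longleftrightarrow> (s, t) \<in> Ed"
    and Lb_\<beta>: "\<And>ts. distinct ts \<Longrightarrow> set ts \<subseteq> J \<Longrightarrow> lab B (map \<beta> ts) = Lb ts"
  defines "S \<equiv> \<lambda>a. \<beta> ` {t \<in> J. (a, t) \<in> Le}"
  defines "\<L> \<equiv> (\<lambda>a. (closed_nbhd B (S a), verts B - S a)) ` A"
  shows "\<exists>W\<subseteq>verts G. isomorphic (duplicate B \<L> k) (ind_sub G W)"
proof -
  define Du where "Du = duplicate B \<L> k"
  define g where "g = inv_into J \<beta>"
  have g: "g (\<beta> t) = t" if "t \<in> J" for t unfolding g_def using \<beta>(1) that by simp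
  define cp where "cp = dup_copy \<L> B"
  have cp: "cp c (\<beta> t) = (if core t then (\<beta> t, 0) else (\<beta> t, c))" if t: "t \<in> J" for c t
  proof -
    have "\<beta> t \<in> dup_core \<L> B \<longleftrightarrow> (\<forall>a\<in>A. \<beta> t \<notin> S a)" unfolding dup_core_def \<L>_def using t \<beta>(2) by auto
    also have "\<dots> \<longleftrightarrow> core t" unfolding core_def S_def using t \<beta>(1) by (auto simp: inj_on_def)
    finally show ?thesis unfolding cp_def dup_copy_def by simp
  qed
  have fst_cp: "fst (cp c v) = v" for c v unfolding cp_def dup_copy_def by simp
  have cp_eq: "cp c (\<beta> t) = cp d (\<beta> t)" if "t \<in> J" "c = d \<or> core t" for c d t using cp[OF that(1)] that(2) by auto
  define \<sigma> where "\<sigma> = (\<lambda>(v, c). glue (g v) c)"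
  have \<sigma>: "\<sigma> (cp c (\<beta> t)) = glue t c" if "t \<in> J" for c t
    unfolding \<sigma>_def using cp[OF that] g[OF that] glue_core by simp
  have Jq: "t < q" if "t \<in> J" for t using J that by auto
  have vDu: "verts Du = {cp c (\<beta> t) | c t. c < k \<and> t \<in> J}"
    unfolding Du_def duplicate_def cp_def using \<beta>(2) by auto
  have eDu: "edges Du = {(cp c u, cp c v) | c u v. c < k \<and> (u, v) \<in> edges B}"
    unfolding Du_def duplicate_def cp_def by simp
  have lDu: "lab Du m' = (if \<exists>c<k. \<exists>m\<in>dom (lab B). m' = map (cp c) m then lab B (map fst m') else None)" for m'
    unfolding Du_def duplicate_def cp_def by simp
  have wfB: "wf_graph B" using lB unfolding labelled_graph_def by blast
  define W where "W = \<sigma> ` verts Du"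
  have WG: "W \<subseteq> verts G" using glue_mem Jq XG \<sigma> unfolding W_def vDu by auto
  have inj: "inj_on \<sigma> (verts Du)"
  proof (rule inj_onI)
    fix x y assume x: "x \<in> verts Du" and y: "y \<in> verts Du" and eq: "\<sigma> x = \<sigma> y"
    obtain c t where x': "x = cp c (\<beta> t)" "c < k" "t \<in> J" using x unfolding vDu by blast
    obtain d s where y': "y = cp d (\<beta> s)" "d < k" "s \<in> J" using y unfolding vDu by blast
    have "t = s \<and> (c = d \<or> core t)" by (rule glue_inj) (use x' y' eq \<sigma> Jq in auto)
    then show "x = y" using x' y' cp_eq by blast
  qed
  have bij: "bij_betw \<sigma> (verts Du) (verts (ind_sub G W))" using inj unfolding W_def bij_betw_def by simp
  have edge: "(x, y) \<in> edges Du \<longleftrightarrow> (\<sigma> x, \<sigma> y) \<in> edges (ind_sub G W)" if x: "x \<in> verts Du" and y: "y \<in> verts Du" for x y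
  proof -
    obtain c s where x': "x = cp c (\<beta> s)" "c < k" "s \<in> J" using x unfolding vDu by blast
    obtain d t where y': "y = cp d (\<beta> t)" "d < k" "t \<in> J" using y unfolding vDu by blast
    have "(x, y) \<in> edges Du \<longleftrightarrow> (s, t) \<in> Ed \<and> (c = d \<or> core s \<or> core t)"
    proof
      assume "(x, y) \<in> edges Du"
      then obtain e u v where e: "e < k" "(u, v) \<in> edges B" "x = cp e u" "y = cp e v" unfolding eDu by blast
      have uv: "u = \<beta> s" "v = \<beta> t" using e(3,4) x'(1) y'(1) fst_cp by metis+
      have "cp e (\<beta> s) = cp c (\<beta> s)" "cp e (\<beta> t) = cp d (\<beta> t)" using e(3,4) x'(1) y'(1) uv by simp_all
      then have "c = d \<or> core s \<or> core t" using cp x'(3) y'(3) by (auto split: if_splits)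
      then show "(s, t) \<in> Ed \<and> (c = d \<or> core s \<or> core t)" using e(2) uv Ed_\<beta> x'(3) y'(3) by blast
    next
      assume *: "(s, t) \<in> Ed \<and> (c = d \<or> core s \<or> core t)"
      then have eB: "(\<beta> s, \<beta> t) \<in> edges B" using Ed_\<beta> x'(3) y'(3) by blast
      have "\<exists>e<k. x = cp e (\<beta> s) \<and> y = cp e (\<beta> t)"
      proof (cases "core s")
        case True
        then show ?thesis using x' y' cp_eq[OF x'(3)] by blast
      next
        case False
        then show ?thesis using * x' y' cp_eq[OF y'(3)] by blast
      qed
      then show "(x, y) \<in> edges Du" unfolding eDu using eB by blast
    qed
    also have "\<dots> \<longleftrightarrow> (glue s c, glue t d) \<in> edges G"
      using glue_edge[OF Jq[OF x'(3)] Jq[OF y'(3)] x'(2) y'(2)] by simp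
    also have "\<dots> \<longleftrightarrow> (\<sigma> x, \<sigma> y) \<in> edges (ind_sub G W)"
    proof -
      have "\<sigma> x \<in> W" "\<sigma> y \<in> W" using x y unfolding W_def by auto
      then show ?thesis using \<sigma>[OF x'(3)] \<sigma>[OF y'(3)] x'(1) y'(1) by simp
    qed
    finally show ?thesis .
  qed
  have lab1: "map \<sigma> m \<in> dom (lab (ind_sub G W)) \<and> lab Du m = lab (ind_sub G W) (map \<sigma> m)" if m: "m \<in> dom (lab Du)" for m
  proof -
    obtain c m0 where c: "c < k" "m0 \<in> dom (lab B)" "m = map (cp c) m0" using m lDu[of m] by (auto split: if_splits)
    have m0: "distinct m0" "set m0 \<subseteq> verts B" using labelled_graph_march[OF lB] c(2) by blast+
    define ts where "ts = map g m0"
    have tsJ: "set ts \<subseteq> J" unfolding ts_def using m0(2) \<beta>(2) g by auto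
    have m0ts: "m0 = map \<beta> ts" unfolding ts_def map_map
      by (rule map_idI[symmetric]) (use m0(2) \<beta>(2) g in auto)
    have dts: "distinct ts" using m0(1) unfolding m0ts by (simp add: distinct_map)
    have Lts: "Lb ts = lab B m0" using Lb_\<beta>[OF dts tsJ] m0ts by simp
    have mfst: "map fst m = m0" unfolding c(3) using fst_cp by (simp add: map_idI)
    have "lab Du m = lab B m0" unfolding lDu mfst using c by auto
    moreover have "map \<sigma> m = map (\<lambda>t. glue t c) ts" unfolding c(3) m0ts using \<sigma> tsJ by auto
    moreover have "lab G (map (\<lambda>t. glue t c) ts) = Lb ts"
      using dts tsJ J Lts c(2) by (intro lab_glue c(1)) auto
    moreover have "set (map \<sigma> m) \<subseteq> W"
      unfolding W_def c(3) m0ts vDu using tsJ c(1) by auto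
    ultimately show ?thesis using Lts c(2) by auto
  qed
  \<comment> \<open>A march found in \<open>G\<close> might mix copies. \<open>glue_march\<close>
    provides one number \<open>d\<close> such that every entry with another copy number is a core
    node, and there all copies coincide.\<close>
  have lab2: "map (inv_into (verts Du) \<sigma>) m' \<in> dom (lab Du)" if m': "m' \<in> dom (lab (ind_sub G W))" for m'
  proof -
    have m'W: "set m' \<subseteq> W" "lab G m' \<noteq> None" using m' by (auto split: if_splits)
    have dm': "distinct m'" using labelled_graph_march[OF lG m'W(2)] by blast
    have "\<forall>w\<in>W. \<exists>t c. t \<in> J \<and> c < k \<and> w = glue t c"
    proof
      fix w assume "w \<in> W"
      then obtain c t where "c < k" "t \<in> J" "w = \<sigma> (cp c (\<beta> t))" unfolding W_def vDu by blast
      then show "\<exists>t c. t \<in> J \<and> c < k \<and> w = glue t c" using \<sigma> by auto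
    qed
    then obtain ft fc where fw: "\<And>w. w \<in> W \<Longrightarrow> ft w \<in> J \<and> fc w < k \<and> w = glue (ft w) (fc w)" by metis
    define ms where "ms = map (\<lambda>w. (ft w, fc w)) m'"
    have msJ: "set ms \<subseteq> J \<times> {..<k}" unfolding ms_def using fw m'W(1) by auto
    then have ms1: "set ms \<subseteq> {..<q} \<times> {..<k}" using J by auto
    have m'ms: "m' = map (\<lambda>(t, c). glue t c) ms" unfolding ms_def map_map
      by (rule map_idI[symmetric]) (use fw m'W(1) in auto)
    have "lab G (map (\<lambda>(t, c). glue t c) ms) \<noteq> None" using m'W(2) m'ms by simp
    from glue_march[OF ms1 this] obtain \<theta> d where \<theta>': "d < k" "\<forall>(s, c)\<in>set ms. glue s c = \<theta> s \<and> (c = d \<or> core s)"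
      "\<forall>ts. distinct ts \<longrightarrow> set ts \<subseteq> {..<q} \<longrightarrow> lab G (map \<theta> ts) = Lb ts" by blast
    then have \<theta>: "d < k" "\<And>s c. (s, c) \<in> set ms \<Longrightarrow> glue s c = \<theta> s \<and> (c = d \<or> core s)"
      "\<And>ts. distinct ts \<Longrightarrow> set ts \<subseteq> {..<q} \<Longrightarrow> lab G (map \<theta> ts) = Lb ts" by auto
    define ts where "ts = map fst ms"
    have m'ts: "m' = map \<theta> ts" unfolding m'ms ts_def using \<theta>(2) by auto
    have dts: "distinct ts" using dm' unfolding m'ts by (simp add: distinct_map)
    have tsJ: "set ts \<subseteq> J" unfolding ts_def using msJ by auto
    have Lts: "Lb ts = lab G m'" using \<theta>(3)[OF dts] tsJ J m'ts by auto
    have lBts: "map \<beta> ts \<in> dom (lab B)" using Lb_\<beta>[OF dts tsJ] Lts m'W(2) by auto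
    have "inv_into (verts Du) \<sigma> (glue s c) = cp d (\<beta> s)" if sc: "(s, c) \<in> set ms" for s c
    proof -
      have s: "s \<in> J" "c < k" using msJ sc by auto
      have "cp c (\<beta> s) \<in> verts Du" unfolding vDu using s by blast
      then have "inv_into (verts Du) \<sigma> (\<sigma> (cp c (\<beta> s))) = cp c (\<beta> s)" using inj by simp
      also have "\<dots> = cp d (\<beta> s)" using cp_eq[OF s(1)] \<theta>(2)[OF sc] by blast
      finally show ?thesis using \<sigma>[OF s(1)] by simp
    qed
    then have "map (inv_into (verts Du) \<sigma>) m' = map (cp d) (map \<beta> ts)" unfolding m'ms ts_def by auto
    moreover have "lab Du (map (cp d) (map \<beta> ts)) = lab B (map \<beta> ts)"
    proof -
      have 1: "map fst (map (cp d) (map \<beta> ts)) = map \<beta> ts" using fst_cp by (simp add: o_def)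
      have 2: "\<exists>c<k. \<exists>m\<in>dom (lab B). map (cp d) (map \<beta> ts) = map (cp c) m" using \<theta>(1) lBts by blast
      show ?thesis unfolding lDu by (simp only: 1 2 if_True)
    qed
    ultimately show ?thesis using lBts by auto
  qed
  have "lisomorphism \<sigma> Du (ind_sub G W)"
    unfolding lisomorphism_def using bij edge lab1 lab2 by blast
  then show ?thesis using WG unfolding isomorphic_def Du_def by blast
qed

end

section \<open>Many homomorphisms force a duplicable collection\<close>

type_synonym ('h, 'x) code = "nat \<times> ('h \<Rightarrow> nat) \<times> (nat \<times> nat) set \<times> (nat \<times> nat) set \<times> (nat list \<Rightarrow> 'x option)"

text \<open>Labels are recorded on all repetition-free lists over \<open>{..<N}\<close> rather than
  \<open>{..<q}\<close>, so that the range of the last component does not depend on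
  \<open>q\<close>. Lists with entries beyond \<open>q\<close> carry arbitrary values, which still
  lie in the finite range.\<close>

definition codes :: "'h set \<Rightarrow> 'x set \<Rightarrow> nat \<Rightarrow> ('h, 'x) code set" where
  "codes V Y N = {..N} \<times> (V \<rightarrow>\<^sub>E {..<N}) \<times> Pow ({..<N} \<times> {..<N}) \<times> Pow ({..<N} \<times> {..<N}) \<times>
     ({ts. set ts \<subseteq> {..<N} \<and> distinct ts} \<rightarrow>\<^sub>E insert None (Some ` Y))"

lemma finite_codes: "finite V \<Longrightarrow> finite Y \<Longrightarrow> finite (codes V Y N)"
  unfolding codes_def by (intro finite_SigmaI finite_PiE) (auto simp: finite_subset_distinct)

lemma card_le_mult_fibre:
  assumes "finite S" and "\<And>y. y \<in> f ` S \<Longrightarrow> card {x \<in> S. f x = y} \<le> b"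
  shows "card S \<le> b * card (f ` S)"
proof -
  have "S = (\<Union>y\<in>f ` S. {x \<in> S. f x = y})" by blast
  then have "card S = card (\<Union>y\<in>f ` S. {x \<in> S. f x = y})" by (rule arg_cong)
  also have "\<dots> \<le> (\<Sum>y\<in>f ` S. card {x \<in> S. f x = y})" by (rule card_UN_le) (use assms(1) in simp)
  also have "\<dots> \<le> (\<Sum>y\<in>f ` S. b)" by (rule sum_mono) (rule assms(2))
  finally show ?thesis by (simp add: mult.commute)
qed

lemma tree_order_ancestor:
  assumes G: "wf_graph G" and inj: "inj_on \<rho> (verts G)" and X: "X \<subseteq> verts G"
  shows "tree_order X (ancestor G \<rho> X) \<rho>"
proof
  show "finite X" using wf_graph_finite[OF G] X finite_subset by blast
  show "inj_on \<rho> X" using inj X inj_on_subset by blast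
  show "\<And>u v. ancestor G \<rho> X u v \<Longrightarrow> u \<in> X \<and> v \<in> X \<and> \<rho> u \<le> \<rho> v" by (rule ancestor_mem)
  show "\<And>u. u \<in> X \<Longrightarrow> ancestor G \<rho> X u u" by (rule ancestor_refl)
  show "\<And>u v w. ancestor G \<rho> X u v \<Longrightarrow> ancestor G \<rho> X v w \<Longrightarrow> ancestor G \<rho> X u w" by (rule ancestor_trans)
  show "\<And>u w v. ancestor G \<rho> X u w \<Longrightarrow> ancestor G \<rho> X v w \<Longrightarrow> ancestor G \<rho> X u v \<or> ancestor G \<rho> X v u"
    by (rule ancestor_chain[OF G])
qed

text \<open>The predicate \<open>host\<close> collects what a single graph of the class contributes: an embedding \<open>\<psi>\<close> of the
  coded pattern together with \<open>k\<close> separate re-embeddings of the branch above every node in \<open>A\<close>.\<close>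
definition host :: "('v, 'x) lgraph set \<Rightarrow> (('h \<Rightarrow> 'v) \<times> ('v, 'x) lgraph) set \<Rightarrow> 'h set \<Rightarrow> ('h, 'x) code \<Rightarrow> nat set \<Rightarrow> nat \<Rightarrow> bool" where
  "host \<G> \<H> V c A k \<longleftrightarrow> (case c of (q, f, Le, Ed, Lb) \<Rightarrow>
     f ` V \<subseteq> {..<q} \<and> (\<forall>a\<in>A. \<exists>x\<in>V. (a, f x) \<in> Le) \<and>
     (\<exists>G X le \<rho> \<psi> \<Theta>. G \<in> \<G> \<and> glued X le \<rho> G q Le Ed Lb A k \<psi> \<Theta> \<and> (restrict (\<psi> \<circ> f) V, G) \<in> \<H>))"

lemma hostE:
  assumes "host \<G> \<H> V (q, f, Le, Ed, Lb) A k"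
  obtains G X le \<rho> \<psi> \<Theta> where "f ` V \<subseteq> {..<q}" "\<And>a. a \<in> A \<Longrightarrow> \<exists>x\<in>V. (a, f x) \<in> Le"
    "G \<in> \<G>" "glued X le \<rho> G q Le Ed Lb A k \<psi> \<Theta>" "(restrict (\<psi> \<circ> f) V, G) \<in> \<H>"
  using assms unfolding host_def prod.case by (elim conjE exE) (rule that, auto)

text \<open>Pigeonhole over codes leaves a family too large for \<open>card_embeddings_le\<close>,
  so some embedding has an antichain \<open>A\<close> of \<open>Suc d\<close> rich nodes. The value
  \<open>K = k * Suc d + N\<close> is what the re-embeddings need: after removal of the at most
  \<open>N\<close> places used by \<open>\<psi>\<close>, each node of \<open>A\<close> keeps
  \<open>k * Suc d\<close> places, enough for distinct roots for all pairs in
  \<open>A \<times> {..<k}\<close>.\<close>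

lemma host_exists:
  fixes G :: "('v, 'x) lgraph" and V :: "'h set"
  assumes Q: "legal_q_labelled Q G" "finite (fst Q)" and G\<G>: "G \<in> \<G>"
    and inj: "inj_on \<rho> (verts G)" and X: "X \<subseteq> verts G" and depth: "\<And>v. card {u. ancestor G \<rho> X u v} \<le> h"
    and V: "finite V" and \<Phi>: "\<Phi> \<subseteq> V \<rightarrow>\<^sub>E X" "\<And>\<phi>. \<phi> \<in> \<Phi> \<Longrightarrow> (\<phi>, G) \<in> \<H>"
    and n: "card X \<le> n" "1 \<le> n" and k: "0 < k"
    and N: "N = card V * h" and K: "K = k * Suc d + N"
    and many: "card (codes V (fst Q) N) * (2 ^ N * (n ^ d * K ^ N)) < card \<Phi>"
  shows "\<exists>c\<in>codes V (fst Q) N. \<exists>A\<in>Pow {..<N}. card A = Suc d \<and> host \<G> \<H> V c A k"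
proof -
  have lG: "labelled_graph G" "legal G" "ran (lab G) \<subseteq> fst Q" using Q(1) unfolding legal_q_labelled_def q_labelled_def by auto
  have G: "wf_graph G" using lG(1) unfolding labelled_graph_def by blast
  define le where "le = ancestor G \<rho> X"
  interpret tree_order X le \<rho> unfolding le_def by (rule tree_order_ancestor[OF G inj X])
  have fin\<Phi>: "finite \<Phi>" using \<Phi>(1) V finX by (meson finite_PiE finite_subset)
  define good where "good \<phi> q \<psi> f \<longleftrightarrow> q \<le> N \<and> \<psi> \<in> {..<q} \<rightarrow>\<^sub>E X \<and>
     emb q {(i, j). i < q \<and> j < q \<and> le (\<psi> i) (\<psi> j)} \<psi> \<and>
     f \<in> V \<rightarrow>\<^sub>E {..<q} \<and> (\<forall>x\<in>V. \<phi> x = \<psi> (f x)) \<and> (\<forall>j<q. \<exists>x\<in>V. le (\<psi> j) (\<psi> (f x)))" for \<phi> q \<psi> f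
  have "\<exists>q \<psi> f. good \<phi> q \<psi> f" if "\<phi> \<in> \<Phi>" for \<phi>
    unfolding good_def N by (rule closure_embedding[OF V]) (use \<Phi>(1) depth that in \<open>auto simp: le_def\<close>)
  then obtain qq pp ff where good: "\<And>\<phi>. \<phi> \<in> \<Phi> \<Longrightarrow> good \<phi> (qq \<phi>) (pp \<phi>) (ff \<phi>)" by metis
  note * = good[unfolded good_def]
  define code where "code \<phi> = (qq \<phi>, ff \<phi>, {(i, j). i < qq \<phi> \<and> j < qq \<phi> \<and> le (pp \<phi> i) (pp \<phi> j)},
     {(i, j). i < qq \<phi> \<and> j < qq \<phi> \<and> (pp \<phi> i, pp \<phi> j) \<in> edges G},
     restrict (\<lambda>ts. lab G (map (pp \<phi>) ts)) {ts. set ts \<subseteq> {..<N} \<and> distinct ts})" for \<phi>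
  have labQ: "lab G m \<in> insert None (Some ` fst Q)" for m
    using lG(3) by (cases "lab G m") (auto simp: ran_def)
  have code_mem: "code \<phi> \<in> codes V (fst Q) N" if "\<phi> \<in> \<Phi>" for \<phi>
  proof -
    have "qq \<phi> \<le> N" "ff \<phi> \<in> V \<rightarrow>\<^sub>E {..<qq \<phi>}" using *[OF that] by blast+
    moreover from this have "ff \<phi> \<in> V \<rightarrow>\<^sub>E {..<N}" by (fastforce simp: PiE_iff)
    ultimately show ?thesis unfolding code_def codes_def using labQ by auto
  qed
  have finC: "finite (codes V (fst Q) N)" using V Q(2) by (rule finite_codes)
  have "\<exists>c\<in>code ` \<Phi>. 2 ^ N * (n ^ d * K ^ N) < card {\<phi> \<in> \<Phi>. code \<phi> = c}"
  proof (rule ccontr)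
    assume "\<not> ?thesis"
    then have "card \<Phi> \<le> 2 ^ N * (n ^ d * K ^ N) * card (code ` \<Phi>)"
      by (intro card_le_mult_fibre[OF fin\<Phi>]) (meson not_less)
    also have "card (code ` \<Phi>) \<le> card (codes V (fst Q) N)" using finC code_mem by (intro card_mono) auto
    finally show False using many by (simp add: mult.commute)
  qed
  then obtain c where c: "c \<in> code ` \<Phi>" "2 ^ N * (n ^ d * K ^ N) < card {\<phi> \<in> \<Phi>. code \<phi> = c}" by blast
  obtain q f Le Ed Lb where cc: "c = (q, f, Le, Ed, Lb)" by (cases c) auto
  define \<Phi>c where "\<Phi>c = {\<phi> \<in> \<Phi>. code \<phi> = c}"
  have cD: "qq \<phi> = q" "ff \<phi> = f" "Le = {(i, j). i < q \<and> j < q \<and> le (pp \<phi> i) (pp \<phi> j)}"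
     "Ed = {(i, j). i < q \<and> j < q \<and> (pp \<phi> i, pp \<phi> j) \<in> edges G}"
     "Lb = restrict (\<lambda>ts. lab G (map (pp \<phi>) ts)) {ts. set ts \<subseteq> {..<N} \<and> distinct ts}" if "\<phi> \<in> \<Phi>c" for \<phi>
    using that unfolding \<Phi>c_def cc code_def by auto
  define \<Psi> where "\<Psi> = pp ` \<Phi>c"
  have ppq: "pp \<phi> \<in> {..<q} \<rightarrow>\<^sub>E X" "emb q Le (pp \<phi>)" "f \<in> V \<rightarrow>\<^sub>E {..<q}" "\<And>x. x \<in> V \<Longrightarrow> \<phi> x = pp \<phi> (f x)"
    "\<And>j. j < q \<Longrightarrow> \<exists>x\<in>V. le (pp \<phi> j) (pp \<phi> (f x))" "q \<le> N" if "\<phi> \<in> \<Phi>c" for \<phi>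
  proof -
    have "\<phi> \<in> \<Phi>" using that unfolding \<Phi>c_def by blast
    from *[OF this] show "pp \<phi> \<in> {..<q} \<rightarrow>\<^sub>E X" "emb q Le (pp \<phi>)" "f \<in> V \<rightarrow>\<^sub>E {..<q}" "\<And>x. x \<in> V \<Longrightarrow> \<phi> x = pp \<phi> (f x)"
      "\<And>j. j < q \<Longrightarrow> \<exists>x\<in>V. le (pp \<phi> j) (pp \<phi> (f x))" "q \<le> N"
      using cD[OF that] by simp_all
  qed
  have recover: "restrict (pp \<phi> \<circ> f) V = \<phi>" if "\<phi> \<in> \<Phi>c" for \<phi>
  proof -
    have "\<phi> \<in> extensional V" using that \<Phi>(1) unfolding \<Phi>c_def by (auto simp: PiE_def)
    moreover have "restrict (pp \<phi> \<circ> f) V \<in> extensional V" by simp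
    ultimately show ?thesis using ppq(4)[OF that] by (intro extensionalityI[of _ V]) auto
  qed
  \<comment> \<open>With \<open>f\<close> fixed by the code, a homomorphism is recovered from its
    embedding, so passing to embeddings loses nothing in the count.\<close>
  have "inj_on pp \<Phi>c" using recover by (metis inj_onI)
  then have card\<Psi>: "card \<Psi> = card \<Phi>c" unfolding \<Psi>_def by (rule card_image)
  have ne: "\<Phi>c \<noteq> {}" using c(2) unfolding \<Phi>c_def[symmetric] by auto
  then have qN: "q \<le> N" using ppq(6) by blast
  have K1: "1 \<le> K" using k unfolding K by simp
  have "\<exists>\<psi> A. \<psi> \<in> \<Psi> \<and> A \<subseteq> {j. j < q \<and> rich \<Psi> q Le K \<psi> j} \<and> (\<forall>a\<in>A. \<forall>b\<in>A. a \<noteq> b \<longrightarrow> (a, b) \<notin> Le) \<and> card A = Suc d"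
  proof (rule ccontr)
    assume no: "\<not> ?thesis"
    have "card \<Psi> \<le> 2 ^ q * (n ^ d * K ^ q)"
    proof (rule card_embeddings_le[OF _ _ n K1])
      show "\<Psi> \<subseteq> {..<q} \<rightarrow>\<^sub>E X" "\<And>\<psi>. \<psi> \<in> \<Psi> \<Longrightarrow> emb q Le \<psi>" unfolding \<Psi>_def using ppq by blast+
    qed (use no in blast)
    also have "\<dots> \<le> 2 ^ N * (n ^ d * K ^ N)" using qN K1 by (intro mult_le_mono order_refl power_increasing) auto
    finally show False using c(2) card\<Psi> unfolding \<Phi>c_def by linarith
  qed
  then obtain \<psi> A where A: "\<psi> \<in> \<Psi>" "A \<subseteq> {j. j < q \<and> rich \<Psi> q Le K \<psi> j}"
    "\<And>a b. a \<in> A \<Longrightarrow> b \<in> A \<Longrightarrow> a \<noteq> b \<Longrightarrow> (a, b) \<notin> Le" "card A = Suc d" by blast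
  obtain \<phi> where \<phi>: "\<phi> \<in> \<Phi>c" "\<psi> = pp \<phi>" using A(1) unfolding \<Psi>_def by blast
  have Aq: "A \<subseteq> {..<q}" using A(2) by auto
  have finA: "finite A" using Aq finite_subset by blast
  have fin\<Psi>: "finite \<Psi>" unfolding \<Psi>_def \<Phi>c_def using fin\<Phi> by simp
  define Y where "Y a = {\<psi>' a | \<psi>'. \<psi>' \<in> \<Psi> \<and> (\<forall>i<q. (i, a) \<in> Le \<longrightarrow> i \<noteq> a \<longrightarrow> \<psi>' i = \<psi> i)}" for a
  have "\<exists>w. inj_on w (A \<times> {..<k}) \<and> (\<forall>p\<in>A \<times> {..<k}. w p \<in> Y (fst p) - \<psi> ` {..<q})"
  proof (rule distinct_representatives)
    show "finite (A \<times> {..<k})" using finA by simp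
    fix p assume "p \<in> A \<times> {..<k}"
    then have "K \<le> card (Y (fst p))" using A(2) unfolding Y_def rich_def by auto
    moreover have "card (\<psi> ` {..<q}) \<le> q" using card_image_le[of "{..<q}" \<psi>] by simp
    moreover have "card (Y (fst p)) - card (\<psi> ` {..<q}) \<le> card (Y (fst p) - \<psi> ` {..<q})" by (rule diff_card_le_card_Diff) simp
    ultimately have "k * Suc d \<le> card (Y (fst p) - \<psi> ` {..<q})" using qN unfolding K by linarith
    then show "card (A \<times> {..<k}) \<le> card (Y (fst p) - \<psi> ` {..<q})" using A(4) by (simp add: card_cartesian_product mult.commute)
  qed
  then obtain w where w: "inj_on w (A \<times> {..<k})" "\<And>a c. a \<in> A \<Longrightarrow> c < k \<Longrightarrow> w (a, c) \<in> Y a \<and> w (a, c) \<notin> \<psi> ` {..<q}"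
    by fastforce
  have "\<exists>\<psi>'. a \<in> A \<longrightarrow> c < k \<longrightarrow> \<psi>' \<in> \<Psi> \<and> w (a, c) = \<psi>' a \<and> (\<forall>i<q. (i, a) \<in> Le \<longrightarrow> i \<noteq> a \<longrightarrow> \<psi>' i = \<psi> i)" for a c
    using w(2)[of a c] unfolding Y_def by blast
  then obtain \<Theta> where \<Theta>: "\<And>a c. a \<in> A \<Longrightarrow> c < k \<Longrightarrow> \<Theta> a c \<in> \<Psi> \<and> w (a, c) = \<Theta> a c a \<and>
     (\<forall>i<q. (i, a) \<in> Le \<longrightarrow> i \<noteq> a \<longrightarrow> \<Theta> a c i = \<psi> i)" by metis
  have emb\<Psi>: "emb q Le \<chi>" and Ed\<Psi>: "\<And>i j. i < q \<Longrightarrow> j < q \<Longrightarrow> (i, j) \<in> Ed \<longleftrightarrow> (\<chi> i, \<chi> j) \<in> edges G"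
    and Lb\<Psi>: "\<And>ts. distinct ts \<Longrightarrow> set ts \<subseteq> {..<q} \<Longrightarrow> lab G (map \<chi> ts) = Lb ts" if "\<chi> \<in> \<Psi>" for \<chi>
  proof -
    obtain \<phi>' where \<phi>': "\<phi>' \<in> \<Phi>c" "\<chi> = pp \<phi>'" using \<open>\<chi> \<in> \<Psi>\<close> unfolding \<Psi>_def by blast
    show "emb q Le \<chi>" unfolding \<phi>'(2) by (rule ppq(2)[OF \<phi>'(1)])
    show "(i, j) \<in> Ed \<longleftrightarrow> (\<chi> i, \<chi> j) \<in> edges G" if "i < q" "j < q" for i j
      unfolding \<phi>'(2) cD(4)[OF \<phi>'(1)] using that by simp
    show "lab G (map \<chi> ts) = Lb ts" if "distinct ts" "set ts \<subseteq> {..<q}" for ts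
    proof -
      have "set ts \<subseteq> {..<N}" using that(2) qN by auto
      then show ?thesis unfolding \<phi>'(2) cD(5)[OF \<phi>'(1)] using that(1) by simp
    qed
  qed
  have "glued X le \<rho> G q Le Ed Lb A k \<psi> \<Theta>"
  proof
    show "labelled_graph G" "legal G" "X \<subseteq> verts G" "A \<subseteq> {..<q}" "0 < k" by fact+
    show "le u v \<or> le v u" if "(u, v) \<in> edges G" "u \<in> X" "v \<in> X" for u v
      unfolding le_def using edge_ancestor[OF G that] .
    show "emb q Le \<psi>" by (rule emb\<Psi>[OF A(1)])
    show "(i, j) \<in> Ed \<longleftrightarrow> (\<psi> i, \<psi> j) \<in> edges G" if "i < q" "j < q" for i j by (rule Ed\<Psi>[OF A(1) that])
    show "lab G (map \<psi> ts) = Lb ts" if "distinct ts" "set ts \<subseteq> {..<q}" for ts by (rule Lb\<Psi>[OF A(1) that])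
    fix a c assume ac: "a \<in> A" "c < k"
    then have t: "\<Theta> a c \<in> \<Psi>" using \<Theta> by blast
    show "emb q Le (\<Theta> a c)" by (rule emb\<Psi>[OF t])
    show "(i, j) \<in> Ed \<longleftrightarrow> (\<Theta> a c i, \<Theta> a c j) \<in> edges G" if "i < q" "j < q" for i j by (rule Ed\<Psi>[OF t that])
    show "lab G (map (\<Theta> a c) ts) = Lb ts" if "distinct ts" "set ts \<subseteq> {..<q}" for ts by (rule Lb\<Psi>[OF t that])
    show "\<Theta> a c i = \<psi> i" if "i < q" "(i, a) \<in> Le" "i \<noteq> a" for i using \<Theta>[OF ac] that by blast
    show "\<Theta> a c a \<notin> \<psi> ` {..<q}" using \<Theta>[OF ac] w(2)[OF ac] by simp
    fix b e assume be: "b \<in> A" "e < k" "\<Theta> a c a = \<Theta> b e b"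
    then have "w (a, c) = w (b, e)" using \<Theta>[OF ac] \<Theta>[OF be(1,2)] by simp
    then show "a = b \<and> c = e" using w(1) ac be(1,2) by (auto simp: inj_on_def)
  next
    show "a = b" if "a \<in> A" "b \<in> A" "(a, b) \<in> Le" for a b using A(3)[OF that(1,2)] that(3) by blast
  qed
  moreover have "(restrict (\<psi> \<circ> f) V, G) \<in> \<H>"
  proof -
    have "\<phi> \<in> \<Phi>" using \<phi>(1) unfolding \<Phi>c_def by blast
    then show ?thesis using recover[OF \<phi>(1)] \<Phi>(2) \<phi>(2) by simp
  qed
  moreover have "f ` V \<subseteq> {..<q}" using ppq(3)[OF \<phi>(1)] by auto
  moreover have "\<exists>x\<in>V. (a, f x) \<in> Le" if "a \<in> A" for a
  proof -
    have "a < q" using that Aq by auto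
    then obtain x where "x \<in> V" "le (pp \<phi> a) (pp \<phi> (f x))" using ppq(5)[OF \<phi>(1)] by blast
    moreover have "f x < q" using \<open>x \<in> V\<close> ppq(3)[OF \<phi>(1)] by auto
    ultimately show ?thesis unfolding cD(3)[OF \<phi>(1)] using \<open>a < q\<close> by blast
  qed
  ultimately have "host \<G> \<H> V c A k" unfolding host_def cc prod.case using G\<G> by blast
  moreover have "c \<in> codes V (fst Q) N" using c(1) code_mem by blast
  moreover have "A \<in> Pow {..<N}" using Aq qN by auto
  ultimately show ?thesis using A(4) by blast
qed

text \<open>One host supplies the homomorphism \<open>\<phi>\<close> and, as the induced subgraph on
  its image, the graph \<open>B\<close>; every host supplies a duplication of this same
  \<open>B\<close>, because all share the code. The separation for a node \<open>a\<close> cuts off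
  \<open>D a\<close>, the vertices of \<open>H\<close> that are sent to the branch above
  \<open>a\<close>.\<close>

lemma duplicable_if_infinitely_many_hosts:
  fixes H :: "('h, 'x) lgraph" and \<G> :: "('v, 'x) lgraph set"
  assumes H: "wf_graph H" and \<G>: "\<And>G. G \<in> \<G> \<Longrightarrow> labelled_graph G" "hereditary \<G>"
    and \<H>: "hom_set Q H \<G> \<H>" "consistent Q H \<G> \<H>"
    and inf: "infinite {k. 0 < k \<and> host \<G> \<H> (verts H) c A k}"
  shows "\<exists>\<L>. independent_coll H \<L> \<and> GH_duplicable H \<G> \<H> \<L> \<and> card \<L> = card A"
proof -
  define V where "V = verts H"
  obtain q f Le Ed Lb where cc: "c = (q, f, Le, Ed, Lb)" by (cases c) auto
  have "{k. 0 < k \<and> host \<G> \<H> (verts H) c A k} \<noteq> {}" using inf infinite_imp_nonempty by blast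
  then obtain k0 where k0: "0 < k0" "host \<G> \<H> V (q, f, Le, Ed, Lb) A k0" unfolding V_def cc by blast
  obtain G X le \<rho> \<psi> \<Theta> where f: "f ` V \<subseteq> {..<q}" "\<And>a. a \<in> A \<Longrightarrow> \<exists>x\<in>V. (a, f x) \<in> Le" and G\<G>: "G \<in> \<G>"
    and gl: "glued X le \<rho> G q Le Ed Lb A k0 \<psi> \<Theta>" and \<phi>0: "(restrict (\<psi> \<circ> f) V, G) \<in> \<H>"
    by (rule hostE[OF k0(2)], rule that) assumption+
  interpret glued X le \<rho> G q Le Ed Lb A k0 \<psi> \<Theta> by (rule gl)
  define \<phi> where "\<phi> = restrict (\<psi> \<circ> f) V"
  define J where "J = f ` V"
  define B where "B = ind_sub G (\<psi> ` J)"
  have Jq: "J \<subseteq> {..<q}" unfolding J_def by (rule f(1))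
  have \<phi>x: "\<phi> x = \<psi> (f x)" if "x \<in> V" for x unfolding \<phi>_def using that by simp
  have \<phi>V: "\<phi> ` V = \<psi> ` J" unfolding J_def using \<phi>x by (auto simp: image_iff)
  have sub: "\<psi> ` J \<subseteq> verts G" using emb_mem[OF emb_\<psi>] Jq XG by auto
  have lB: "labelled_graph B" unfolding B_def by (rule labelled_graph_ind_sub[OF lG sub])
  have wfB: "wf_graph B" using lB unfolding labelled_graph_def by blast
  have vB: "verts B = \<psi> ` J" unfolding B_def by simp
  have "induced_subgraph B G" unfolding B_def by (rule induced_subgraph_ind_sub[OF lG sub])
  moreover have "\<phi> ` verts H \<subseteq> verts B" using \<phi>V unfolding vB V_def by simp
  ultimately have \<phi>B: "(\<phi>, B) \<in> \<H>"
    using \<H>(2) \<phi>0 unfolding consistent_def \<phi>_def[symmetric] by fast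
  have hom: "(\<phi> x, \<phi> y) \<in> edges G" if "(x, y) \<in> edges H" for x y
    using \<H>(1) \<phi>0 that unfolding hom_set_def \<phi>_def[symmetric] lhom_def by fast
  have fq: "f x < q" if "x \<in> V" for x using f(1) that by auto
  have inj\<psi>: "\<psi> (f x) = \<psi> (f y) \<longleftrightarrow> f x = f y" if "x \<in> V" "y \<in> V" for x y using emb_inj[OF emb_\<psi>] fq that by blast
  define D where "D a = {x \<in> V. (a, f x) \<in> Le}" for a
  define S where "S a = \<psi> ` {t \<in> J. (a, t) \<in> Le}" for a
  have SD: "\<phi> ` D a = S a" for a unfolding S_def D_def J_def using \<phi>x by (auto simp: image_iff)
  have D_ne: "D a \<noteq> {}" if "a \<in> A" for a using f(2)[OF that] unfolding D_def by blast
  \<comment> \<open>Images above \<open>a\<close> and \<open>b\<close> that coincide or are adjacent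
    are comparable, so \<open>a\<close> and \<open>b\<close> lie below a common node, and the
    antichain property gives equality. Independence of the separations follows from this both in
    \<open>H\<close> and in \<open>B\<close>.\<close>
  have same: "a = b" if ab: "a \<in> A" "b \<in> A" and x: "x \<in> V" "(a, f x) \<in> Le" and y: "y \<in> V" "(b, f y) \<in> Le"
    and xy: "\<phi> x = \<phi> y \<or> (\<phi> x, \<phi> y) \<in> edges G" for a b x y
  proof -
    have "(f x, f y) \<in> Le \<or> (f y, f x) \<in> Le"
    proof (cases "\<phi> x = \<phi> y")
      case True
      then have "f x = f y" using inj\<psi> x(1) y(1) \<phi>x by simp
      then show ?thesis using emb_Le_refl[OF emb_\<psi> fq[OF x(1)]] by simp
    next
      case False
      then have "(\<psi> (f x), \<psi> (f y)) \<in> edges G" using xy \<phi>x x(1) y(1) by simp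
      then have "le (\<psi> (f x)) (\<psi> (f y)) \<or> le (\<psi> (f y)) (\<psi> (f x))"
        using edge_comparable emb_mem[OF emb_\<psi>] fq x(1) y(1) by blast
      then show ?thesis using emb_le[OF emb_\<psi>] fq x(1) y(1) by blast
    qed
    then show ?thesis
    proof
      assume "(f x, f y) \<in> Le"
      then have "(a, f y) \<in> Le" using Le_trans[OF x(2)] A_less[OF ab(1)] fq x(1) y(1) by blast
      then show ?thesis using top_unique(2)[OF ab(1)] top_unique(2)[OF ab(2) y(2)] fq[OF y(1)] by metis
    next
      assume "(f y, f x) \<in> Le"
      then have "(b, f x) \<in> Le" using Le_trans[OF y(2)] A_less[OF ab(2)] fq x(1) y(1) by blast
      then show ?thesis using top_unique(2)[OF ab(2)] top_unique(2)[OF ab(1) x(2)] fq[OF x(1)] by metis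
    qed
  qed
  \<comment> \<open>The two sides differ exactly by \<open>D a\<close>, whose image is
    \<open>S a\<close>; hence the collection that \<open>GH_duplicable\<close> forms from images is
    \<open>\<L>'\<close>.\<close>
  define \<L> where "\<L> = (\<lambda>a. (closed_nbhd H (D a), V - D a)) ` A"
  define \<L>' where "\<L>' = (\<lambda>a. (closed_nbhd B (S a), verts B - S a)) ` A"
  have DV: "D a \<subseteq> V" for a unfolding D_def by blast
  have nbH: "D a \<subseteq> closed_nbhd H (D a)" "closed_nbhd H (D a) \<subseteq> V" for a
    using DV unfolding closed_nbhd_def V_def by auto
  have SB: "S a \<subseteq> verts B" for a unfolding S_def vB by blast
  have nbB: "S a \<subseteq> closed_nbhd B (S a)" "closed_nbhd B (S a) \<subseteq> verts B" for a
    using SB unfolding closed_nbhd_def by auto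
  have diffH: "closed_nbhd H (D a) - (V - D a) = D a" for a using nbH[of a] by blast
  have diffB: "closed_nbhd B (S a) - (verts B - S a) = S a" for a using nbB[of a] by blast
  have S_ne: "S a \<noteq> {}" if "a \<in> A" for a using D_ne[OF that] SD by blast
  have D_sep: "closed_nbhd H (D a) \<subseteq> V - D b" if ab: "a \<in> A" "b \<in> A" "a \<noteq> b" for a b
  proof
    fix y assume y: "y \<in> closed_nbhd H (D a)"
    then obtain x where x: "x \<in> D a" "x = y \<or> (x, y) \<in> edges H" unfolding closed_nbhd_def by blast
    have "y \<notin> D b"
    proof
      assume "y \<in> D b"
      then have "a = b" using same[OF ab(1,2), of x y] x hom unfolding D_def by blast
      then show False using ab(3) by blast
    qed
    then show "y \<in> V - D b" using y nbH by blast
  qed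
  have S_sep: "closed_nbhd B (S a) \<subseteq> verts B - S b" if ab: "a \<in> A" "b \<in> A" "a \<noteq> b" for a b
  proof
    fix y assume y: "y \<in> closed_nbhd B (S a)"
    then obtain x where x: "x \<in> S a" "x = y \<or> (x, y) \<in> edges B" unfolding closed_nbhd_def by blast
    have "y \<notin> S b"
    proof
      assume "y \<in> S b"
      then obtain x' y' where *: "x' \<in> D a" "x = \<phi> x'" "y' \<in> D b" "y = \<phi> y'" using x(1) SD by (metis imageE)
      then have "\<phi> x' = \<phi> y' \<or> (\<phi> x', \<phi> y') \<in> edges G" using x(2) unfolding B_def by auto
      then have "a = b" using same[OF ab(1,2), of x' y'] * unfolding D_def by blast
      then show False using ab(3) by blast
    qed
    then show "y \<in> verts B - S b" using y nbB by blast
  qed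
  have indH: "independent_coll H \<L>"
    unfolding independent_coll_def
  proof (intro conjI ballI)
    fix s assume "s \<in> \<L>"
    then obtain a where a: "a \<in> A" "s = (closed_nbhd H (D a), V - D a)" unfolding \<L>_def by blast
    show "separation H s" unfolding separation_def a(2) prod.case diffH
    proof (intro conjI ballI)
      show "closed_nbhd H (D a) \<subseteq> verts H" using nbH(2)[of a] unfolding V_def .
      show "V - D a \<subseteq> verts H" unfolding V_def by blast
      show "closed_nbhd H (D a) \<union> (V - D a) = verts H" using nbH[of a] unfolding V_def by blast
      fix u v assume "u \<in> D a" "v \<in> V - D a - closed_nbhd H (D a)"
      then show "(u, v) \<notin> edges H" unfolding closed_nbhd_def V_def by blast
    qed
    show "case s of (A, B) \<Rightarrow> A - B \<noteq> {}" unfolding a(2) prod.case diffH by (rule D_ne[OF a(1)])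
    show "case s of (A, B) \<Rightarrow> \<forall>(C, D)\<in>\<L>. (A, B) \<noteq> (C, D) \<longrightarrow> A \<subseteq> D \<and> C \<subseteq> B"
      unfolding a(2) prod.case
    proof
      fix s' assume "s' \<in> \<L>"
      then obtain b where b: "b \<in> A" "s' = (closed_nbhd H (D b), V - D b)" unfolding \<L>_def by blast
      show "case s' of (C, E) \<Rightarrow> (closed_nbhd H (D a), V - D a) \<noteq> (C, E) \<longrightarrow>
          closed_nbhd H (D a) \<subseteq> E \<and> C \<subseteq> V - D a"
        unfolding b(2) prod.case using D_sep[OF a(1) b(1)] D_sep[OF b(1) a(1)] by metis
    qed
  qed
  have indB: "independent_coll B \<L>'"
    unfolding independent_coll_def
  proof (intro conjI ballI)
    fix s assume "s \<in> \<L>'"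
    then obtain a where a: "a \<in> A" "s = (closed_nbhd B (S a), verts B - S a)" unfolding \<L>'_def by blast
    show "separation B s" unfolding separation_def a(2) prod.case diffB
    proof (intro conjI ballI)
      show "closed_nbhd B (S a) \<subseteq> verts B" by (rule nbB)
      show "verts B - S a \<subseteq> verts B" by blast
      show "closed_nbhd B (S a) \<union> (verts B - S a) = verts B" using nbB[of a] by blast
      fix u v assume "u \<in> S a" "v \<in> verts B - S a - closed_nbhd B (S a)"
      then show "(u, v) \<notin> edges B" unfolding closed_nbhd_def by blast
    qed
    show "case s of (A, B) \<Rightarrow> A - B \<noteq> {}" unfolding a(2) prod.case diffB by (rule S_ne[OF a(1)])
    show "case s of (A, B) \<Rightarrow> \<forall>(C, D)\<in>\<L>'. (A, B) \<noteq> (C, D) \<longrightarrow> A \<subseteq> D \<and> C \<subseteq> B"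
      unfolding a(2) prod.case
    proof
      fix s' assume "s' \<in> \<L>'"
      then obtain b where b: "b \<in> A" "s' = (closed_nbhd B (S b), verts B - S b)" unfolding \<L>'_def by blast
      show "case s' of (C, E) \<Rightarrow> (closed_nbhd B (S a), verts B - S a) \<noteq> (C, E) \<longrightarrow>
          closed_nbhd B (S a) \<subseteq> E \<and> C \<subseteq> verts B - S a"
        unfolding b(2) prod.case using S_sep[OF a(1) b(1)] S_sep[OF b(1) a(1)] by metis
    qed
  qed
  have card\<L>: "card \<L> = card A"
  proof -
    have "inj_on (\<lambda>a. (closed_nbhd H (D a), V - D a)) A"
    proof (rule inj_onI)
      fix a b assume ab: "a \<in> A" "b \<in> A" "(closed_nbhd H (D a), V - D a) = (closed_nbhd H (D b), V - D b)"
      then have "D a = D b" using diffH by (metis prod.inject)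
      then show "a = b" using D_sep[OF ab(1,2)] nbH(1)[of a] D_ne[OF ab(1)] by blast
    qed
    then show ?thesis unfolding \<L>_def by (rule card_image)
  qed
  have card\<L>': "card \<L>' = card A"
  proof -
    have "inj_on (\<lambda>a. (closed_nbhd B (S a), verts B - S a)) A"
    proof (rule inj_onI)
      fix a b assume ab: "a \<in> A" "b \<in> A" "(closed_nbhd B (S a), verts B - S a) = (closed_nbhd B (S b), verts B - S b)"
      then have "S a = S b" using diffB by (metis prod.inject)
      then show "a = b" using S_sep[OF ab(1,2)] nbB(1)[of a] S_ne[OF ab(1)] by blast
    qed
    then show ?thesis unfolding \<L>'_def by (rule card_image)
  qed
  have im: "(\<lambda>(A, B'). (closed_nbhd B (\<phi> ` (A - B')), verts B - \<phi> ` (A - B'))) ` \<L> = \<L>'"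
    unfolding \<L>_def \<L>'_def image_image prod.case diffH SD ..
  have cd: "class_duplicable \<G> B \<L>'"
    unfolding class_duplicable_def
  proof (rule infinite_super[OF _ inf], rule subsetI)
    fix k assume "k \<in> {k. 0 < k \<and> host \<G> \<H> (verts H) c A k}"
    then have "0 < k" and hk: "host \<G> \<H> V (q, f, Le, Ed, Lb) A k" unfolding V_def cc by auto
    obtain G1 X1 le1 \<rho>1 \<psi>1 \<Theta>1 where G1: "G1 \<in> \<G>" and gl1: "glued X1 le1 \<rho>1 G1 q Le Ed Lb A k \<psi>1 \<Theta>1"
      by (rule hostE[OF hk], rule that) assumption+
    have "\<exists>W\<subseteq>verts G1. isomorphic (duplicate B \<L>' k) (ind_sub G1 W)"
      unfolding \<L>'_def S_def
    proof (rule glued.duplicate_isomorphic_induced[OF gl1 lB Jq _ vB])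
      show "inj_on \<psi> J" using emb_inj[OF emb_\<psi>] Jq by (auto simp: inj_on_def)
      show "(\<psi> s, \<psi> t) \<in> edges B \<longleftrightarrow> (s, t) \<in> Ed" if "s \<in> J" "t \<in> J" for s t
        using Ed_\<psi>[of s t] that Jq unfolding B_def by auto
      show "lab B (map \<psi> ts) = Lb ts" if "distinct ts" "set ts \<subseteq> J" for ts
      proof -
        have "set (map \<psi> ts) \<subseteq> \<psi> ` J" "set ts \<subseteq> {..<q}" using that(2) Jq by auto
        then show ?thesis using Lb_\<psi>[OF that(1)] unfolding B_def by simp
      qed
    qed
    then obtain W where W: "W \<subseteq> verts G1" "isomorphic (duplicate B \<L>' k) (ind_sub G1 W)" by blast
    have "ind_sub G1 W \<in> \<G>"
      using \<G>(2) G1 induced_subgraph_ind_sub[OF \<G>(1)[OF G1] W(1)] unfolding hereditary_def by blast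
    then show "k \<in> {k. 0 < k \<and> (\<exists>G'\<in>\<G>. isomorphic (duplicate B \<L>' k) G')}" using W(2) \<open>0 < k\<close> by blast
  qed
  have disj: "\<forall>(A, B)\<in>\<L>. \<phi> ` (A - B) \<inter> \<phi> ` B = {}"
  proof
    fix s assume "s \<in> \<L>"
    then obtain a where a: "a \<in> A" "s = (closed_nbhd H (D a), V - D a)" unfolding \<L>_def by blast
    have "\<phi> x \<noteq> \<phi> y" if "x \<in> D a" "y \<in> V - D a" for x y
    proof
      assume "\<phi> x = \<phi> y"
      moreover have "x \<in> V" "y \<in> V" using that DV by auto
      ultimately have "f x = f y" using inj\<psi>[of x y] \<phi>x by simp
      then show False using that unfolding D_def by simp
    qed
    then show "case s of (A, B) \<Rightarrow> \<phi> ` (A - B) \<inter> \<phi> ` B = {}" unfolding a(2) prod.case diffH by blast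
  qed
  have "\<phi> ` verts H = verts B" using \<phi>V unfolding vB V_def .
  then have "GH_duplicable H \<G> \<H> \<L>" unfolding GH_duplicable_def Let_def
    using \<phi>B disj im indB cd card\<L> card\<L>' by (intro exI[of _ \<phi>] exI[of _ B]) simp
  then show ?thesis using indH card\<L> by blast
qed

section \<open>Finiteness and attainment of the counting function\<close>

lemma hom_setD:
  assumes "hom_set Q H \<G> \<H>" "(\<phi>, G) \<in> \<H>"
  shows "G \<in> \<G>" "lhom Q H G \<phi>" "\<phi> \<in> extensional (verts H)"
  using bspec[OF assms(1)[unfolded hom_set_def] assms(2)] by simp_all

lemma homs_bounded:
  assumes H: "wf_graph H" and \<G>: "\<And>G. G \<in> \<G> \<Longrightarrow> wf_graph G" and hs: "hom_set Q H \<G> \<H>"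
  shows "{\<phi>. (\<phi>, G) \<in> \<H>} \<subseteq> verts H \<rightarrow>\<^sub>E verts G" "finite {\<phi>. (\<phi>, G) \<in> \<H>}"
    "card {\<phi>. (\<phi>, G) \<in> \<H>} \<le> card (verts G) ^ card (verts H)"
proof -
  show sub: "{\<phi>. (\<phi>, G) \<in> \<H>} \<subseteq> verts H \<rightarrow>\<^sub>E verts G"
  proof
    fix \<phi> assume "\<phi> \<in> {\<phi>. (\<phi>, G) \<in> \<H>}"
    then have "lhom Q H G \<phi>" "\<phi> \<in> extensional (verts H)" using hom_setD(2,3)[OF hs] by auto
    then show "\<phi> \<in> verts H \<rightarrow>\<^sub>E verts G" unfolding lhom_def PiE_iff by simp
  qed
  have finH: "finite (verts H)" by (rule wf_graph_finite[OF H])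
  have "finite {\<phi>. (\<phi>, G) \<in> \<H>} \<and> card {\<phi>. (\<phi>, G) \<in> \<H>} \<le> card (verts G) ^ card (verts H)"
  proof (cases "G \<in> \<G>")
    case True
    have "finite (verts H \<rightarrow>\<^sub>E verts G)" using finH wf_graph_finite[OF \<G>[OF True]] by (simp add: finite_PiE)
    then show ?thesis using sub card_mono[OF _ sub] finH by (simp add: card_PiE finite_subset)
  next
    case False
    then have "{\<phi>. (\<phi>, G) \<in> \<H>} = {}" using hom_setD(1)[OF hs] by blast
    then show ?thesis by simp
  qed
  then show "finite {\<phi>. (\<phi>, G) \<in> \<H>}" "card {\<phi>. (\<phi>, G) \<in> \<H>} \<le> card (verts G) ^ card (verts H)" by auto
qed

lemma ex_count_set_finite:
  assumes H: "wf_graph H" and \<G>: "\<And>G. G \<in> \<G> \<Longrightarrow> wf_graph G" and hs: "hom_set Q H \<G> \<H>"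
  shows "finite {card {\<phi>. (\<phi>, G) \<in> \<H>} | G. G \<in> \<G> \<and> card (verts G) = n}"
  by (rule finite_subset[of _ "{..n ^ card (verts H)}"]) (use homs_bounded(3)[OF assms] in auto)

lemma ex_count_ge:
  assumes "wf_graph H" "\<And>G. G \<in> \<G> \<Longrightarrow> wf_graph G" "hom_set Q H \<G> \<H>" "G \<in> \<G>"
  shows "card {\<phi>. (\<phi>, G) \<in> \<H>} \<le> ex_count H \<H> \<G> (card (verts G))"
  unfolding ex_count_def
  by (rule le_cSup_finite[OF ex_count_set_finite[OF assms(1-3)]]) (use assms(4) in auto)

lemma ex_count_attained:
  assumes "wf_graph H" "\<And>G. G \<in> \<G> \<Longrightarrow> wf_graph G" "hom_set Q H \<G> \<H>" "0 < ex_count H \<H> \<G> n"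
  shows "\<exists>G\<in>\<G>. card (verts G) = n \<and> card {\<phi>. (\<phi>, G) \<in> \<H>} = ex_count H \<H> \<G> n"
proof -
  let ?S = "{card {\<phi>. (\<phi>, G) \<in> \<H>} | G. G \<in> \<G> \<and> card (verts G) = n}"
  have "?S \<noteq> {}"
  proof
    assume "?S = {}"
    \<comment> \<open>The supremum of the empty set of natural numbers is 0.\<close>
    then show False using assms(4) unfolding ex_count_def by (simp only: Sup_nat_def simp_thms if_True less_irrefl)
  qed
  then have "Sup ?S \<in> ?S" using Max_in[OF ex_count_set_finite[OF assms(1-3)] \<open>?S \<noteq> {}\<close>]
    by (simp only: Sup_nat_def if_False)
  then show ?thesis unfolding ex_count_def by fastforce
qed

text \<open>For each \<open>k\<close>, take a large \<open>n\<close> and a graph that attains the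
  count, and split its homomorphisms by the colours of the images. Up to constants this costs at
  most \<open>n powr (\<epsilon> / 2)\<close> and confines one class of homomorphisms to a set
  \<open>X\<close> with at most \<open>h\<close> colours, whose elimination forest has bounded
  height. The remaining excess beats the constants that depend on \<open>k\<close>, so
  \<open>host_exists\<close> applies.\<close>

theorem duplicable_if_many_homs:
  fixes H :: "('h, 'x) lgraph" and \<G> :: "('v, 'x) lgraph set" and \<epsilon> :: real
  assumes Q: "finite (fst Q)" and H: "wf_graph H" and \<G>: "\<And>G. G \<in> \<G> \<Longrightarrow> legal_q_labelled Q G" "hereditary \<G>" "nowhere_dense \<G>"
    and \<H>: "hom_set Q H \<G> \<H>" "consistent Q H \<G> \<H>" and \<epsilon>: "0 < \<epsilon>"
    and inf: "infinite {n. real n powr (real d + \<epsilon>) < real (ex_count H \<H> \<G> n)}"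
  shows "\<exists>\<L>. independent_coll H \<L> \<and> GH_duplicable H \<G> \<H> \<L> \<and> card \<L> = Suc d"
proof -
  define V where "V = verts H"
  define h where "h = card V"
  define N where "N = card V * h"
  have finV: "finite V" unfolding V_def by (rule wf_graph_finite[OF H])
  have lab\<G>: "labelled_graph G" if "G \<in> \<G>" for G using \<G>(1)[OF that] unfolding legal_q_labelled_def q_labelled_def by blast
  have wf\<G>: "wf_graph G" if "G \<in> \<G>" for G using lab\<G>[OF that] unfolding labelled_graph_def by blast
  have fin: "finite (codes V (fst Q) N \<times> Pow {..<N})" using finite_codes[OF finV Q] by simp
  have each: "\<exists>p\<in>codes V (fst Q) N \<times> Pow {..<N}. card (snd p) = Suc d \<and> host \<G> \<H> V (fst p) (snd p) k" if k: "0 < k" for k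
  proof -
    define K where "K = k * Suc d + N"
    define C where "C = 2 ^ h * (real (card (codes V (fst Q) N)) * (2 ^ N * real K ^ N))"
    \<comment> \<open>At most \<open>M ^ h\<close> colour patterns occur, with \<open>M\<close>
      about \<open>n powr \<delta>\<close>. The denominator uses \<open>h + 1\<close> instead of
      \<open>h\<close> to cover an empty \<open>H\<close>.\<close>
    define \<delta> where "\<delta> = \<epsilon> / (2 * real (h + 1))"
    have \<delta>: "0 < \<delta>" unfolding \<delta>_def using \<epsilon> by simp
    obtain n0 where n0: "\<forall>G\<in>\<G>. n0 \<le> card (verts G) \<longrightarrow> (\<exists>\<rho> col :: 'v \<Rightarrow> nat. inj_on \<rho> (verts G) \<and>
     (\<forall>v\<in>verts G. real (col v) < real (card (verts G)) powr \<delta>) \<and>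
     (\<forall>X\<subseteq>verts G. card (col ` X) \<le> h \<longrightarrow> (\<forall>v. card {u. ancestor G \<rho> X u v} \<le> h)))"
      by (rule exE[OF nowhere_dense_colouring[OF \<G>(3) _ \<delta>, of h]], erule wf\<G>, rule that, assumption)
    define n1 where "n1 = max (max n0 1) (nat \<lceil>C powr (2 / \<epsilon>)\<rceil>)"
    have "\<not> finite {n. real n powr (real d + \<epsilon>) < real (ex_count H \<H> \<G> n)}" by (rule inf)
    then obtain n where n: "n1 \<le> n" "real n powr (real d + \<epsilon>) < real (ex_count H \<H> \<G> n)"
      unfolding infinite_nat_iff_unbounded_le by blast
    have nn: "n0 \<le> n" "1 \<le> n" "C powr (2 / \<epsilon>) \<le> real n" using n(1) unfolding n1_def by linarith+
    have "0 \<le> C" unfolding C_def by simp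
    then have "C = (C powr (2 / \<epsilon>)) powr (\<epsilon> / 2)" using \<epsilon> by (simp add: powr_powr)
    also have "\<dots> \<le> real n powr (\<epsilon> / 2)" using nn(3) \<epsilon> by (intro powr_mono2) auto
    finally have Cn: "C \<le> real n powr (\<epsilon> / 2)" .
    have "0 < real n powr (real d + \<epsilon>)" using nn(2) by simp
    then have "0 < ex_count H \<H> \<G> n" using n(2) by linarith
    then obtain G where G: "G \<in> \<G>" "card (verts G) = n" "card {\<phi>. (\<phi>, G) \<in> \<H>} = ex_count H \<H> \<G> n"
      using ex_count_attained[OF H wf\<G> \<H>(1)] by blast
    define \<Phi>0 where "\<Phi>0 = {\<phi>. (\<phi>, G) \<in> \<H>}"
    have \<Phi>0: "\<Phi>0 \<subseteq> V \<rightarrow>\<^sub>E verts G" "finite \<Phi>0" unfolding \<Phi>0_def V_def using homs_bounded[OF H wf\<G> \<H>(1)] by blast+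
    have "n0 \<le> card (verts G)" using nn(1) G(2) by simp
    from bspec[OF n0 G(1), THEN mp, OF this] obtain \<rho> col :: "'v \<Rightarrow> nat" where
      col': "inj_on \<rho> (verts G)" "\<forall>v\<in>verts G. real (col v) < real n powr \<delta>"
      "\<forall>X\<subseteq>verts G. card (col ` X) \<le> h \<longrightarrow> (\<forall>v. card {u. ancestor G \<rho> X u v} \<le> h)"
      unfolding G(2) by (elim exE conjE) (rule that)
    then have col: "inj_on \<rho> (verts G)" "\<And>v. v \<in> verts G \<Longrightarrow> real (col v) < real n powr \<delta>"
      "\<And>X v. X \<subseteq> verts G \<Longrightarrow> card (col ` X) \<le> h \<Longrightarrow> card {u. ancestor G \<rho> X u v} \<le> h" by simp_all
    define M where "M = nat \<lceil>real n powr \<delta>\<rceil>"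
    have "1 \<le> real n powr \<delta>" using nn(2) \<delta> by (simp add: ge_one_powr_ge_zero)
    then have M: "real M \<le> 2 * real n powr \<delta>" unfolding M_def by linarith
    have colM: "col v < M" if "v \<in> verts G" for v using col(2)[OF that] unfolding M_def by linarith
    define \<kappa> where "\<kappa> \<phi> = restrict (col \<circ> \<phi>) V" for \<phi> :: "'h \<Rightarrow> 'v"
    have "\<kappa> ` \<Phi>0 \<subseteq> V \<rightarrow>\<^sub>E {..<M}" unfolding \<kappa>_def using \<Phi>0(1) colM by (fastforce simp: PiE_iff)
    then have "card (\<kappa> ` \<Phi>0) \<le> card (V \<rightarrow>\<^sub>E {..<M})" using finV by (intro card_mono) (simp_all add: finite_PiE)
    also have "\<dots> = M ^ h" using finV by (simp add: card_PiE h_def)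
    finally have c\<kappa>: "card (\<kappa> ` \<Phi>0) \<le> M ^ h" .
    define b where "b = card (codes V (fst Q) N) * (2 ^ N * (n ^ d * K ^ N))"
    have "\<exists>g\<in>\<kappa> ` \<Phi>0. b < card {\<phi> \<in> \<Phi>0. \<kappa> \<phi> = g}"
    proof (rule ccontr)
      assume "\<not> ?thesis"
      then have "card \<Phi>0 \<le> b * card (\<kappa> ` \<Phi>0)" by (intro card_le_mult_fibre[OF \<Phi>0(2)]) (meson not_less)
      also have "\<dots> \<le> b * M ^ h" using c\<kappa> by (rule mult_le_mono2)
      finally have "real (card \<Phi>0) \<le> real (b * M ^ h)" by (rule of_nat_mono)
      also have "\<dots> = real b * real M ^ h" by simp
      also have "\<dots> \<le> real b * (2 * real n powr \<delta>) ^ h" using M by (intro mult_left_mono power_mono) auto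
      also have "(2 * real n powr \<delta>) ^ h = 2 ^ h * real n powr (\<delta> * real h)"
        using nn(2) by (simp add: power_mult_distrib powr_realpow[symmetric] powr_powr)
      also have "real b * (2 ^ h * real n powr (\<delta> * real h)) \<le> real b * (2 ^ h * real n powr (\<epsilon> / 2))"
      proof (intro mult_left_mono powr_mono)
        show "\<delta> * real h \<le> \<epsilon> / 2" unfolding \<delta>_def using \<epsilon> by (simp add: field_simps)
      qed (use nn(2) in auto)
      also have "real b * (2 ^ h * real n powr (\<epsilon> / 2)) = C * real n ^ d * real n powr (\<epsilon> / 2)"
        unfolding b_def C_def by simp
      also have "\<dots> \<le> real n powr (\<epsilon> / 2) * real n ^ d * real n powr (\<epsilon> / 2)"
        using Cn by (intro mult_right_mono) auto
      also have "\<dots> = real n powr (\<epsilon> / 2) * real n powr real d * real n powr (\<epsilon> / 2)" using nn(2) by (simp add: powr_realpow)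
      also have "\<dots> = real n powr (real d + \<epsilon>)" by (simp add: powr_add[symmetric] add.commute)
      finally show False using n(2) G(3) unfolding \<Phi>0_def by linarith
    qed
    then obtain g where g: "g \<in> \<kappa> ` \<Phi>0" "b < card {\<phi> \<in> \<Phi>0. \<kappa> \<phi> = g}" by blast
    define X where "X = {v \<in> verts G. col v \<in> g ` V}"
    have XG: "X \<subseteq> verts G" unfolding X_def by blast
    have "col ` X \<subseteq> g ` V" unfolding X_def by blast
    then have "card (col ` X) \<le> card (g ` V)" using finV by (intro card_mono) auto
    also have "\<dots> \<le> h" unfolding h_def using finV by (rule card_image_le)
    finally have depth: "\<And>v. card {u. ancestor G \<rho> X u v} \<le> h" using col(3)[OF XG] by blast
    have "\<phi> \<in> V \<rightarrow>\<^sub>E X" if "\<phi> \<in> \<Phi>0" "\<kappa> \<phi> = g" for \<phi>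
    proof (rule PiE_I)
      fix x assume x: "x \<in> V"
      have "\<phi> \<in> V \<rightarrow>\<^sub>E verts G" using \<Phi>0(1) that(1) by blast
      then have "\<phi> x \<in> verts G" using x by (rule PiE_mem)
      moreover have "g x = col (\<phi> x)" using that(2) x unfolding \<kappa>_def by auto
      then have "col (\<phi> x) \<in> g ` V" using x by (metis imageI)
      ultimately show "\<phi> x \<in> X" unfolding X_def by blast
    next
      fix x assume "x \<notin> V"
      then show "\<phi> x = undefined" using \<Phi>0(1) that(1) by auto
    qed
    then have \<Phi>X: "{\<phi> \<in> \<Phi>0. \<kappa> \<phi> = g} \<subseteq> V \<rightarrow>\<^sub>E X" by blast
    have "card X \<le> n" using card_mono[OF wf_graph_finite[OF wf\<G>[OF G(1)]] XG] G(2) by simp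
    have "\<exists>c\<in>codes V (fst Q) N. \<exists>A\<in>Pow {..<N}. card A = Suc d \<and> host \<G> \<H> V c A k"
    proof (rule host_exists[OF \<G>(1)[OF G(1)] Q G(1) col(1) XG depth finV \<Phi>X _ \<open>card X \<le> n\<close> nn(2) k N_def K_def])
      show "(\<phi>, G) \<in> \<H>" if "\<phi> \<in> {\<phi> \<in> \<Phi>0. \<kappa> \<phi> = g}" for \<phi> using that unfolding \<Phi>0_def by simp
      show "card (codes V (fst Q) N) * (2 ^ N * (n ^ d * K ^ N)) < card {\<phi> \<in> \<Phi>0. \<kappa> \<phi> = g}"
        using g(2) unfolding b_def .
    qed
    then show ?thesis by auto
  qed
  \<comment> \<open>Codes and node sets range over a finite set that does not depend on
    \<open>k\<close>, so one pair serves infinitely many \<open>k\<close>.\<close>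
  have "infinite {k::nat. 0 < k}" by (simp add: greaterThan_def[symmetric] infinite_Ioi)
  then have "\<exists>p\<in>codes V (fst Q) N \<times> Pow {..<N}. infinite {k \<in> {k. 0 < k}. card (snd p) = Suc d \<and> host \<G> \<H> V (fst p) (snd p) k}"
    by (rule pigeonhole_infinite_rel[OF _ fin]) (use each in blast)
  then obtain p where p: "infinite {k \<in> {k. 0 < k}. card (snd p) = Suc d \<and> host \<G> \<H> V (fst p) (snd p) k}" by blast
  then have "card (snd p) = Suc d" using not_finite_existsD by blast
  moreover from this p have "infinite {k. 0 < k \<and> host \<G> \<H> (verts H) (fst p) (snd p) k}" unfolding V_def by simp
  ultimately show ?thesis
    using duplicable_if_infinitely_many_hosts[OF H lab\<G> \<G>(2) \<H>] by metis
qed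

section \<open>Lower bound by duplication\<close>

locale duplicated =
  fixes G :: "('v, 'x) lgraph" and \<M> :: "('v set \<times> 'v set) set" and k :: nat
  assumes lG: "labelled_graph G" and legG: "legal G" and ind: "independent_coll G \<M>" and k: "0 < k"
begin

abbreviation "Du \<equiv> duplicate G \<M> k"

definition flap :: "'v set \<times> 'v set \<Rightarrow> 'v set" where "flap s = verts G - snd s"

lemma flap_sep:
  assumes "s \<in> \<M>"
  shows "flap s = fst s - snd s" "u \<in> flap s \<Longrightarrow> v \<in> snd s - fst s \<Longrightarrow> (u, v) \<notin> edges G" "flap s \<noteq> {}"
proof -
  obtain A B where s: "s = (A, B)" by fastforce
  have sep: "A \<subseteq> verts G" "A \<union> B = verts G" "\<And>u v. u \<in> A - B \<Longrightarrow> v \<in> B - A \<Longrightarrow> (u, v) \<notin> edges G"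
    using bspec[OF conjunct1[OF ind[unfolded independent_coll_def]] assms] unfolding s separation_def by auto
  have ne: "A - B \<noteq> {}"
    using bspec[OF conjunct1[OF conjunct2[OF ind[unfolded independent_coll_def]]] assms] unfolding s by simp
  show eq: "flap s = fst s - snd s" unfolding flap_def s using sep(1,2) by auto
  show "u \<in> flap s \<Longrightarrow> v \<in> snd s - fst s \<Longrightarrow> (u, v) \<notin> edges G" unfolding eq unfolding s using sep(3) by simp
  show "flap s \<noteq> {}" unfolding eq using ne unfolding s by simp
qed

lemma flap_cross:
  assumes "s \<in> \<M>" "t \<in> \<M>" "s \<noteq> t"
  shows "fst s \<subseteq> snd t"
proof -
  obtain A B C D where s: "s = (A, B)" "t = (C, D)" by (metis surj_pair)
  have "\<forall>(A, B)\<in>\<M>. \<forall>(C, D)\<in>\<M>. (A, B) \<noteq> (C, D) \<longrightarrow> A \<subseteq> D \<and> C \<subseteq> B"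
    using ind unfolding independent_coll_def by (elim conjE)
  from bspec[OF this assms(1)] have "\<forall>(C, D)\<in>\<M>. (A, B) \<noteq> (C, D) \<longrightarrow> A \<subseteq> D \<and> C \<subseteq> B" unfolding s by simp
  from bspec[OF this assms(2)] show ?thesis using assms(3) unfolding s by simp
qed

lemma flap_unique: "s \<in> \<M> \<Longrightarrow> t \<in> \<M> \<Longrightarrow> v \<in> flap s \<Longrightarrow> v \<in> flap t \<Longrightarrow> s = t"
  using flap_cross flap_sep(1) by (metis DiffD1 DiffD2 subsetD)

lemma flap_nonadjacent:
  assumes "s \<in> \<M>" "t \<in> \<M>" "s \<noteq> t" "u \<in> flap s" "v \<in> flap t"
  shows "(u, v) \<notin> edges G"
proof -
  have "v \<in> fst t" "v \<notin> snd t" using assms(5) flap_sep(1)[OF assms(2)] by auto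
  moreover have "fst t \<subseteq> snd s" "fst s \<subseteq> snd t" using flap_cross assms(1-3) by metis+
  ultimately have "v \<in> snd s - fst s" by blast
  then show ?thesis using flap_sep(2)[OF assms(1,4)] by blast
qed

lemma dup_core_flap: "v \<in> verts G \<Longrightarrow> v \<notin> dup_core \<M> G \<longleftrightarrow> (\<exists>s\<in>\<M>. v \<in> flap s)"
  unfolding dup_core_def flap_def by force

text \<open>The flap of \<open>s\<close> goes to copy \<open>c s\<close>. For a vertex in no flap
  the definite description is unspecified, which does no harm since \<open>dup_copy\<close> ignores
  the copy number on the core.\<close>

definition place :: "('v set \<times> 'v set \<Rightarrow> nat) \<Rightarrow> 'v \<Rightarrow> 'v \<times> nat" where
  "place c v = dup_copy \<M> G (c (THE s. s \<in> \<M> \<and> v \<in> flap s)) v"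

lemma fst_copy: "fst (dup_copy \<M> G i v) = v" unfolding dup_copy_def by simp

lemma fst_place: "fst (place c v) = v" unfolding place_def by (rule fst_copy)

lemma place_flap: "s \<in> \<M> \<Longrightarrow> v \<in> flap s \<Longrightarrow> place c v = dup_copy \<M> G (c s) v"
  unfolding place_def using flap_unique by (metis (mono_tags, lifting) the_equality)

lemma copy_flap: "s \<in> \<M> \<Longrightarrow> v \<in> flap s \<Longrightarrow> dup_copy \<M> G i v = (v, i)"
  using dup_core_flap[of v] unfolding dup_copy_def flap_def by auto

lemma copy_core: "v \<in> dup_core \<M> G \<Longrightarrow> dup_copy \<M> G i v = dup_copy \<M> G j v"
  unfolding dup_copy_def by simp

text \<open>Distinct flaps are disjoint and non-adjacent, so a clique meets at most one of them and
  is placed inside a single copy. Applied to edges and, by legality, to marches, this is why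
  independent choices per flap still yield a copy of \<open>G\<close>.\<close>

lemma place_clique:
  assumes M: "M \<subseteq> verts G" "\<And>u v. u \<in> M \<Longrightarrow> v \<in> M \<Longrightarrow> u \<noteq> v \<Longrightarrow> (u, v) \<in> edges G"
    and c: "\<And>s. s \<in> \<M> \<Longrightarrow> c s < k"
  shows "\<exists>i<k. \<forall>v\<in>M. place c v = dup_copy \<M> G i v"
proof (cases "\<exists>s\<in>\<M>. \<exists>u\<in>M. u \<in> flap s")
  case True
  then obtain s u where s: "s \<in> \<M>" "u \<in> M" "u \<in> flap s" by blast
  have "place c v = dup_copy \<M> G (c s) v" if v: "v \<in> M" for v
  proof (cases "v \<in> dup_core \<M> G")
    case True
    then show ?thesis unfolding place_def by (rule copy_core)
  next
    case False
    then obtain t where t: "t \<in> \<M>" "v \<in> flap t" using dup_core_flap M(1) v by blast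
    have "t = s"
    proof (rule ccontr)
      assume "t \<noteq> s"
      moreover have "u \<noteq> v" using flap_unique[OF s(1) t(1) s(3)] t(2) calculation by blast
      ultimately show False using M(2)[OF s(2) v] flap_nonadjacent[OF s(1) t(1) _ s(3) t(2)] by blast
    qed
    then show ?thesis using place_flap[OF t] by simp
  qed
  then show ?thesis using c[OF s(1)] by blast
next
  case False
  then have "v \<in> dup_core \<M> G" if "v \<in> M" for v using dup_core_flap M(1) that by blast
  then have "\<forall>v\<in>M. place c v = dup_copy \<M> G 0 v" unfolding place_def using copy_core by blast
  then show ?thesis using k by blast
qed

lemma verts_Du: "verts Du = {dup_copy \<M> G i v | i v. i < k \<and> v \<in> verts G}"
  and edges_Du: "edges Du = {(dup_copy \<M> G i u, dup_copy \<M> G i v) | i u v. i < k \<and> (u, v) \<in> edges G}"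
  and lab_Du: "lab Du m' = (if \<exists>i<k. \<exists>m\<in>dom (lab G). m' = map (dup_copy \<M> G i) m then lab G (map fst m') else None)"
  unfolding duplicate_def by simp_all

lemma wfG: "wf_graph G" using lG unfolding labelled_graph_def by blast

lemma place_mem:
  assumes v: "v \<in> verts G" and c: "\<And>s. s \<in> \<M> \<Longrightarrow> c s < k"
  shows "place c v \<in> verts Du"
proof -
  have "\<exists>i<k. \<forall>u\<in>{v}. place c u = dup_copy \<M> G i u" by (rule place_clique) (use v c in auto)
  then show ?thesis unfolding verts_Du using v by blast
qed

text \<open>The first projection undoes \<open>place c\<close>. It also sends edges and labelled
  marches of the duplication back to those of \<open>G\<close>, so the image gains nothing
  new.\<close>

lemma place_iso:
  assumes \<iota>: "lisomorphism \<iota> Du G'" and lG': "labelled_graph G'" and c: "\<And>s. s \<in> \<M> \<Longrightarrow> c s < k"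
  shows "lisomorphism (\<iota> \<circ> place c) G (ind_sub G' ((\<iota> \<circ> place c) ` verts G))"
proof -
  define W where "W = (\<iota> \<circ> place c) ` verts G"
  have bij: "bij_betw \<iota> (verts Du) (verts G')" using \<iota> unfolding lisomorphism_def by blast
  have eds: "\<And>u v. u \<in> verts Du \<Longrightarrow> v \<in> verts Du \<Longrightarrow> (u, v) \<in> edges Du \<longleftrightarrow> (\<iota> u, \<iota> v) \<in> edges G'"
    using \<iota> unfolding lisomorphism_def by blast
  have lab1: "\<And>m. m \<in> dom (lab Du) \<Longrightarrow> map \<iota> m \<in> dom (lab G') \<and> lab Du m = lab G' (map \<iota> m)"
    using \<iota> unfolding lisomorphism_def by blast
  have lab2: "\<And>m'. m' \<in> dom (lab G') \<Longrightarrow> map (inv_into (verts Du) \<iota>) m' \<in> dom (lab Du)"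
    using \<iota> unfolding lisomorphism_def by blast
  have inj\<iota>: "inj_on \<iota> (verts Du)" using bij unfolding bij_betw_def by blast
  have pm: "place c v \<in> verts Du" if "v \<in> verts G" for v by (rule place_mem[OF that c])
  have inj: "inj_on (\<iota> \<circ> place c) (verts G)"
  proof (rule inj_onI)
    fix u v assume uv: "u \<in> verts G" "v \<in> verts G" "(\<iota> \<circ> place c) u = (\<iota> \<circ> place c) v"
    then have "place c u = place c v" using inj_onD[OF inj\<iota>] pm by simp
    then show "u = v" using fst_place by metis
  qed
  have edge: "(u, v) \<in> edges G \<longleftrightarrow> ((\<iota> \<circ> place c) u, (\<iota> \<circ> place c) v) \<in> edges (ind_sub G' W)"
    if uv: "u \<in> verts G" "v \<in> verts G" for u v
  proof -
    have "(u, v) \<in> edges G \<longleftrightarrow> (place c u, place c v) \<in> edges Du"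
    proof
      assume e: "(u, v) \<in> edges G"
      have "\<exists>i<k. \<forall>x\<in>{u, v}. place c x = dup_copy \<M> G i x"
        by (rule place_clique) (use e uv c wf_graph_sym[OF wfG e] in auto)
      then show "(place c u, place c v) \<in> edges Du" unfolding edges_Du using e by blast
    next
      assume "(place c u, place c v) \<in> edges Du"
      then obtain i u' v' where *: "(u', v') \<in> edges G" "place c u = dup_copy \<M> G i u'" "place c v = dup_copy \<M> G i v'"
        unfolding edges_Du by blast
      then have "u' = u" "v' = v" using fst_place fst_copy by metis+
      then show "(u, v) \<in> edges G" using * by simp
    qed
    also have "\<dots> \<longleftrightarrow> (\<iota> (place c u), \<iota> (place c v)) \<in> edges G'" by (rule eds[OF pm[OF uv(1)] pm[OF uv(2)]])
    finally show ?thesis unfolding W_def using uv by simp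
  qed
  have l1: "map (\<iota> \<circ> place c) m \<in> dom (lab (ind_sub G' W)) \<and> lab G m = lab (ind_sub G' W) (map (\<iota> \<circ> place c) m)"
    if m: "m \<in> dom (lab G)" for m
  proof -
    have mV: "set m \<subseteq> verts G" using labelled_graph_march[OF lG] m by blast
    have "\<exists>i<k. \<forall>v\<in>set m. place c v = dup_copy \<M> G i v"
      by (rule place_clique[OF mV _ c]) (use legG m in \<open>auto simp: legal_def\<close>)
    then obtain i where i: "i < k" "map (place c) m = map (dup_copy \<M> G i) m" by auto
    have f: "map fst (map (place c) m) = m" using fst_place by (simp add: map_idI)
    have "lab Du (map (place c) m) = lab G (map fst (map (place c) m))"
    proof -
      have "\<exists>i<k. \<exists>m'\<in>dom (lab G). map (place c) m = map (dup_copy \<M> G i) m'" using i m by blast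
      then show ?thesis by (simp only: lab_Du if_True)
    qed
    then have eq: "lab Du (map (place c) m) = lab G m" unfolding f .
    then have "map (place c) m \<in> dom (lab Du)" using m by auto
    from lab1[OF this] have "lab G' (map (\<iota> \<circ> place c) m) = lab G m" using eq by simp
    moreover have "set (map (\<iota> \<circ> place c) m) \<subseteq> W" unfolding W_def using mV by auto
    ultimately show ?thesis using m by auto
  qed
  have l2: "map (inv_into (verts G) (\<iota> \<circ> place c)) m' \<in> dom (lab G)" if m': "m' \<in> dom (lab (ind_sub G' W))" for m'
  proof -
    have *: "m' \<in> dom (lab G')" "set m' \<subseteq> W" using m' by (auto split: if_splits)
    have "map (inv_into (verts Du) \<iota>) m' \<in> dom (lab Du)" by (rule lab2[OF *(1)])
    then obtain i m0 where m0: "m0 \<in> dom (lab G)" "map (inv_into (verts Du) \<iota>) m' = map (dup_copy \<M> G i) m0"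
      using lab_Du[of "map (inv_into (verts Du) \<iota>) m'"] by (auto split: if_splits)
    have "inv_into (verts G) (\<iota> \<circ> place c) w = fst (inv_into (verts Du) \<iota> w)" if w: "w \<in> W" for w
    proof -
      obtain v where v: "v \<in> verts G" "w = (\<iota> \<circ> place c) v" using w unfolding W_def by blast
      have "inv_into (verts G) (\<iota> \<circ> place c) w = v" unfolding v(2) by (rule inv_into_f_f[OF inj v(1)])
      moreover have "inv_into (verts Du) \<iota> w = place c v" unfolding v(2) o_def by (rule inv_into_f_f[OF inj\<iota> pm[OF v(1)]])
      ultimately show ?thesis using fst_place by simp
    qed
    then have "map (inv_into (verts G) (\<iota> \<circ> place c)) m' = map fst (map (inv_into (verts Du) \<iota>) m')" using *(2) by auto
    also have "\<dots> = m0" unfolding m0(2) using fst_copy by (simp add: map_idI)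
    finally show ?thesis using m0(1) by simp
  qed
  show ?thesis unfolding W_def[symmetric] lisomorphism_def
  proof (intro conjI ballI)
    show "bij_betw (\<iota> \<circ> place c) (verts G) (verts (ind_sub G' W))" using inj unfolding bij_betw_def W_def by simp
  qed (use edge l1 l2 in blast)+
qed

lemma card_verts_Du: "card (verts Du) \<le> k * card (verts G)" "\<M> \<noteq> {} \<Longrightarrow> k \<le> card (verts Du)" "finite (verts Du)"
proof -
  have finV: "finite (verts G)" by (rule wf_graph_finite[OF wfG])
  have eq: "verts Du = (\<lambda>(i, v). dup_copy \<M> G i v) ` ({..<k} \<times> verts G)" unfolding verts_Du by auto
  show fin: "finite (verts Du)" unfolding eq using finV by simp
  show "card (verts Du) \<le> k * card (verts G)"
    unfolding eq using card_image_le[of "{..<k} \<times> verts G" "\<lambda>(i, v). dup_copy \<M> G i v"] finV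
    by (simp add: card_cartesian_product)
  assume "\<M> \<noteq> {}"
  then obtain s v where s: "s \<in> \<M>" "v \<in> flap s" using flap_sep(3) by blast
  have "(\<lambda>i. (v, i)) ` {..<k} \<subseteq> verts Du"
  proof
    fix x assume "x \<in> (\<lambda>i. (v, i)) ` {..<k}"
    then obtain i where "i < k" "x = (v, i)" by auto
    moreover have "v \<in> verts G" using s(2) unfolding flap_def by blast
    ultimately show "x \<in> verts Du" unfolding verts_Du using copy_flap[OF s, of i] by (metis (mono_tags, lifting) mem_Collect_eq)
  qed
  then have "card ((\<lambda>i. (v, i)) ` {..<k}) \<le> card (verts Du)" using fin by (rule card_mono[rotated])
  then show "k \<le> card (verts Du)" by (simp add: card_image inj_on_def)
qed

end

text \<open>Each choice of copies \<open>c\<close> composes \<open>\<phi>\<close> with an induced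
  copy of \<open>G\<close> inside \<open>G'\<close>; CON2 admits the homomorphism to that copy and
  CON1 extends its codomain to \<open>G'\<close>. As \<open>\<phi>\<close> is onto, some vertex of
  \<open>H\<close> is sent into each flap and reveals \<open>c\<close>, so distinct choices give
  distinct homomorphisms.\<close>

lemma many_homs_if_duplicated:
  fixes H :: "('h, 'x) lgraph" and \<G> :: "('v, 'x) lgraph set"
  assumes H: "wf_graph H" and \<G>: "\<forall>G\<in>\<G>. labelled_graph G \<and> legal G" "hereditary \<G>"
    and \<H>: "hom_set Q H \<G> \<H>" "consistent Q H \<G> \<H>"
    and \<phi>: "(\<phi>, G) \<in> \<H>" "\<phi> ` verts H = verts G"
    and \<M>: "independent_coll G \<M>" "finite \<M>" and k: "0 < k"
    and G': "G' \<in> \<G>" "isomorphic (duplicate G \<M> k) G'"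
  shows "k ^ card \<M> \<le> card {\<phi>. (\<phi>, G') \<in> \<H>}" "card (verts G') \<le> k * card (verts G)" "\<M> \<noteq> {} \<Longrightarrow> k \<le> card (verts G')"
proof -
  have G\<G>: "G \<in> \<G>" by (rule hom_setD(1)[OF \<H>(1) \<phi>(1)])
  interpret duplicated G \<M> k by unfold_locales (use \<G>(1) G\<G> \<M>(1) k in auto)
  obtain \<iota> where \<iota>: "lisomorphism \<iota> Du G'" using G'(2) unfolding isomorphic_def by blast
  have bij: "bij_betw \<iota> (verts Du) (verts G')" using \<iota> unfolding lisomorphism_def by blast
  have lG': "labelled_graph G'" using \<G>(1) G'(1) by blast
  have "card (verts G') = card (verts Du)" using bij_betw_same_card[OF bij] by simp
  then show "card (verts G') \<le> k * card (verts G)" "\<M> \<noteq> {} \<Longrightarrow> k \<le> card (verts G')" using card_verts_Du by auto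
  define F where "F c = restrict ((\<iota> \<circ> place c) \<circ> \<phi>) (verts H)" for c
  have F: "(F c, G') \<in> \<H>" if c: "c \<in> \<M> \<rightarrow>\<^sub>E {..<k}" for c
  proof -
    have ck: "c s < k" if "s \<in> \<M>" for s using c that by auto
    define W where "W = (\<iota> \<circ> place c) ` verts G"
    have WG': "W \<subseteq> verts G'" unfolding W_def using place_mem[OF _ ck] bij_betwE[OF bij] by auto
    have iso: "lisomorphism (\<iota> \<circ> place c) G (ind_sub G' W)" unfolding W_def by (rule place_iso[OF \<iota> lG' ck])
    have indW: "induced_subgraph (ind_sub G' W) G'" by (rule induced_subgraph_ind_sub[OF lG' WG'])
    then have W\<G>: "ind_sub G' W \<in> \<G>" using \<G>(2) G'(1) unfolding hereditary_def by blast
    have con2: "\<forall>G1\<in>\<G>. \<forall>G2\<in>\<G>. \<forall>\<iota> \<phi>. lisomorphism \<iota> G1 G2 \<and> (\<phi>, G1) \<in> \<H> \<longrightarrow> (restrict (\<iota> \<circ> \<phi>) (verts H), G2) \<in> \<H>"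
      using \<H>(2) unfolding consistent_def by (elim conjE)
    have FW: "(F c, ind_sub G' W) \<in> \<H>" unfolding F_def using con2 G\<G> W\<G> iso \<phi>(1) by blast
    have con1: "\<forall>(\<phi>, G)\<in>\<H>.
        (\<forall>G'. induced_subgraph G' G \<and> \<phi> ` verts H \<subseteq> verts G' \<longrightarrow> lhom Q H G' \<phi> \<and> (\<phi>, G') \<in> \<H>) \<and>
        (\<forall>G'\<in>\<G>. induced_subgraph G G' \<longrightarrow> lhom Q H G' \<phi> \<and> (\<phi>, G') \<in> \<H>)"
      using \<H>(2) unfolding consistent_def by (elim conjE)
    from bspec[OF con1 FW] show ?thesis using indW G'(1) by simp
  qed
  have "inj_on F (\<M> \<rightarrow>\<^sub>E {..<k})"
  proof (rule inj_onI)
    fix c d assume c: "c \<in> \<M> \<rightarrow>\<^sub>E {..<k}" and d: "d \<in> \<M> \<rightarrow>\<^sub>E {..<k}" and eq: "F c = F d"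
    have ck: "c s < k" "d s < k" if "s \<in> \<M>" for s using c d that by auto
    show "c = d"
    proof (rule PiE_ext[OF c d])
      fix s assume s: "s \<in> \<M>"
      then obtain v where v: "v \<in> flap s" using flap_sep(3) by blast
      then have vG: "v \<in> verts G" unfolding flap_def by blast
      then obtain x where x: "x \<in> verts H" "v = \<phi> x" using \<phi>(2) by blast
      have "F c x = F d x" using eq by simp
      then have "\<iota> (place c v) = \<iota> (place d v)" unfolding F_def using x by simp
      moreover have "place c v \<in> verts Du" "place d v \<in> verts Du" using place_mem[OF vG] ck by blast+
      ultimately have "place c v = place d v" using bij unfolding bij_betw_def by (auto dest: inj_onD)
      then show "c s = d s" using place_flap[OF s v] copy_flap[OF s v] by simp
    qed
  qed
  then have "card (\<M> \<rightarrow>\<^sub>E {..<k}) \<le> card {\<phi>. (\<phi>, G') \<in> \<H>}"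
    by (rule card_inj_on_le) (use F homs_bounded(2)[OF H _ \<H>(1)] \<G>(1) in \<open>auto simp: labelled_graph_def\<close>)
  then show "k ^ card \<M> \<le> card {\<phi>. (\<phi>, G') \<in> \<H>}" using \<M>(2) by (simp add: card_PiE)
qed

section \<open>From duplications to the growth exponent of the counts\<close>

lemma dupH_set_finite:
  assumes "finite (verts H)"
  shows "finite {card \<L> | \<L>. independent_coll H \<L> \<and> GH_duplicable H \<G> \<H> \<L>}"
proof -
  have sub: "\<L> \<subseteq> Pow (verts H) \<times> Pow (verts H)" if "independent_coll H \<L>" for \<L>
  proof
    fix s assume "s \<in> \<L>"
    then have "separation H s" using that unfolding independent_coll_def by blast
    then show "s \<in> Pow (verts H) \<times> Pow (verts H)" unfolding separation_def by (cases s) auto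
  qed
  have fin: "finite (Pow (Pow (verts H) \<times> Pow (verts H)))" using assms by simp
  have "{card \<L> | \<L>. independent_coll H \<L> \<and> GH_duplicable H \<G> \<H> \<L>} \<subseteq> card ` Pow (Pow (verts H) \<times> Pow (verts H))"
    using sub by blast
  then show ?thesis using fin by (meson finite_imageI finite_subset)
qed

text \<open>A duplication with \<open>k\<close> copies has between \<open>k\<close> and
  \<open>k * g\<close> vertices, where \<open>g\<close> is the order of \<open>G\<close>. The upper
  bound keeps \<open>k\<close> at least \<open>n / g\<close>; the lower bound, which rests on a
  non-empty collection and so on a positive \<open>dupH\<close>, makes the orders \<open>n\<close>
  unbounded.\<close>

lemma infinitely_many_large_counts:
  fixes H :: "('h, 'x) lgraph" and \<G> :: "('v, 'x) lgraph set"
  assumes H: "wf_graph H" and \<G>: "\<forall>G\<in>\<G>. labelled_graph G \<and> legal G" "hereditary \<G>"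
    and \<H>: "hom_set Q H \<G> \<H>" "consistent Q H \<G> \<H>"
    and d: "0 < dupH H \<H> \<G>"
  shows "\<exists>g>0. \<forall>m. \<exists>n\<ge>m. \<exists>k>0. n \<le> k * g \<and> k ^ dupH H \<H> \<G> \<le> ex_count H \<H> \<G> n"
proof -
  let ?S = "{card \<L> | \<L>. independent_coll H \<L> \<and> GH_duplicable H \<G> \<H> \<L>}"
  have "?S \<noteq> {}"
  proof
    assume "?S = {}"
    then show False using d unfolding dupH_def by (simp only: Sup_nat_def simp_thms if_True less_irrefl)
  qed
  then have "Sup ?S \<in> ?S"
    using Max_in[OF dupH_set_finite[OF wf_graph_finite[OF H]] \<open>?S \<noteq> {}\<close>] by (simp only: Sup_nat_def if_False)
  then obtain \<L> where \<L>: "GH_duplicable H \<G> \<H> \<L>" "card \<L> = dupH H \<H> \<G>" unfolding dupH_def by auto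
  from \<L>(1) obtain \<phi> G where \<phi>: "(\<phi>, G) \<in> \<H>" "\<phi> ` verts H = verts G"
    and *: "let \<L>' = (\<lambda>(A, B). (closed_nbhd G (\<phi> ` (A - B)), verts G - \<phi> ` (A - B))) ` \<L>
         in independent_coll G \<L>' \<and> class_duplicable \<G> G \<L>' \<and> card \<L>' = card \<L>"
    unfolding GH_duplicable_def by (elim exE conjE) (rule that)
  define \<M> where "\<M> = (\<lambda>(A, B). (closed_nbhd G (\<phi> ` (A - B)), verts G - \<phi> ` (A - B))) ` \<L>"
  have \<M>: "independent_coll G \<M>" "class_duplicable \<G> G \<M>" "card \<M> = dupH H \<H> \<G>"
    using * \<L>(2) unfolding \<M>_def Let_def by auto
  have fin\<M>: "finite \<M>" by (rule ccontr) (use \<M>(3) d in simp)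
  have ne: "\<M> \<noteq> {}" using \<M>(3) d by auto
  have wf\<G>: "\<And>G. G \<in> \<G> \<Longrightarrow> wf_graph G" using \<G>(1) unfolding labelled_graph_def by blast
  have *: "\<exists>n\<ge>m. \<exists>k>0. n \<le> k * card (verts G) \<and> k ^ dupH H \<H> \<G> \<le> ex_count H \<H> \<G> n" for m
  proof -
    have "infinite {k::nat. 0 < k \<and> (\<exists>G'\<in>\<G>. isomorphic (duplicate G \<M> k) G')}" using \<M>(2) unfolding class_duplicable_def .
    then obtain k where "m \<le> k" "k \<in> {k::nat. 0 < k \<and> (\<exists>G'\<in>\<G>. isomorphic (duplicate G \<M> k) G')}"
      unfolding infinite_nat_iff_unbounded_le by blast
    then obtain G' where k: "m \<le> k" "0 < k" and G': "G' \<in> \<G>" "isomorphic (duplicate G \<M> k) G'" by blast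
    note mh = many_homs_if_duplicated[OF H \<G> \<H> \<phi> \<M>(1) fin\<M> k(2) G']
    have "m \<le> card (verts G')" using mh(3)[OF ne] k(1) by linarith
    moreover have "k ^ dupH H \<H> \<G> \<le> ex_count H \<H> \<G> (card (verts G'))"
    proof -
      have "card {\<phi>. (\<phi>, G') \<in> \<H>} \<le> ex_count H \<H> \<G> (card (verts G'))"
        by (rule ex_count_ge[OF H wf\<G> \<H>(1) G'(1)])
      then show ?thesis using mh(1) unfolding \<M>(3) by linarith
    qed
    ultimately show ?thesis using mh(2) k(2) by blast
  qed
  moreover have "0 < card (verts G)"
  proof (rule ccontr)
    assume "\<not> 0 < card (verts G)"
    then have "card (verts G) = 0" by simp
    then show False using *[of 1] by auto
  qed
  ultimately show ?thesis by blast
qed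

theorem mainTheorem4:
  fixes Q :: "'x qorder"
    and H :: "('h, 'x) lgraph"
    and \<G> :: "('v, 'x) lgraph set"
    and \<H> :: "(('h \<Rightarrow> 'v) \<times> ('v, 'x) lgraph) set"
  assumes "quasi_order Q" and "finite (fst Q)"
    and "legal_q_labelled Q H"
    and "\<forall>G\<in>\<G>. legal_q_labelled Q G"
    and "hereditary \<G>"
    and "nowhere_dense \<G>"
    and "hom_set Q H \<G> \<H>"
    and "consistent Q H \<G> \<H>"
  shows "limsup (\<lambda>n::nat. ereal (ln (real (ex_count H \<H> \<G> n)) / ln (real n)))
           = ereal (real (dupH H \<H> \<G>))"
proof -
  let ?f = "\<lambda>n::nat. ln (real (ex_count H \<H> \<G> n)) / ln (real n)"
  define d where "d = dupH H \<H> \<G>"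
  have H: "wf_graph H" using assms(3) unfolding legal_q_labelled_def q_labelled_def labelled_graph_def by blast
  have \<G>: "\<forall>G\<in>\<G>. labelled_graph G \<and> legal G" "\<And>G. G \<in> \<G> \<Longrightarrow> legal_q_labelled Q G"
    using assms(4) unfolding legal_q_labelled_def q_labelled_def by blast+
  have "limsup (\<lambda>n. ereal (?f n)) \<le> ereal (real d) + ereal \<epsilon>" if \<epsilon>: "0 < \<epsilon>" for \<epsilon> :: real
  proof -
    have "finite {n. real n powr (real d + \<epsilon>) < real (ex_count H \<H> \<G> n)}"
    proof (rule ccontr)
      assume "\<not> ?thesis"
      then obtain \<L> where "independent_coll H \<L>" "GH_duplicable H \<G> \<H> \<L>" "card \<L> = Suc d"
        using duplicable_if_many_homs[OF assms(2) H \<G>(2) assms(5-8) \<epsilon>, of d] by blast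
      then have "Suc d \<le> dupH H \<H> \<G>" unfolding dupH_def
        by (intro le_cSup_finite[OF dupH_set_finite[OF wf_graph_finite[OF H]]]) force
      then show False unfolding d_def by simp
    qed
    \<comment> \<open>Values of \<open>n\<close> below 2 are excluded because \<open>ln n\<close>
      must be positive there to act as a denominator.\<close>
    then have "finite ({n. real n powr (real d + \<epsilon>) < real (ex_count H \<H> \<G> n)} \<union> {..<2})" by simp
    then have "\<forall>\<^sub>F n in sequentially. n \<notin> {n. real n powr (real d + \<epsilon>) < real (ex_count H \<H> \<G> n)} \<union> {..<2}"
      unfolding cofinite_eq_sequentially[symmetric] eventually_cofinite by simp
    then have "\<forall>\<^sub>F n in sequentially. ereal (?f n) \<le> ereal (real d + \<epsilon>)"
    proof (rule eventually_mono)
      fix n assume "n \<notin> {n. real n powr (real d + \<epsilon>) < real (ex_count H \<H> \<G> n)} \<union> {..<2}"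
      then have n: "2 \<le> n" "real (ex_count H \<H> \<G> n) \<le> real n powr (real d + \<epsilon>)" by auto
      have lnn: "0 < ln (real n)" using n(1) by simp
      have "ln (real (ex_count H \<H> \<G> n)) \<le> (real d + \<epsilon>) * ln (real n)"
      \<comment> \<open>Without homomorphisms the logarithm is taken at 0, where \<open>ln\<close>
        has the value 0; the bound still holds.\<close>
      proof (cases "ex_count H \<H> \<G> n = 0")
        case True
        then show ?thesis using lnn \<epsilon> by simp
      next
        case False
        then have "ln (real (ex_count H \<H> \<G> n)) \<le> ln (real n powr (real d + \<epsilon>))" using n by (intro ln_mono) auto
        then show ?thesis using n(1) by (simp add: ln_powr)
      qed
      then show "ereal (?f n) \<le> ereal (real d + \<epsilon>)" using lnn by (simp add: divide_le_eq)
    qed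
    then have "limsup (\<lambda>n. ereal (?f n)) \<le> ereal (real d + \<epsilon>)" by (rule Limsup_bounded)
    then show ?thesis by simp
  qed
  then have upper: "limsup (\<lambda>n. ereal (?f n)) \<le> ereal (real d)" using ereal_le_epsilon2 by simp
  have lower: "ereal (real d) \<le> limsup (\<lambda>n. ereal (?f n))"
  proof (rule ccontr)
    assume "\<not> ?thesis"
    then have "limsup (\<lambda>n. ereal (?f n)) < ereal (real d)" by simp
    then obtain r where r: "limsup (\<lambda>n. ereal (?f n)) < ereal r" "ereal r < ereal (real d)" using ereal_dense2 by blast
    have "\<forall>\<^sub>F n in sequentially. ereal (?f n) < ereal r" by (rule Limsup_lessD[OF r(1)])
    then obtain m where m: "\<And>n. m \<le> n \<Longrightarrow> ?f n < r" unfolding eventually_sequentially by auto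
    have rd: "r < real d" using r(2) by simp
    show False
    proof (cases "d = 0")
      \<comment> \<open>Logarithms of natural numbers are non-negative here, as
        \<open>ln 0 = 0\<close>, so the quotient does not drop below 0.\<close>
      case True
      have "0 \<le> ?f (max m 1)"
      proof (rule divide_nonneg_nonneg)
        show "0 \<le> ln (real (ex_count H \<H> \<G> (max m 1)))" by (cases "ex_count H \<H> \<G> (max m 1) = 0") auto
      qed auto
      then show False using m[of "max m 1"] rd True by simp
    next
      case False
      then have "0 < dupH H \<H> \<G>" unfolding d_def by simp
      then obtain g where g: "0 < g" "\<And>m. \<exists>n\<ge>m. \<exists>k>0. n \<le> k * g \<and> k ^ d \<le> ex_count H \<H> \<G> n"
        using infinitely_many_large_counts[OF H \<G>(1) assms(5,7,8)] unfolding d_def by blast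
      \<comment> \<open>Replacing \<open>k\<close> by \<open>n / g\<close> costs
        \<open>d * ln g\<close>; this threshold makes the loss at most
        \<open>(d - r) * ln n\<close>.\<close>
      define B where "B = max (max m 2) (nat \<lceil>exp (real d * ln (real g) / (real d - r))\<rceil>)"
      obtain n k where n: "B \<le> n" "0 < k" "n \<le> k * g" "k ^ d \<le> ex_count H \<H> \<G> n" using g(2)[of B] by blast
      have nB: "m \<le> n" "2 \<le> n" "exp (real d * ln (real g) / (real d - r)) \<le> real n" using n(1) unfolding B_def by linarith+
      have lnn: "0 < ln (real n)" using nB(2) by simp
      have "real d * ln (real g) / (real d - r) \<le> ln (real n)" using nB(2,3) by (subst ln_ge_iff) auto
      then have 1: "real d * ln (real g) \<le> (real d - r) * ln (real n)" using rd by (simp add: pos_divide_le_eq mult.commute)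
      have "real n \<le> real k * real g" using n(3) by (metis of_nat_le_iff of_nat_mult)
      then have "ln (real n) \<le> ln (real k * real g)" using nB(2) n(2) g(1) by simp
      also have "\<dots> = ln (real k) + ln (real g)" using n(2) g(1) by (simp add: ln_mult)
      finally have "real d * ln (real n) \<le> real d * ln (real k) + real d * ln (real g)"
        by (metis distrib_left mult_left_mono of_nat_0_le_iff)
      moreover have "real d * ln (real k) \<le> ln (real (ex_count H \<H> \<G> n))"
      proof -
        have "real d * ln (real k) = ln (real (k ^ d))" using n(2) by (simp add: ln_realpow)
        also have "\<dots> \<le> ln (real (ex_count H \<H> \<G> n))"
        proof (rule ln_mono)
          show "0 < real (k ^ d)" using n(2) by simp
          show "real (k ^ d) \<le> real (ex_count H \<H> \<G> n)" using n(4) by (rule of_nat_mono)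
        qed
        finally show ?thesis .
      qed
      ultimately have "r * ln (real n) \<le> ln (real (ex_count H \<H> \<G> n))" using 1 by (simp add: algebra_simps)
      then have "r \<le> ?f n" using lnn by (simp add: le_divide_eq)
      then show False using m[OF nB(1)] by simp
    qed
  qed
  show ?thesis using upper lower unfolding d_def by (rule antisym)
qed

end
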